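(* Let $\mathbf M$ be a Bayesian network with input nodes, with CDAG $\mathbf G=(J,V,E)$ and joint Markov kernel $\mathbf P(X_V\Vert X_J)$. Then for all (not necessarily disjoint) $A,B,C\subseteq J\,\dot\cup\,V$: $$A\perp^{\mathrm{id}}_{\mathbf G}B\mid C\quad\implies\quad X_A\perp\!\!\!\perp_{\mathbf P(X_V\Vert X_J)}X_B\mid X_C.$$
   Context: Graphs. A conditional directed acyclic graph (CDAG) $\mathbf G=(J,V,E)$ consists of disjoint finite sets $J$ (input nodes) and $V$ (output nodes) and a set $E$ of directed edges $w\to v$ with $w\in J\cup V$, $v\in V$, such that the directed graph $(J\cup V,E)$ is acyclic. $\mathrm{Pa}^{\mathbf G}(v)$ is the set of parents of $v$; $\mathrm{Anc}^{\mathbf G}(C)$ is the set of nodes having a directed walk (possibly trivial) to some node in $C$. A walk $\pi$ is a finite sequence $v_0,\dots,v_n$ ($n\ge0$) of nodes together with, for each $k$, an edge between $v_{k-1}$ and $v_k$ in either direction; repetitions are allowed. A position $k$ is a collider of $\pi$ if $0<k<n$ and $v_{k-1}\to v_k\leftarrow v_{k+1}$; all other positions, including both end nodes, are non-colliders. $\pi$ is d-blocked by $C$ if some non-collider of $\pi$ lies in $C$ or some collider of $\pi$ lies outside $\mathrm{Anc}^{\mathbf G}(C)$. $A\perp^{d}_{\mathbf G}B\mid C$ means every walk from a node in $A$ to a node in $B$ is d-blocked by $C$. Id-separation: $A\perp^{\mathrm{id}}_{\mathbf G}B\mid C:\iff A\perp^{d}_{\mathbf G}B\cup J\mid C$. Kernels.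 A Markov kernel $\mathcal T\dashrightarrow\mathcal W$ between measurable spaces is a map assigning to each $t\in\mathcal T$ a probability measure on $\mathcal W$, measurable in $t$ on each measurable subset of $\mathcal W$. The product $\mathbf Q\otimes\mathbf K$ of two kernels integrates the left kernel against the right one over those arguments of the left kernel that are outputs of the right one; all outputs of both are kept, all remaining arguments become inputs. Bayesian networks. A Bayesian network with input nodes $\mathbf M$ consists of a CDAG $\mathbf G=(J,V,E)$, a measurable space $\mathcal X_v$ for every $v\in J\cup V$, where $\mathcal X_v$ is standard (measurably isomorphic to a Borel subset of $[0,1]$) if $v\in V$ (no assumption for $v\in J$), and for each $v\in V$ a Markov kernel $\mathbf P_v(X_v\Vert X_{\mathrm{Pa}^{\mathbf G}(v)}):\mathcal X_{\mathrm{Pa}^{\mathbf G}(v)}\dashrightarrow\mathcal X_v$, where $\mathcal X_D:=\prod_{v\in D}\mathcal X_v$ (and $\mathcal X_\emptyset$ is a one-point space). Its joint Markov kernel $\mathbf P(X_V\Vert X_J):\mathcal X_J\dashrightarrow\mathcal X_V$ is the product of the kernels $\mathbf P_v$, $v\in V$, taken in reverse order of a topological order (children to the left of their parents); it does not depend on the topological order. Transitional conditional independence. For $S\subseteq J\cup V$ let $X_S:\mathcal X_V\times\mathcal X_J\to\mathcal X_S$ be the coordinate projection. For $x_J\in\mathcal X_J$ let $\mathbf P(X_A,X_B,X_C\Vert X_J=x_J)$ be the law of $(X_A,X_B,X_C)(x_V,x_J)$ when $x_V\sim\mathbf P(X_V\Vert X_J=x_J)$. Then $X_A\perp\!\!\!\perp_{\mathbf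 P(X_V\Vert X_J)}X_B\mid X_C$ means: there exists a Markov kernel $\mathbf Q(X_A|X_C):\mathcal X_C\dashrightarrow\mathcal X_A$ (not depending on $x_J$ otherwise) with $\mathbf P(X_A,X_B,X_C\Vert X_J)=\mathbf Q(X_A|X_C)\otimes\mathbf P(X_B,X_C\Vert X_J)$, i.e. for every $x_J\in\mathcal X_J$ and measurable sets $F,G,H$ in $\mathcal X_A,\mathcal X_B,\mathcal X_C$: $\mathbf P(X_A\in F,X_B\in G,X_C\in H\Vert X_J=x_J)=\int\mathbf 1_G(x_B)\mathbf 1_H(x_C)\mathbf Q(X_A\in F|X_C=x_C)\,\mathbf P((X_B,X_C)\in d(x_B,x_C)\Vert X_J=x_J)$. *)

theory Defs
  imports "HOL-Probability.Probability"
begin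

section \<open>Conditional directed acyclic graphs and id-separation\<close>

locale cdag =
  fixes J :: "'n set" and V :: "'n set" and E :: "('n \<times> 'n) set"
  assumes finite_J: "finite J"
    and finite_V: "finite V"
    and disjoint: "J \<inter> V = {}"
    and edges: "E \<subseteq> (J \<union> V) \<times> V"
    and acyclic: "acyclic E"

definition parents :: "('n \<times> 'n) set \<Rightarrow> 'n \<Rightarrow> 'n set" where
  "parents E v = {w. (w, v) \<in> E}"

definition ancestors :: "('n \<times> 'n) set \<Rightarrow> 'n set \<Rightarrow> 'n set" where
  "ancestors E C = {u. \<exists>c\<in>C. (u, c) \<in> E\<^sup>*}"

text \<open>A walk is given by its list \<open>ns\<close> of nodes and its list \<open>es\<close> of edges, where \<open>es ! k\<close> is the
  directed edge, traversed in either direction, between positions \<open>k\<close> and \<open>Suc k\<close>.\<close>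

definition is_walk :: "'n set \<Rightarrow> ('n \<times> 'n) set \<Rightarrow> 'n list \<Rightarrow> ('n \<times> 'n) list \<Rightarrow> bool" where
  "is_walk N E ns es \<longleftrightarrow>
     length ns = Suc (length es) \<and> set ns \<subseteq> N \<and> set es \<subseteq> E \<and>
     (\<forall>k < length es. es ! k = (ns ! k, ns ! Suc k) \<or> es ! k = (ns ! Suc k, ns ! k))"

definition is_collider :: "'n list \<Rightarrow> ('n \<times> 'n) list \<Rightarrow> nat \<Rightarrow> bool" where
  "is_collider ns es k \<longleftrightarrow>
     0 < k \<and> k < length es \<and>
     es ! (k - 1) = (ns ! (k - 1), ns ! k) \<and> es ! k = (ns ! Suc k, ns ! k)"

definition d_blocked :: "('n \<times> 'n) set \<Rightarrow> 'n list \<Rightarrow> ('n \<times> 'n) list \<Rightarrow> 'n set \<Rightarrow> bool" where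
  "d_blocked E ns es C \<longleftrightarrow>
     (\<exists>k < length ns. \<not> is_collider ns es k \<and> ns ! k \<in> C) \<or>
     (\<exists>k < length ns. is_collider ns es k \<and> ns ! k \<notin> ancestors E C)"

definition d_separated :: "'n set \<Rightarrow> ('n \<times> 'n) set \<Rightarrow> 'n set \<Rightarrow> 'n set \<Rightarrow> 'n set \<Rightarrow> bool" where
  "d_separated N E A B C \<longleftrightarrow>
     (\<forall>ns es. is_walk N E ns es \<and> hd ns \<in> A \<and> last ns \<in> B \<longrightarrow> d_blocked E ns es C)"

definition id_separated ::
  "'n set \<Rightarrow> 'n set \<Rightarrow> ('n \<times> 'n) set \<Rightarrow> 'n set \<Rightarrow> 'n set \<Rightarrow> 'n set \<Rightarrow> bool" where
  "id_separated J V E A B C \<longleftrightarrow> d_separated (J \<union> V) E A (B \<union> J) C"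

definition topological_order :: "'n set \<Rightarrow> ('n \<times> 'n) set \<Rightarrow> 'n list \<Rightarrow> bool" where
  "topological_order V E vs \<longleftrightarrow>
     distinct vs \<and> set vs = V \<and>
     (\<forall>i < length vs. \<forall>j < length vs. (vs ! i, vs ! j) \<in> E \<longrightarrow> i < j)"


lemma (in cdag) ex_topological_order: "\<exists>vs. topological_order V E vs"
proof -
  have "\<exists>vs. topological_order W E vs" if "finite W" "W \<subseteq> V" for W
    using that
  proof (induction W rule: finite_psubset_induct)
    case (psubset W)
    show ?case
    proof (cases "W = {}")
      case True
      then show ?thesis by (intro exI[of _ "[]"]) (simp add: topological_order_def)
    next
      case False
      let ?R = "E \<inter> W \<times> W"
      have "acyclic ?R" using acyclic by (rule acyclic_subset) blast
      moreover have "finite ?R" using psubset.hyps by simp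
      ultimately have "wf (?R\<inverse>)" by (rule finite_acyclic_wf_converse[rotated])
      from wfE_min'[OF this False]
      obtain m where m: "m \<in> W" "\<And>y. (y, m) \<in> ?R\<inverse> \<Longrightarrow> y \<notin> W"
        by blast
      have "\<exists>vs. topological_order (W - {m}) E vs"
      proof (rule psubset.IH)
        show "W - {m} \<subset> W" using m(1) by auto
        show "W - {m} \<subseteq> V" using psubset.prems by auto
      qed
      then obtain vs where vs: "topological_order (W - {m}) E vs" ..
      have nm: "(m, y) \<notin> E" if "y \<in> W" for y using m(1) m(2)[of y] that by auto
      have dist: "distinct vs" "set vs = W - {m}"
        and ord: "\<And>i j. \<lbrakk>i < length vs; j < length vs; (vs ! i, vs ! j) \<in> E\<rbrakk> \<Longrightarrow> i < j"
        using vs by (auto simp: topological_order_def)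
      have "i < j" if ij: "i < length (vs @ [m])" "j < length (vs @ [m])"
        "((vs @ [m]) ! i, (vs @ [m]) ! j) \<in> E" for i j
      proof (cases "i < length vs")
        case True
        then show ?thesis using ij ord[of i j] by (cases "j < length vs") (auto simp: nth_append)
      next
        case False
        then have "(vs @ [m]) ! i = m" using ij by (simp add: nth_append)
        with ij(3) have "(m, (vs @ [m]) ! j) \<in> E" by (simp only:)
        moreover have "set (vs @ [m]) = W" using dist(2) m(1) by auto
        then have "(vs @ [m]) ! j \<in> W" using nth_mem[OF ij(2)] by (simp only:)
        ultimately show ?thesis using nm by blast
      qed
      moreover have "distinct (vs @ [m])" "set (vs @ [m]) = W" using dist m(1) by auto
      ultimately have "topological_order W E (vs @ [m])"
        unfolding topological_order_def by blast
      then show ?thesis ..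
    qed
  qed
  then show ?thesis using finite_V by blast
qed


section \<open>Standard measurable spaces and Markov kernels\<close>

text \<open>A measurable space is represented by a measure of which only the underlying space and
  sigma-algebra matter. A Markov kernel from \<open>S\<close> to \<open>T\<close> is an element of
  \<open>S \<rightarrow>\<^sub>M prob_algebra T\<close>.\<close>

definition measurably_isomorphic :: "'a measure \<Rightarrow> 'b measure \<Rightarrow> bool" where
  "measurably_isomorphic M N \<longleftrightarrow>
     (\<exists>f \<in> M \<rightarrow>\<^sub>M N. \<exists>g \<in> N \<rightarrow>\<^sub>M M.
        (\<forall>x \<in> space M. g (f x) = x) \<and> (\<forall>y \<in> space N. f (g y) = y))"

definition standard_space :: "'a measure \<Rightarrow> bool" where
  "standard_space M \<longleftrightarrow>
     (\<exists>S \<in> sets (borel :: real measure). S \<subseteq> {0..1} \<and>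
        measurably_isomorphic M (restrict_space borel S))"

text \<open>The product \<open>Q \<otimes> K\<close> of \<open>Q\<close>, with inputs \<open>I1\<close> and outputs \<open>O1\<close>, and \<open>K\<close>, with inputs \<open>I2\<close>
  and outputs \<open>O2\<close>, where \<open>O1\<close> and \<open>O2\<close> are disjoint. Its inputs are \<open>(I1 - O2) \<union> I2\<close>, its outputs
  \<open>O1 \<union> O2\<close>: first \<open>y\<close> is drawn from \<open>K\<close>, then \<open>z\<close> from \<open>Q\<close>, whose arguments are read off \<open>y\<close>
  where they are outputs of \<open>K\<close> and off the input \<open>x\<close> otherwise.\<close>

definition kernel_prod ::
  "('n \<Rightarrow> 'a measure) \<Rightarrow>
   'n set \<Rightarrow> 'n set \<Rightarrow> (('n \<Rightarrow> 'a) \<Rightarrow> ('n \<Rightarrow> 'a) measure) \<Rightarrow>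
   'n set \<Rightarrow> 'n set \<Rightarrow> (('n \<Rightarrow> 'a) \<Rightarrow> ('n \<Rightarrow> 'a) measure) \<Rightarrow>
   ('n \<Rightarrow> 'a) \<Rightarrow> ('n \<Rightarrow> 'a) measure" where
  "kernel_prod X I1 O1 Q I2 O2 K x =
     K (restrict x I2) \<bind> (\<lambda>y.
       distr (Q (restrict (merge O2 ((I1 - O2) \<union> I2) (y, x)) I1))
             (PiM (O1 \<union> O2) X) (\<lambda>z. merge O1 O2 (z, y)))"


lemma measurable_kernel_prod:
  assumes Q: "Q \<in> PiM I1 X \<rightarrow>\<^sub>M prob_algebra (PiM O1 X)"
    and K: "K \<in> PiM I2 X \<rightarrow>\<^sub>M prob_algebra (PiM O2 X)"
  shows "kernel_prod X I1 O1 Q I2 O2 K \<in>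
    PiM ((I1 - O2) \<union> I2) X \<rightarrow>\<^sub>M prob_algebra (PiM (O1 \<union> O2) X)"
proof -
  let ?I = "(I1 - O2) \<union> I2"
  have 1: "(\<lambda>x. K (restrict x I2)) \<in> PiM ?I X \<rightarrow>\<^sub>M prob_algebra (PiM O2 X)"
    by (rule measurable_compose[OF _ K], rule measurable_restrict_subset) auto
  have 2: "(\<lambda>(x,y). restrict (merge O2 ?I (y, x)) I1) \<in> PiM ?I X \<Otimes>\<^sub>M PiM O2 X \<rightarrow>\<^sub>M PiM I1 X"
  proof -
    have "(\<lambda>p. merge O2 ?I (snd p, fst p)) \<in> PiM ?I X \<Otimes>\<^sub>M PiM O2 X \<rightarrow>\<^sub>M PiM (O2 \<union> ?I) X"
      by (rule measurable_compose[OF _ measurable_merge]) simp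
    from measurable_compose[OF this measurable_restrict_subset[of I1 "O2 \<union> ?I"]]
    show ?thesis by (auto simp: case_prod_beta)
  qed
  have 3: "(\<lambda>((x,y),z). merge O1 O2 (z,y)) \<in> (PiM ?I X \<Otimes>\<^sub>M PiM O2 X) \<Otimes>\<^sub>M PiM O1 X \<rightarrow>\<^sub>M PiM (O1 \<union> O2) X"
    unfolding case_prod_beta
    by (rule measurable_compose[OF _ measurable_merge]) simp
  show ?thesis
    unfolding kernel_prod_def
    apply (rule measurable_bind_prob_space2[OF 1])
    unfolding case_prod_beta
    apply (rule measurable_distr_prob_space2[where M = "PiM O1 X"])
    apply (rule measurable_compose[OF _ Q])
    using 2 apply (simp add: case_prod_beta)
    using 3 apply (simp add: case_prod_beta)
    done
qed


section \<open>Bayesian networks with input nodes\<close>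

locale bayes_net = cdag J V E
  for J :: "'n set" and V :: "'n set" and E :: "('n \<times> 'n) set" +
  fixes X :: "'n \<Rightarrow> 'a measure" and P :: "'n \<Rightarrow> ('n \<Rightarrow> 'a) \<Rightarrow> 'a measure"
  assumes standard: "\<And>v. v \<in> V \<Longrightarrow> standard_space (X v)"
    and kernel: "\<And>v. v \<in> V \<Longrightarrow> P v \<in> PiM (parents E v) X \<rightarrow>\<^sub>M prob_algebra (X v)"

text \<open>\<open>P v\<close> with its values transported along the canonical isomorphism from \<open>X v\<close> to
  \<open>PiM {v} X\<close>.\<close>

definition node_kernel ::
  "('n \<Rightarrow> 'a measure) \<Rightarrow> ('n \<Rightarrow> ('n \<Rightarrow> 'a) \<Rightarrow> 'a measure) \<Rightarrow> 'n \<Rightarrow>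
   ('n \<Rightarrow> 'a) \<Rightarrow> ('n \<Rightarrow> 'a) measure" where
  "node_kernel X P v x = distr (P v x) (PiM {v} X) (\<lambda>z. \<lambda>i\<in>{v}. z)"

text \<open>The product over a list of output nodes that has children to the left of their parents. The
  unit of the product, at the empty list, is the only kernel into the one-point space
  \<open>PiM {} X\<close>; taking it with inputs \<open>J\<close> makes every input node an input of the product, also one
  without children.\<close>

fun list_kernel ::
  "'n set \<Rightarrow> ('n \<times> 'n) set \<Rightarrow> ('n \<Rightarrow> 'a measure) \<Rightarrow> ('n \<Rightarrow> ('n \<Rightarrow> 'a) \<Rightarrow> 'a measure) \<Rightarrow>
   'n list \<Rightarrow> ('n \<Rightarrow> 'a) \<Rightarrow> ('n \<Rightarrow> 'a) measure" where
  "list_kernel J E X P [] = (\<lambda>x. return (PiM {} X) (\<lambda>_. undefined))"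
| "list_kernel J E X P (v # vs) =
     kernel_prod X (parents E v) {v} (node_kernel X P v) J (set vs) (list_kernel J E X P vs)"

definition joint_kernel ::
  "'n set \<Rightarrow> ('n \<times> 'n) set \<Rightarrow> ('n \<Rightarrow> 'a measure) \<Rightarrow> ('n \<Rightarrow> ('n \<Rightarrow> 'a) \<Rightarrow> 'a measure) \<Rightarrow>
   'n list \<Rightarrow> ('n \<Rightarrow> 'a) \<Rightarrow> ('n \<Rightarrow> 'a) measure" where
  "joint_kernel J E X P vs = list_kernel J E X P (rev vs)"

lemma (in bayes_net) measurable_joint_kernel:
  assumes "topological_order V E vs"
  shows "joint_kernel J E X P vs \<in> PiM J X \<rightarrow>\<^sub>M prob_algebra (PiM V X)"
proof -
  have ne: "node_kernel X P v \<in> PiM (parents E v) X \<rightarrow>\<^sub>M prob_algebra (PiM {v} X)" if "v \<in> V" for v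
    unfolding node_kernel_def
    by (rule measurable_distr_prob_space2[where M="X v"], rule kernel[OF that])
       (unfold case_prod_beta, rule measurable_restrict, auto)
  have "list_kernel J E X P (rev (take n vs)) \<in> PiM J X \<rightarrow>\<^sub>M prob_algebra (PiM (set (take n vs)) X)"
    if "n \<le> length vs" for n using that
  proof (induction n)
    case 0
    then show ?case
      by (simp add: measurable_const space_prob_algebra prob_space_return space_PiM_empty)
  next
    case (Suc n)
    have v: "vs ! n \<in> V" using assms Suc.prems by (auto simp: topological_order_def)
    have "parents E (vs!n) - set (take n vs) \<subseteq> J"
    proof
      fix w assume w: "w \<in> parents E (vs!n) - set (take n vs)"
      then have we: "(w, vs!n) \<in> E" by (simp add: parents_def)
      show "w \<in> J"
      proof (rule ccontr)
        assume "w \<notin> J"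
        then have "w \<in> set vs" using we edges assms by (auto simp: topological_order_def)
        then obtain i where i: "i < length vs" "w = vs ! i" by (auto simp: in_set_conv_nth)
        then have "i < n" using we assms Suc.prems by (auto simp: topological_order_def)
        then show False using i w Suc.prems by (auto simp: in_set_conv_nth)
      qed
    qed
    then have "(parents E (vs!n) - set (take n vs)) \<union> J = J" by blast
    with measurable_kernel_prod[OF ne[OF v] Suc.IH] Suc.prems show ?case
      by (simp add: take_Suc_conv_app_nth)
  qed
  from this[of "length vs"] show ?thesis using assms
    by (simp add: joint_kernel_def topological_order_def)
qed


section \<open>Transitional conditional independence\<close>

definition proj :: "'n set \<Rightarrow> 'n set \<Rightarrow> 'n set \<Rightarrow> ('n \<Rightarrow> 'a) \<Rightarrow> ('n \<Rightarrow> 'a) \<Rightarrow> 'n \<Rightarrow> 'a" where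
  "proj V J S xV xJ = restrict (merge V J (xV, xJ)) S"

definition trans_cond_indep ::
  "'n set \<Rightarrow> 'n set \<Rightarrow> ('n \<Rightarrow> 'a measure) \<Rightarrow> (('n \<Rightarrow> 'a) \<Rightarrow> ('n \<Rightarrow> 'a) measure) \<Rightarrow>
   'n set \<Rightarrow> 'n set \<Rightarrow> 'n set \<Rightarrow> bool" where
  "trans_cond_indep J V X K A B C \<longleftrightarrow>
     (\<exists>Q \<in> PiM C X \<rightarrow>\<^sub>M prob_algebra (PiM A X).
        \<forall>xJ \<in> space (PiM J X).
        \<forall>F \<in> sets (PiM A X). \<forall>G \<in> sets (PiM B X). \<forall>H \<in> sets (PiM C X).
          emeasure
            (distr (K xJ) (PiM A X \<Otimes>\<^sub>M PiM B X \<Otimes>\<^sub>M PiM C X)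
               (\<lambda>xV. (proj V J A xV xJ, proj V J B xV xJ, proj V J C xV xJ)))
            (F \<times> G \<times> H) =
          (\<integral>\<^sup>+ (b, c). indicator G b * indicator H c * emeasure (Q c) F
             \<partial>distr (K xJ) (PiM B X \<Otimes>\<^sub>M PiM C X)
                 (\<lambda>xV. (proj V J B xV xJ, proj V J C xV xJ))))"

end

theory Submission
  imports Defs
begin

text \<open>
  Fix the network and suppose that \<open>A\<close> is id-separated from \<open>B\<close> given \<open>C\<close>. Inside the ancestral set \<open>N\<close>
  of \<open>A \<union> B \<union> C \<union> J\<close>, let \<open>A'\<close> be the nodes that an open walk from \<open>A\<close> reaches, and let
  \<open>D = N - A'\<close>. Separation puts \<open>B\<close> and all input nodes into \<open>D\<close>, and \<open>A'\<close> is closed in the way of a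
  component of the moral graph with \<open>C\<close> deleted: for every output node \<open>v\<close> of \<open>N\<close>, the kernel
  \<open>P v\<close> reads and writes only in \<open>A' \<union> C\<close>, or it does so only in \<open>D\<close> (\<open>id_separated_split\<close>).

  If all kernels had densities, the joint density on \<open>N\<close> would be a product \<open>g(A', C) * h(D)\<close>, and the
  conditional law of \<open>A'\<close> given \<open>D\<close> would visibly be a function of \<open>C\<close> alone, with no dependence on the
  inputs. Without densities, the same statement is carried through the nodes one at a time, in
  topological order: the invariant is that there is a kernel \<open>Q\<close> from the \<open>C\<close>-nodes seen so far to the
  \<open>A'\<close>-nodes seen so far which, for every value of the inputs, is a conditional law of the latter given
  all \<open>D\<close>-nodes seen so far (\<open>kernel_factorization\<close>). Let \<open>v\<close> be the next node.

    \<^item> If \<open>v\<close> lies outside \<open>N\<close>, it is integrated out.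
    \<^item> If \<open>v\<close> lies in \<open>D\<close> with parents in \<open>D\<close>, then \<open>Q\<close> stays as it is; the order of the two integrations
      over \<open>v\<close> and over \<open>A'\<close> is exchanged.
    \<^item> If \<open>v\<close> lies in \<open>A'\<close>, then \<open>Q\<close> is composed with \<open>P v\<close>.
    \<^item> If \<open>v\<close> lies in \<open>C\<close> with parents in \<open>A' \<union> C\<close>, then \<open>Q \<otimes> P v\<close> is a joint kernel for \<open>A'\<close> and \<open>v\<close>; the
      new \<open>Q\<close> is its conditional kernel given \<open>v\<close>. As \<open>Q \<otimes> P v\<close> only takes \<open>C\<close>-nodes as arguments, the
      new \<open>Q\<close> does so too.

  The last case needs a disintegration that is jointly measurable in the parameter and in the value
  conditioned on (\<open>disintegration\<close>); there the parameter space is arbitrary, since its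
  coordinates may be input nodes, but the two other spaces are built from standard ones. A nonempty
  finite product of standard spaces is a measurable retract of the line, so it suffices to condition
  on a real variable. Conditional probabilities are then limits of dyadic difference quotients along
  a subsequence that depends measurably on the parameter, and a conditional law is rebuilt from them
  as the law of a quantile function applied to a uniform variable.
\<close>

section \<open>Densities of dominated kernels on the real line\<close>

text \<open>
  The quotient of the two masses of the dyadic interval of level \<open>n\<close> around \<open>y\<close>; it is \<open>0\<close> where that
  interval is a null set of \<open>\<mu>\<close>. If \<open>\<mu>\<close> dominates \<open>\<nu>\<close>, these quotients form a bounded martingale under \<open>\<mu>\<close>
  whose limit is the density of \<open>\<nu>\<close>.
\<close>

definition dyadic_ratio :: "real measure \<Rightarrow> real measure \<Rightarrow> nat \<Rightarrow> real \<Rightarrow> real" where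
  "dyadic_ratio \<mu> \<nu> n y =
     measure \<nu> {z. \<lfloor>2 ^ n * z\<rfloor> = \<lfloor>2 ^ n * y\<rfloor>} / measure \<mu> {z. \<lfloor>2 ^ n * z\<rfloor> = \<lfloor>2 ^ n * y\<rfloor>}"

lemma dyadic_atom_borel [measurable]: "{z::real. \<lfloor>2 ^ n * z\<rfloor> = k} \<in> sets borel"
  by measurable

lemma dyadic_floor_refine:
  assumes "n \<le> m"
  shows "\<lfloor>2 ^ n * (y::real)\<rfloor> = \<lfloor>2 ^ m * y\<rfloor> div 2 ^ (m - n)"
proof -
  have "\<lfloor>2 ^ m * y\<rfloor> div 2 ^ (m - n) = \<lfloor>2 ^ m * y / of_int (2 ^ (m - n))\<rfloor>"
    by (rule floor_divide_real_eq_div[symmetric]) simp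
  also have "2 ^ m * y / of_int (2 ^ (m - n)) = 2 ^ n * y"
    using assms by (simp add: power_diff[symmetric] field_simps power_add[symmetric])
  finally show ?thesis by simp
qed

text \<open>
  An open half-line is a countable union of dyadic intervals. The empty set is added because the
  generator then becomes stable under intersection: two dyadic intervals are nested or disjoint.
\<close>

lemma dyadic_atoms_generate:
  "sets (borel :: real measure) = sigma_sets UNIV (insert {} {{z. \<lfloor>2 ^ n * z\<rfloor> = k} | n k. True})"
    (is "_ = sigma_sets UNIV ?E")
proof
  show "sigma_sets UNIV ?E \<subseteq> sets borel"
  proof -
    have "?E \<subseteq> sets borel" by auto
    from sets.sigma_sets_subset[OF this] show ?thesis by simp
  qed
  have "{..<r} \<in> sigma_sets UNIV ?E" for r :: real
  proof -
    let ?I = "{p :: nat \<times> int. of_int (snd p + 1) \<le> 2 ^ fst p * r}"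
    have "{..<r} = (\<Union>p\<in>?I. {z::real. \<lfloor>2 ^ fst p * z\<rfloor> = snd p})"
    proof (intro set_eqI iffI)
      fix z assume "z \<in> {..<r}"
      then have "0 < r - z" by simp
      then obtain n :: nat where "inverse (2 ^ n) < r - z"
        using real_arch_pow_inv[of "r - z" "1/2"] by (auto simp: power_one_over inverse_eq_divide)
      then have "1 < 2 ^ n * r - 2 ^ n * z" by (simp add: field_simps)
      then have "(n, \<lfloor>2 ^ n * z\<rfloor>) \<in> ?I" by (simp) linarith
      then show "z \<in> (\<Union>p\<in>?I. {z::real. \<lfloor>2 ^ fst p * z\<rfloor> = snd p})" by force
    next
      fix z assume "z \<in> (\<Union>p\<in>?I. {z::real. \<lfloor>2 ^ fst p * z\<rfloor> = snd p})"
      then obtain n k where "of_int (k + 1) \<le> 2 ^ n * r" "\<lfloor>2 ^ n * z\<rfloor> = k" by auto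
      then have "2 ^ n * z < 2 ^ n * r" by linarith
      then show "z \<in> {..<r}" by simp
    qed
    also have "\<dots> \<in> sigma_sets UNIV ?E"
      by (rule sigma_sets_UNION) (auto intro!: sigma_sets.Basic)
    finally show ?thesis .
  qed
  then have "range (lessThan :: real \<Rightarrow> _) \<subseteq> sigma_sets UNIV ?E" by auto
  then have "sigma_sets UNIV (range (lessThan :: real \<Rightarrow> _)) \<subseteq> sigma_sets UNIV ?E"
    by (intro sigma_sets_mono)
  then show "sets borel \<subseteq> sigma_sets UNIV ?E"
    by (simp add: borel_Iio)
qed

text \<open>
  The convergence of the dyadic quotients is proved in \<open>L\<^sup>2\<close>, along a subsequence. In contrast to almost
  sure convergence of the whole martingale, this only uses the orthogonality of its increments, and the
  subsequence can be chosen measurably when \<open>\<mu>\<close> and \<open>\<nu>\<close> vary with a parameter.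
\<close>

locale dominated_pair =
  fixes \<mu> \<nu> :: "real measure"
  assumes sets_mu [measurable_cong, simp]: "sets \<mu> = sets borel"
    and sets_nu [measurable_cong, simp]: "sets \<nu> = sets borel"
    and fin_mu: "subprob_space \<mu>"
    and dom: "\<And>B. B \<in> sets borel \<Longrightarrow> emeasure \<nu> B \<le> emeasure \<mu> B"
begin

sublocale mu: subprob_space \<mu> by (rule fin_mu)

lemma spaces [simp]: "space \<mu> = UNIV" "space \<nu> = UNIV"
  using sets_eq_imp_space_eq[OF sets_mu] sets_eq_imp_space_eq[OF sets_nu] by auto

sublocale nu: finite_measure \<nu>
  by standard (use dom[of UNIV] mu.emeasure_finite[of UNIV] in \<open>auto simp: top_unique\<close>)

lemma measure_dom: "B \<in> sets borel \<Longrightarrow> measure \<nu> B \<le> measure \<mu> B"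
  using dom[of B] by (simp add: mu.emeasure_eq_measure nu.emeasure_eq_measure)

abbreviation "ratio \<equiv> dyadic_ratio \<mu> \<nu>"

lemma ratio_bounds: "0 \<le> ratio n y" "ratio n y \<le> 1"
  unfolding dyadic_ratio_def using measure_dom[OF dyadic_atom_borel, of n]
  by (auto simp: divide_le_eq_1 zero_less_measure_iff order.trans measure_nonneg)

lemma ratio_abs: "\<bar>ratio n y\<bar> \<le> 1"
  using ratio_bounds[of n y] by auto

lemma ratio_measurable [measurable]: "ratio n \<in> borel_measurable borel"
proof -
  have "(\<lambda>y::real. (\<lambda>k. measure \<nu> {z. \<lfloor>2 ^ n * z\<rfloor> = k} / measure \<mu> {z. \<lfloor>2 ^ n * z\<rfloor> = k}) \<lfloor>2 ^ n * y\<rfloor>)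
     \<in> borel_measurable borel"
    by (rule measurable_compose[where N="count_space UNIV"]) measurable
  then show ?thesis by (simp add: dyadic_ratio_def[abs_def])
qed

text \<open>
  On the sigma-algebra of the dyadic intervals of level \<open>n\<close>, the quotient is already the density. As that
  sigma-algebra is atomic, this is checked on the images of the measures under the index map.
\<close>

lemma integral_ratio:
  fixes G :: "int \<Rightarrow> real"
  shows "(\<integral>y. ratio n y * G \<lfloor>2 ^ n * y\<rfloor> \<partial>\<mu>) = (\<integral>y. G \<lfloor>2 ^ n * y\<rfloor> \<partial>\<nu>)"
proof -
  let ?b = "\<lambda>y::real. \<lfloor>2 ^ n * y\<rfloor>"
  let ?\<rho> = "\<lambda>k. measure \<nu> {z. ?b z = k} / measure \<mu> {z. ?b z = k}"
  let ?C = "count_space (UNIV :: int set)"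
  have "distr \<nu> ?C ?b = density (distr \<mu> ?C ?b) ?\<rho>"
  proof (rule measure_eqI_countable[where A=UNIV])
    fix k
    have "emeasure (density (distr \<mu> ?C ?b) ?\<rho>) {k} = ennreal (?\<rho> k) * emeasure \<mu> {z. ?b z = k}"
    proof -
      have "emeasure (density (distr \<mu> ?C ?b) ?\<rho>) {k}
          = (\<integral>\<^sup>+y. ennreal (?\<rho> (?b y)) * indicator {k} (?b y) \<partial>\<mu>)"
        by (subst emeasure_density, simp, simp, subst nn_integral_distr) auto
      also have "\<dots> = (\<integral>\<^sup>+y. ennreal (?\<rho> k) * indicator {z. ?b z = k} y \<partial>\<mu>)"
        by (intro nn_integral_cong) (auto split: split_indicator)
      finally show ?thesis by (simp add: nn_integral_cmult_indicator)
    qed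
    also have "\<dots> = emeasure \<nu> {z. ?b z = k}"
      using measure_dom[OF dyadic_atom_borel, of n k]
      by (auto simp: mu.emeasure_eq_measure nu.emeasure_eq_measure ennreal_mult[symmetric]
          measure_le_0_iff)
    finally show "emeasure (distr \<nu> ?C ?b) {k} = emeasure (density (distr \<mu> ?C ?b) ?\<rho>) {k}"
      by (simp add: emeasure_distr vimage_def)
  qed (auto simp: emeasure_distr)
  then have "(\<integral>k. G k \<partial>distr \<nu> ?C ?b) = (\<integral>k. G k \<partial>density (distr \<mu> ?C ?b) ?\<rho>)" by simp
  also have "\<dots> = (\<integral>k. ?\<rho> k * G k \<partial>distr \<mu> ?C ?b)"
    by (rule integral_real_density) auto
  finally have "(\<integral>y. G (?b y) \<partial>\<nu>) = (\<integral>y. ?\<rho> (?b y) * G (?b y) \<partial>\<mu>)"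
    by (simp add: integral_distr)
  then show ?thesis
    by (simp add: dyadic_ratio_def)
qed

lemma ratio_integrable [simp]:
  "integrable \<mu> (ratio n)" "integrable \<mu> (\<lambda>y. ratio n y * ratio m y)"
  by (auto intro!: mu.integrable_const_bound[where B=1] AE_I2 simp: abs_mult ratio_abs mult_le_one)

text \<open>
  Both sides are the \<open>\<nu>\<close>-integral of the quotient of the coarser level, which is also constant on the
  intervals of the finer one.
\<close>

lemma ratio_orth:
  assumes "n \<le> m"
  shows "(\<integral>y. ratio m y * ratio n y \<partial>\<mu>) = (\<integral>y. ratio n y * ratio n y \<partial>\<mu>)"
proof -
  let ?G = "\<lambda>k. measure \<nu> {z. \<lfloor>2 ^ n * z\<rfloor> = k} / measure \<mu> {z. \<lfloor>2 ^ n * z\<rfloor> = k}"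
  have "(\<integral>y. ratio m y * ratio n y \<partial>\<mu>) = (\<integral>y. ratio n y \<partial>\<nu>)"
    using integral_ratio[of m "\<lambda>k. ?G (k div 2 ^ (m - n))"]
    by (simp add: dyadic_ratio_def dyadic_floor_refine[OF assms, symmetric])
  also have "\<dots> = (\<integral>y. ratio n y * ratio n y \<partial>\<mu>)"
    using integral_ratio[of n ?G] by (simp add: dyadic_ratio_def)
  finally show ?thesis .
qed

definition energy :: "nat \<Rightarrow> real" where "energy n = (\<integral>y. ratio n y * ratio n y \<partial>\<mu>)"

lemma energy_diff:
  assumes "n \<le> m"
  shows "(\<integral>y. (ratio m y - ratio n y)\<^sup>2 \<partial>\<mu>) = energy m - energy n"
proof -
  have "(\<integral>y. (ratio m y - ratio n y)\<^sup>2 \<partial>\<mu>)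
     = (\<integral>y. ratio m y * ratio m y - 2 * (ratio m y * ratio n y) + ratio n y * ratio n y \<partial>\<mu>)"
    by (intro Bochner_Integration.integral_cong) (auto simp: power2_eq_square algebra_simps)
  also have "\<dots> = energy m - 2 * (\<integral>y. ratio m y * ratio n y \<partial>\<mu>) + energy n"
    by (simp add: energy_def)
  finally show ?thesis using ratio_orth[OF assms] by (simp add: energy_def)
qed

lemma energy_mono: "n \<le> m \<Longrightarrow> energy n \<le> energy m"
  using energy_diff[of n m] Bochner_Integration.integral_nonneg[of \<mu> "\<lambda>y. (ratio m y - ratio n y)\<^sup>2"]
  by auto

lemma energy_le_1: "energy n \<le> 1"
proof -
  have "energy n \<le> (\<integral>y. 1 \<partial>\<mu>)"
    unfolding energy_def
    by (intro integral_mono) (auto simp: mult_le_one ratio_bounds)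
  also have "\<dots> \<le> 1" using mu.subprob_measure_le_1[of UNIV] by simp
  finally show ?thesis .
qed

text \<open>
  By orthogonality the increments of the energy are squared \<open>L\<^sup>2\<close>-distances. If these decrease
  geometrically, the \<open>L\<^sup>1\<close>-distances are summable, and the telescoping series of the differences
  converges absolutely almost everywhere.
\<close>

lemma ratio_subseq_converges:
  fixes s :: "nat \<Rightarrow> nat"
  assumes s: "mono s" and E: "\<And>k. energy (s (Suc k)) - energy (s k) \<le> (1 / 4) ^ k"
  shows "AE y in \<mu>. convergent (\<lambda>k. ratio (s k) y)"
proof -
  let ?d = "\<lambda>k y. ratio (s (Suc k)) y - ratio (s k) y"
  have int: "integrable \<mu> (?d k)" "integrable \<mu> (\<lambda>y. (?d k y)\<^sup>2)" for k
    by (auto simp: power2_eq_square algebra_simps)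
  have L1: "(\<integral>y. \<bar>?d k y\<bar> \<partial>\<mu>) \<le> 2 * (1 / 2) ^ k" for k
  proof -
    \<comment> \<open>By the inequality of the means; the weight balances a squared distance of order \<open>4 ^ -k\<close>.\<close>
    have am: "\<bar>x\<bar> \<le> (1 / 2) ^ k + 2 ^ k * x\<^sup>2" for x :: real
    proof -
      define t :: real where "t = 2 ^ k"
      have t: "0 < t" by (simp add: t_def)
      have "0 \<le> (\<bar>x\<bar> * t - 1)\<^sup>2 + \<bar>x\<bar> * t" using t by simp
      then have "\<bar>x\<bar> * t \<le> 1 + x\<^sup>2 * t * t"
        by (simp add: power2_eq_square algebra_simps)
      then have "\<bar>x\<bar> \<le> 1 / t + t * x\<^sup>2"
        using t by (simp add: field_simps)
      then show ?thesis by (simp add: t_def power_one_over)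
    qed
    have "(\<integral>y. \<bar>?d k y\<bar> \<partial>\<mu>) \<le> (\<integral>y. (1 / 2) ^ k + 2 ^ k * (?d k y)\<^sup>2 \<partial>\<mu>)"
      by (intro integral_mono) (auto intro!: int am integrable_abs)
    also have "\<dots> = (1 / 2) ^ k * measure \<mu> UNIV + 2 ^ k * (energy (s (Suc k)) - energy (s k))"
      using int energy_diff[of "s k" "s (Suc k)"] monoD[OF s] by simp
    also have "\<dots> \<le> (1 / 2) ^ k * 1 + 2 ^ k * (1 / 4) ^ k"
      using E[of k] mu.subprob_measure_le_1[of UNIV] by (intro add_mono mult_left_mono) auto
    also have "\<dots> = 2 * (1 / 2) ^ k" by (simp add: power_mult_distrib[symmetric])
    finally show ?thesis .
  qed
  have "(\<integral>\<^sup>+y. (\<Sum>k. ennreal \<bar>?d k y\<bar>) \<partial>\<mu>) = (\<Sum>k. \<integral>\<^sup>+y. ennreal \<bar>?d k y\<bar> \<partial>\<mu>)"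
    by (rule nn_integral_suminf) auto
  also have "\<dots> \<le> (\<Sum>k. ennreal (2 * (1 / 2) ^ k))"
    using L1 int by (intro suminf_le) (auto simp: nn_integral_eq_integral)
  also have "\<dots> < \<infinity>"
    by (subst suminf_ennreal2) (auto intro!: summable_mult summable_geometric)
  finally have "AE y in \<mu>. (\<Sum>k. ennreal \<bar>?d k y\<bar>) \<noteq> \<infinity>"
    by (intro nn_integral_PInf_AE) auto
  then show ?thesis
  proof (rule AE_mp, intro AE_I2 impI)
    fix y assume "(\<Sum>k. ennreal \<bar>?d k y\<bar>) \<noteq> \<infinity>"
    then have "summable (\<lambda>k. \<bar>?d k y\<bar>)" by (intro summable_suminf_not_top) auto
    then have "summable (\<lambda>k. ?d k y)" by (rule summable_rabs_cancel)
    then have "convergent (\<lambda>n. \<Sum>k<n. ?d k y)" by (simp add: summable_iff_convergent)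
    then have "convergent (\<lambda>n. ratio (s n) y - ratio (s 0) y)"
      by (simp add: sum_lessThan_telescope[of "\<lambda>k. ratio (s k) y"])
    then have "convergent (\<lambda>n. (ratio (s n) y - ratio (s 0) y) + ratio (s 0) y)"
      by (intro convergent_add convergent_const)
    then show "convergent (\<lambda>k. ratio (s k) y)" by simp
  qed
qed

text \<open>
  From level \<open>n\<close> on, the integral of the quotients over a dyadic interval of level \<open>n\<close> equals its
  \<open>\<nu>\<close>-mass. Dominated convergence carries this over to \<open>g\<close>, and the dyadic intervals determine the measure.
\<close>

lemma density_limit:
  fixes s :: "nat \<Rightarrow> nat" and g :: "real \<Rightarrow> real"
  assumes s: "filterlim s at_top sequentially" and g [measurable]: "g \<in> borel_measurable borel"
    and g01: "\<And>y. 0 \<le> g y"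
    and lim: "AE y in \<mu>. (\<lambda>k. ratio (s k) y) \<longlonglongrightarrow> g y"
  shows "\<nu> = density \<mu> g"
proof -
  let ?E = "{{z::real. \<lfloor>2 ^ n * z\<rfloor> = k} | n k. True}"
  have main: "emeasure \<nu> {z. \<lfloor>2 ^ n * z\<rfloor> = k} = emeasure (density \<mu> g) {z. \<lfloor>2 ^ n * z\<rfloor> = k}" for n k
  proof -
    let ?I = "{z::real. \<lfloor>2 ^ n * z\<rfloor> = k}"
    have lim2: "AE y in \<mu>. (\<lambda>i. ratio (s i) y * indicator ?I y) \<longlonglongrightarrow> g y * indicator ?I y"
      using lim by eventually_elim (intro tendsto_mult tendsto_const)
    have b: "\<And>i. AE y in \<mu>. norm (ratio (s i) y * indicator ?I y) \<le> 1"
      by (auto simp: abs_mult ratio_abs indicator_def)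
    have "(\<lambda>i. \<integral>y. ratio (s i) y * indicator ?I y \<partial>\<mu>) \<longlonglongrightarrow> (\<integral>y. g y * indicator ?I y \<partial>\<mu>)"
      by (rule integral_dominated_convergence[where w="\<lambda>_. 1"]) (use lim2 b in auto)
    moreover have "eventually (\<lambda>i. (\<integral>y. ratio (s i) y * indicator ?I y \<partial>\<mu>) = measure \<nu> ?I) sequentially"
    proof -
      have "eventually (\<lambda>i. n \<le> s i) sequentially" using s by (simp add: filterlim_at_top)
      then show ?thesis
      proof eventually_elim
        case (elim i)
        have "(\<integral>y. ratio (s i) y * indicator ?I y \<partial>\<mu>) = (\<integral>y. indicator ?I y \<partial>\<nu>)"
          using integral_ratio[of "s i" "\<lambda>j. if j div 2 ^ (s i - n) = k then 1 else 0"]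
          by (simp add: dyadic_floor_refine[OF elim, symmetric] indicator_def of_bool_def)
        then show ?case by simp
      qed
    qed
    then have "(\<lambda>i. \<integral>y. ratio (s i) y * indicator ?I y \<partial>\<mu>) \<longlonglongrightarrow> measure \<nu> ?I"
      by (rule tendsto_eventually)
    ultimately have "(\<integral>y. g y * indicator ?I y \<partial>\<mu>) = measure \<nu> ?I"
      by (rule LIMSEQ_unique)
    moreover have "integrable \<mu> (\<lambda>y. g y * indicator ?I y)"
      by (rule integrable_dominated_convergence[where w="\<lambda>_. 1", OF _ _ _ lim2]) (use b in auto)
    ultimately have "(\<integral>\<^sup>+y. ennreal (g y * indicator ?I y) \<partial>\<mu>) = measure \<nu> ?I"
      using g01 by (subst nn_integral_eq_integral) auto
    then show ?thesis
      by (simp add: emeasure_density nu.emeasure_eq_measure ennreal_mult' g01 ennreal_indicator)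
  qed
  have IS: "Int_stable (insert {} ?E)"
  proof (rule Int_stableI)
    fix a b assume "a \<in> insert {} ?E" "b \<in> insert {} ?E"
    moreover have "{z::real. \<lfloor>2 ^ n * z\<rfloor> = k} \<inter> {z. \<lfloor>2 ^ m * z\<rfloor> = l} \<in> insert {} ?E"
      if "n \<le> m" for n m k l
    proof (cases "k = l div 2 ^ (m - n)")
      case True
      then have "{z::real. \<lfloor>2 ^ n * z\<rfloor> = k} \<inter> {z. \<lfloor>2 ^ m * z\<rfloor> = l} = {z. \<lfloor>2 ^ m * z\<rfloor> = l}"
        using dyadic_floor_refine[OF that] by auto
      then show ?thesis by blast
    next
      case False
      then have "{z::real. \<lfloor>2 ^ n * z\<rfloor> = k} \<inter> {z. \<lfloor>2 ^ m * z\<rfloor> = l} = {}"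
        using dyadic_floor_refine[OF that] by auto
      then show ?thesis by blast
    qed
    ultimately show "a \<inter> b \<in> insert {} ?E"
      by (smt (verit) Int_commute Int_empty_left insert_iff mem_Collect_eq nle_le)
  qed
  show ?thesis
  proof (rule measure_eqI_generator_eq[OF IS, where \<Omega>=UNIV and A="\<lambda>i. {z. \<lfloor>2 ^ 0 * z\<rfloor> = from_nat i}"])
    show "(\<Union>i. {z::real. \<lfloor>2 ^ 0 * z\<rfloor> = from_nat i}) = UNIV"
    proof (intro set_eqI iffI UNIV_I)
      fix z :: real
      show "z \<in> (\<Union>i. {z::real. \<lfloor>2 ^ 0 * z\<rfloor> = from_nat i})"
        by (rule UN_I[of "to_nat \<lfloor>z\<rfloor>"]) auto
    qed
    show "range (\<lambda>i. {z::real. \<lfloor>2 ^ 0 * z\<rfloor> = from_nat i}) \<subseteq> insert {} ?E" by blast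
  qed (use main in \<open>auto simp: dyadic_atoms_generate\<close>)
qed

end

text \<open>
  The quotient depends on \<open>y\<close> only through the index of its dyadic interval, and there are countably many.
\<close>

lemma measurable_dyadic_ratio:
  assumes mu [measurable]: "\<mu> \<in> M \<rightarrow>\<^sub>M subprob_algebra borel"
    and nu [measurable]: "\<nu> \<in> M \<rightarrow>\<^sub>M subprob_algebra borel"
  shows "(\<lambda>p. dyadic_ratio (\<mu> (fst p)) (\<nu> (fst p)) n (snd p)) \<in> borel_measurable (M \<Otimes>\<^sub>M borel)"
proof -
  have m: "(\<lambda>p. measure (\<kappa> (fst p)) {z::real. \<lfloor>2 ^ n * z\<rfloor> = k}) \<in> borel_measurable (M \<Otimes>\<^sub>M (borel :: real measure))"
    if [measurable]: "\<kappa> \<in> M \<rightarrow>\<^sub>M subprob_algebra borel" for \<kappa> and k :: int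
    by (rule measurable_compose[OF _ measurable_measure_subprob_algebra]) (use that in measurable)
  show ?thesis
    unfolding dyadic_ratio_def
    by (rule measurable_compose_countable[where g="\<lambda>p. \<lfloor>2 ^ n * snd p\<rfloor>" and f="\<lambda>k p.
        measure (\<nu> (fst p)) {z. \<lfloor>2 ^ n * z\<rfloor> = k} / measure (\<mu> (fst p)) {z. \<lfloor>2 ^ n * z\<rfloor> = k}"])
       (use m[OF mu] m[OF nu] in measurable)
qed

text \<open>
  A Radon--Nikodym theorem with a parameter. For a single parameter the theorem is classical; what has
  to be arranged is that the density is jointly measurable. The parameter space carries no countability
  assumption, so the density is obtained as an explicit limit of jointly measurable functions.
\<close>

proposition kernel_density_exists:
  fixes \<mu> \<nu> :: "'c \<Rightarrow> real measure"
  assumes mu: "\<mu> \<in> M \<rightarrow>\<^sub>M subprob_algebra borel" and nu: "\<nu> \<in> M \<rightarrow>\<^sub>M subprob_algebra borel"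
    and dom: "\<And>c B. c \<in> space M \<Longrightarrow> B \<in> sets borel \<Longrightarrow> emeasure (\<nu> c) B \<le> emeasure (\<mu> c) B"
  shows "\<exists>g. g \<in> borel_measurable (M \<Otimes>\<^sub>M borel) \<and> (\<forall>p. 0 \<le> g p) \<and>
    (\<forall>c\<in>space M. \<nu> c = density (\<mu> c) (\<lambda>y. ennreal (g (c, y))))"
proof -
  note mu [measurable] nu [measurable] measurable_dyadic_ratio[OF mu nu, measurable]
  have dp: "dominated_pair (\<mu> c) (\<nu> c)" if "c \<in> space M" for c
    using measurable_space[OF mu that] measurable_space[OF nu that] dom[OF that]
    by (auto simp: dominated_pair_def space_subprob_algebra)
  define r where "r n p = dyadic_ratio (\<mu> (fst p)) (\<nu> (fst p)) n (snd p)" for n p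
  define e where "e n c = dominated_pair.energy (\<mu> c) (\<nu> c) n" for n c
  have r [measurable]: "r n \<in> borel_measurable (M \<Otimes>\<^sub>M borel)" for n
    unfolding r_def[abs_def] by measurable
  have e [measurable]: "e n \<in> borel_measurable M" for n
  proof -
    have "(\<lambda>c. \<integral>\<^sup>+y. ennreal (r n (c, y) * r n (c, y)) \<partial>\<mu> c) \<in> borel_measurable M"
      by (rule nn_integral_measurable_subprob_algebra2[OF _ mu]) measurable
    then have "(\<lambda>c. enn2real (\<integral>\<^sup>+y. ennreal (r n (c, y) * r n (c, y)) \<partial>\<mu> c)) \<in> borel_measurable M"
      by measurable
    moreover have "e n c = enn2real (\<integral>\<^sup>+y. ennreal (r n (c, y) * r n (c, y)) \<partial>\<mu> c)" if "c \<in> space M" for c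
    proof -
      interpret dominated_pair "\<mu> c" "\<nu> c" by (rule dp[OF that])
      have [measurable_cong]: "sets (\<mu> c) = sets borel" by simp
      show ?thesis
        unfolding e_def energy_def r_def fst_conv snd_conv
        by (rule integral_eq_nn_integral[OF borel_measurable_integrable[OF ratio_integrable(2)]])
          (auto simp: ratio_bounds)
    qed
    ultimately show ?thesis by (simp cong: measurable_cong)
  qed
  \<comment> \<open>From level \<open>s k c\<close> on, the energy at the parameter \<open>c\<close> increases by at most \<open>4 ^ -k\<close>. The bound
    \<open>k \<le> n\<close> forces the levels to infinity also when the energy is constant.\<close>
  define ok where "ok k c n \<longleftrightarrow> k \<le> n \<and> (\<forall>m. n \<le> m \<longrightarrow> e m c - e n c \<le> (1 / 4) ^ k)" for k c n
  define s where "s k c = (LEAST n. ok k c n)" for k c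
  have [measurable]: "Measurable.pred M (\<lambda>c. ok k c n)" for k n
    unfolding ok_def by measurable
  have s [measurable]: "s k \<in> M \<rightarrow>\<^sub>M count_space UNIV" for k
    unfolding s_def[abs_def] by measurable
  have ok_ex: "\<exists>n. ok k c n" if c: "c \<in> space M" for k c
  proof -
    interpret dominated_pair "\<mu> c" "\<nu> c" by (rule dp[OF c])
    have "incseq (\<lambda>n. e n c)" by (auto simp: mono_def e_def intro: energy_mono)
    then have "convergent (\<lambda>n. e n c)"
      by (rule incseq_convergent[where B=1]) (auto simp: e_def energy_le_1 convergent_def)
    then have "Cauchy (\<lambda>n. e n c)" by (rule convergent_Cauchy)
    from metric_CauchyD[OF this, of "(1 / 4) ^ k"]
    obtain N where N: "\<And>m n. m \<ge> N \<Longrightarrow> n \<ge> N \<Longrightarrow> dist (e m c) (e n c) < (1 / 4) ^ k"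
      by auto
    have "ok k c (max k N)"
      unfolding ok_def
    proof (intro conjI allI impI)
      fix m assume "max k N \<le> m"
      then have "dist (e m c) (e (max k N) c) < (1 / 4) ^ k" by (intro N) auto
      then show "e m c - e (max k N) c \<le> (1 / 4) ^ k" by (simp add: dist_real_def)
    qed simp
    then show ?thesis ..
  qed
  have ok_s: "ok k c (s k c)" if "c \<in> space M" for k c
    unfolding s_def using ok_ex[OF that] by (rule LeastI_ex)
  \<comment> \<open>The value of \<open>lim\<close> is unspecified without convergence; the maximum makes \<open>g\<close> nonnegative there.\<close>
  define g where "g p = max 0 (lim (\<lambda>k. r (s k (fst p)) p))" for p
  have rs: "(\<lambda>p. r (s k (fst p)) p) \<in> borel_measurable (M \<Otimes>\<^sub>M borel)" for k
    by (rule measurable_compose_countable[where f=r and g="\<lambda>p. s k (fst p)"]) measurable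
  have g: "g \<in> borel_measurable (M \<Otimes>\<^sub>M borel)"
    unfolding g_def[abs_def]
    by (intro borel_measurable_max borel_measurable_const borel_measurable_lim_metric rs)
  have "\<nu> c = density (\<mu> c) (\<lambda>y. ennreal (g (c, y)))" if c: "c \<in> space M" for c
  proof -
    interpret dominated_pair "\<mu> c" "\<nu> c" by (rule dp[OF c])
    have "s k c \<le> s (Suc k) c" for k
    proof -
      have "(1 / 4 :: real) ^ Suc k \<le> (1 / 4) ^ k" by simp
      then have "ok k c (s (Suc k) c)"
        using ok_s[OF c, of "Suc k"] unfolding ok_def by (meson Suc_leD order_trans)
      then show ?thesis unfolding s_def[of k] by (rule Least_le)
    qed
    then have smono: "mono (\<lambda>k. s k c)" by (rule incseq_SucI)
    have conv: "AE y in \<mu> c. convergent (\<lambda>k. dyadic_ratio (\<mu> c) (\<nu> c) (s k c) y)"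
    proof (rule ratio_subseq_converges[OF smono])
      show "energy (s (Suc k) c) - energy (s k c) \<le> (1 / 4) ^ k" for k
        using ok_s[OF c, of k] monoD[OF smono, of k "Suc k"] by (auto simp: ok_def e_def)
    qed
    show ?thesis
    proof (rule density_limit)
      show "filterlim (\<lambda>k. s k c) at_top sequentially"
        using ok_s[OF c]
        by (intro filterlim_at_top_mono[OF filterlim_ident] always_eventually) (auto simp: ok_def)
      show "(\<lambda>y. g (c, y)) \<in> borel_measurable borel"
        using measurable_Pair2[OF g c] .
      show "0 \<le> g (c, y)" for y by (simp add: g_def)
      show "AE y in \<mu> c. (\<lambda>k. dyadic_ratio (\<mu> c) (\<nu> c) (s k c) y) \<longlonglongrightarrow> g (c, y)"
        using conv
      proof eventually_elim
        case (elim y)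
        then have l: "(\<lambda>k. dyadic_ratio (\<mu> c) (\<nu> c) (s k c) y) \<longlonglongrightarrow> lim (\<lambda>k. r (s k c) (c, y))"
          by (simp add: r_def convergent_LIMSEQ_iff)
        moreover have "0 \<le> lim (\<lambda>k. r (s k c) (c, y))"
          using l by (rule LIMSEQ_le_const) (simp add: ratio_bounds)
        ultimately show ?case by (simp add: g_def)
      qed
    qed
  qed
  then show ?thesis using g by (intro exI[of _ g]) (auto simp: g_def)
qed

section \<open>Quantile functions and disintegration over the real line\<close>

text \<open>
  The running maxima of an enumeration of the rationals below \<open>r\<close>.
\<close>

lemma rational_cofinal_below:
  fixes r :: ereal
  assumes "r \<noteq> -\<infinity>"
  obtains q :: "nat \<Rightarrow> rat" where "incseq q" "\<And>i. ereal (real_of_rat (q i)) < r"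
    "\<And>p. ereal (real_of_rat p) < r \<Longrightarrow> \<exists>i. p \<le> q i"
    "{..<r} = (\<Union>i. {..ereal (real_of_rat (q i))})"
proof -
  let ?D = "{p :: rat. ereal (real_of_rat p) < r}"
  have dense: "\<exists>p. a \<le> ereal (real_of_rat p) \<and> ereal (real_of_rat p) < r" if a: "a < r" for a
  proof -
    obtain b where b: "a < b" "b < r" using dense[OF a] by auto
    obtain b' where b': "b < b'" "b' < r" using dense[OF b(2)] by auto
    obtain c where c: "b = ereal c" using b b' by (cases b) auto
    obtain d where d: "c < d" "ereal d < r"
      using b' c by (cases b') auto
    obtain p where p: "c < real_of_rat p" "real_of_rat p < d" using of_rat_dense[OF d(1)] by auto
    have "a \<le> ereal (real_of_rat p)" using b c p by (meson ereal_less_eq(3) less_imp_le order_trans)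
    moreover have "ereal (real_of_rat p) < r" using p(2) d(2) by (meson less_ereal.simps(1) less_trans)
    ultimately show ?thesis by blast
  qed
  have ne: "?D \<noteq> {}" using dense[of "-\<infinity>"] assms by (auto simp: less_le)
  define e where "e = from_nat_into ?D"
  define q where "q i = Max (e ` {..i})" for i :: nat
  have e: "e i \<in> ?D" for i unfolding e_def by (rule from_nat_into[OF ne])
  have q: "q i \<in> ?D" for i
  proof -
    have "q i \<in> e ` {..i}" unfolding q_def by (rule Max_in) auto
    then obtain j where "q i = e j" by auto
    then show ?thesis using e[of j] by simp
  qed
  have cof: "\<exists>i. p \<le> q i" if p: "p \<in> ?D" for p
  proof -
    obtain i where "e i = p" using from_nat_into_surj[OF _ p] unfolding e_def by auto
    then have "p \<le> q i" unfolding q_def by (intro Max_ge) auto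
    then show ?thesis ..
  qed
  have inc: "incseq q"
    unfolding q_def by (intro monoI Max_mono image_mono) auto
  show ?thesis
  proof (rule that[OF inc])
    show "ereal (real_of_rat (q i)) < r" for i using q[of i] by simp
    show "\<exists>i. p \<le> q i" if "ereal (real_of_rat p) < r" for p using cof[of p] that by simp
    show "{..<r} = (\<Union>i. {..ereal (real_of_rat (q i))})"
    proof (intro set_eqI iffI)
      fix a assume "a \<in> {..<r}"
      then obtain p where p: "a \<le> ereal (real_of_rat p)" "ereal (real_of_rat p) < r"
        using dense[of a] by auto
      obtain i where "p \<le> q i" using cof[of p] p by auto
      then have "ereal (real_of_rat p) \<le> ereal (real_of_rat (q i))" by (simp add: of_rat_less_eq)
      then have "a \<le> ereal (real_of_rat (q i))" using p(1) by (rule order_trans[rotated])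
      then show "a \<in> (\<Union>i. {..ereal (real_of_rat (q i))})" by blast
    qed (use q in \<open>auto intro: le_less_trans\<close>)
  qed
qed

text \<open>
  The values are extended reals so that the infimum is always meaningful. No monotonicity or limit
  condition is then imposed on \<open>G\<close>, the candidate for a distribution function on the rationals.
\<close>

definition quantile :: "(rat \<Rightarrow> real) \<Rightarrow> real \<Rightarrow> ereal" where
  "quantile G u = (INF q. if u < G q then ereal (real_of_rat q) else \<infinity>)"

lemma quantile_less_iff: "quantile G u < r \<longleftrightarrow> (\<exists>q. u < G q \<and> ereal (real_of_rat q) < r)"
  unfolding quantile_def INF_less_iff by auto

abbreviation unit_uniform :: "real measure" where
  "unit_uniform \<equiv> uniform_measure lborel {0<..<1}"

lemma prob_space_unit_uniform: "prob_space unit_uniform"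
  by (rule prob_space_uniform_measure) auto

text \<open>
  For a uniform \<open>u\<close>, the event says that \<open>u < G q\<close> for some rational \<open>q\<close> below \<open>r\<close>, so \<open>u\<close> lies below the
  supremum of these \<open>G q\<close>.
\<close>

lemma emeasure_quantile:
  assumes G: "\<And>q. 0 \<le> G q" "\<And>q. G q \<le> 1"
  shows "emeasure unit_uniform {u. quantile G u < r} = (SUP q\<in>{q. ereal (real_of_rat q) < r}. ennreal (G q))"
proof -
  let ?D = "{q. ereal (real_of_rat q) < r}"
  define S where "S = (SUP q\<in>?D. ennreal (G q))"
  have S1: "S \<le> 1" unfolding S_def using G by (intro SUP_least) (auto simp: ennreal_le_1)
  then obtain s where s: "S = ennreal s" "0 \<le> s" "s \<le> 1"
    by (cases S) (auto simp: ennreal_le_1 top_unique)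
  have eq: "(u < s) = (\<exists>q. u < G q \<and> ereal (real_of_rat q) < r)" if "0 < u" for u
  proof -
    have "u < s \<longleftrightarrow> ennreal u < S" using that s by (simp add: ennreal_less_iff)
    also have "\<dots> \<longleftrightarrow> (\<exists>q\<in>?D. ennreal u < ennreal (G q))" unfolding S_def by (rule less_SUP_iff)
    also have "\<dots> \<longleftrightarrow> (\<exists>q. u < G q \<and> ereal (real_of_rat q) < r)"
      using that G by (auto simp: ennreal_less_iff)
    finally show ?thesis .
  qed
  have set_eq: "{0<..<1} \<inter> {u. quantile G u < r} = {0<..<1} \<inter> {0<..<s}"
    using eq by (auto simp: quantile_less_iff)
  also have "\<dots> = {0<..<s}" using s by auto
  finally have *: "{0<..<1} \<inter> {u. quantile G u < r} = {0<..<s}" .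
  have m: "{u. quantile G u < r} \<in> sets lborel"
  proof -
    have "{u. quantile G u < r} = (\<Union>q\<in>?D. {..<G q})" by (auto simp: quantile_less_iff)
    also have "\<dots> \<in> sets borel" by (intro sets.countable_UN') auto
    finally show ?thesis by simp
  qed
  show ?thesis
    using s m by (subst emeasure_uniform_measure) (auto simp: * S_def[symmetric] divide_ennreal_def)
qed

text \<open>
  Half-lines \<open>{..<r}\<close> of extended reals never contain \<open>\<infinity>\<close>, so the whole line is added to the generator.
\<close>

lemma measure_eqI_ereal_times_real:
  fixes M N :: "(ereal \<times> real) measure"
  assumes sets: "sets M = sets (borel \<Otimes>\<^sub>M borel)" "sets N = sets (borel \<Otimes>\<^sub>M borel)"
    and fin: "finite_measure M"
    and top: "\<And>B. B \<in> sets borel \<Longrightarrow> emeasure M (UNIV \<times> B) = emeasure N (UNIV \<times> B)"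
    and less: "\<And>r B. B \<in> sets borel \<Longrightarrow> emeasure M ({..<r} \<times> B) = emeasure N ({..<r} \<times> B)"
  shows "M = N"
proof -
  let ?A = "insert UNIV (range lessThan) :: ereal set set"
  let ?E = "{A \<times> B | A B. A \<in> ?A \<and> B \<in> sets (borel :: real measure)}"
  have A: "sets (borel :: ereal measure) = sigma_sets (space borel) ?A"
  proof -
    have "sigma_sets UNIV ?A = sigma_sets UNIV (range lessThan)"
      using sigma_sets_top[of UNIV "range lessThan :: ereal set set"]
      by (intro equalityI sigma_sets_mono insert_subsetI)
         (auto intro: sigma_sets.Basic)
    then show ?thesis by (simp add: borel_Iio)
  qed
  have "sets (borel \<Otimes>\<^sub>M borel :: (ereal \<times> real) measure)
      = sets (sigma (space borel \<times> space borel) ?E)"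
  proof (rule sets_pair_eq[where Ca="{UNIV}" and Cb="{UNIV}"])
    show "sets (borel :: real measure) = sigma_sets (space borel) (sets borel)"
      by (rule sets.sigma_sets_eq[symmetric])
    show "{UNIV} \<subseteq> sets (borel :: real measure)"
      using sets.top[of "borel :: real measure"] by simp
  qed (use A in auto)
  then have gen: "sets (borel \<Otimes>\<^sub>M borel :: (ereal \<times> real) measure) = sigma_sets UNIV ?E"
    by simp
  have IS: "Int_stable ?E"
  proof (rule Int_stableI)
    fix a b assume "a \<in> ?E" "b \<in> ?E"
    then obtain A B A' B' where *: "a = A \<times> B" "b = A' \<times> B'" "A \<in> ?A" "A' \<in> ?A"
      "B \<in> sets borel" "B' \<in> sets borel" by blast
    have "{..<x} \<inter> {..<y} \<in> range lessThan" for x y :: ereal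
      by (rule range_eqI[of _ _ "min x y"]) auto
    then have "A \<inter> A' \<in> ?A" using *(3,4) by auto
    moreover have "B \<inter> B' \<in> sets borel" using * by auto
    ultimately show "a \<inter> b \<in> ?E" using *(1,2) by (auto simp: Times_Int_Times)
  qed
  show ?thesis
  proof (rule measure_eqI_generator_eq[OF IS, where \<Omega>=UNIV and A="\<lambda>_. UNIV"])
    have "(UNIV :: ereal set) \<times> (UNIV :: real set) \<in> ?E"
      using sets.top[of "borel :: real measure"] by (intro CollectI exI[of _ UNIV] conjI) auto
    then show "range (\<lambda>_. UNIV) \<subseteq> ?E" by auto
    show "emeasure M a = emeasure N a" if "a \<in> ?E" for a
      using that top less by auto
  qed (use sets gen finite_measure.emeasure_finite[OF fin] in auto)
qed

text \<open>
  The inequality is tested on the set where it fails.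
\<close>

lemma AE_le_of_density_le:
  fixes f g :: "real \<Rightarrow> real"
  assumes fin: "finite_measure \<mu>" and [measurable_cong]: "sets \<mu> = sets borel"
    and [measurable]: "f \<in> borel_measurable borel" "g \<in> borel_measurable borel"
    and g0: "\<And>y. 0 \<le> g y"
    and gint: "(\<integral>\<^sup>+y. ennreal (g y) \<partial>\<mu>) < \<infinity>"
    and le: "\<And>B. B \<in> sets borel \<Longrightarrow>
      (\<integral>\<^sup>+y. ennreal (f y) * indicator B y \<partial>\<mu>) \<le> (\<integral>\<^sup>+y. ennreal (g y) * indicator B y \<partial>\<mu>)"
  shows "AE y in \<mu>. f y \<le> g y"
proof -
  define B where "B = {y. g y < f y}"
  have B [measurable]: "B \<in> sets borel" unfolding B_def by measurable
  let ?g = "\<lambda>y. ennreal (g y) * indicator B y"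
  have "(\<integral>\<^sup>+y. ennreal (f y) * indicator B y \<partial>\<mu>) = (\<integral>\<^sup>+y. ?g y + ennreal (f y - g y) * indicator B y \<partial>\<mu>)"
    using g0 by (intro nn_integral_cong) (auto simp: B_def indicator_def ennreal_plus[symmetric] simp del: ennreal_plus)
  also have "\<dots> = (\<integral>\<^sup>+y. ?g y \<partial>\<mu>) + (\<integral>\<^sup>+y. ennreal (f y - g y) * indicator B y \<partial>\<mu>)"
    by (rule nn_integral_add) measurable
  finally have "(\<integral>\<^sup>+y. ?g y \<partial>\<mu>) + (\<integral>\<^sup>+y. ennreal (f y - g y) * indicator B y \<partial>\<mu>) \<le> (\<integral>\<^sup>+y. ?g y \<partial>\<mu>) + 0"
    using le[OF B] by simp
  moreover have "(\<integral>\<^sup>+y. ?g y \<partial>\<mu>) < \<infinity>"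
    by (rule le_less_trans[OF nn_integral_mono gint]) (auto simp: indicator_def)
  ultimately have "(\<integral>\<^sup>+y. ennreal (f y - g y) * indicator B y \<partial>\<mu>) = 0"
    by (auto simp: ennreal_add_left_cancel_le)
  then have "AE y in \<mu>. ennreal (f y - g y) * indicator B y = 0"
    by (subst (asm) nn_integral_0_iff_AE) measurable
  then show ?thesis
    by eventually_elim (auto simp: B_def indicator_def ennreal_eq_0_iff split: if_splits)
qed

text \<open>
  For each rational \<open>q\<close>, the conditional probability that the first coordinate is at most \<open>q\<close> is a
  density \<open>g q\<close> from the parametrized Radon--Nikodym theorem. Monotonicity in \<open>q\<close> only holds almost everywhere,
  for each parameter separately. Defining the conditional law by quantiles avoids a choice of good
  versions: it is a probability measure and measurable in the parameter whatever the \<open>g q\<close> are, and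
  almost everywhere it gives \<open>{..<r}\<close> the supremum of the \<open>g q\<close> with \<open>q < r\<close>, as required.
\<close>

proposition disintegration_ereal_real:
  fixes R :: "'c \<Rightarrow> (ereal \<times> real) measure"
  assumes R: "R \<in> M \<rightarrow>\<^sub>M prob_algebra (borel \<Otimes>\<^sub>M borel)"
  shows "\<exists>Q \<in> M \<Otimes>\<^sub>M borel \<rightarrow>\<^sub>M prob_algebra borel. \<forall>c\<in>space M.
     \<forall>h\<in>borel_measurable (borel \<Otimes>\<^sub>M borel).
       (\<integral>\<^sup>+p. h p \<partial>R c) = (\<integral>\<^sup>+p. (\<integral>\<^sup>+a. h (a, snd p) \<partial>Q (c, snd p)) \<partial>R c)"
proof -
  let ?e = "\<lambda>q. ereal (real_of_rat q)"
  have R' [measurable]: "R \<in> M \<rightarrow>\<^sub>M subprob_algebra (borel \<Otimes>\<^sub>M borel)"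
    using R by (rule measurable_prob_algebraD)
  have Rsets [simp, measurable_cong]: "sets (R c) = sets (borel \<Otimes>\<^sub>M borel)" if "c \<in> space M" for c
    using measurable_space[OF R that] by (simp add: space_prob_algebra)
  have Rspace [simp]: "space (R c) = UNIV" if "c \<in> space M" for c
    using sets_eq_imp_space_eq[OF Rsets[OF that]] by (simp add: space_pair_measure)
  have Rprob: "prob_space (R c)" if "c \<in> space M" for c
    using measurable_space[OF R that] by (simp add: space_prob_algebra)
  define \<mu> where "\<mu> c = distr (R c) borel snd" for c
  have mu: "\<mu> \<in> M \<rightarrow>\<^sub>M subprob_algebra borel"
    unfolding \<mu>_def[abs_def] by (rule measurable_compose[OF R' measurable_distr]) measurable
  have musets [simp, measurable_cong]: "sets (\<mu> c) = sets borel" for c by (simp add: \<mu>_def)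
  have muprob: "prob_space (\<mu> c)" if "c \<in> space M" for c
    unfolding \<mu>_def
    by (rule prob_space.prob_space_distr[OF Rprob[OF that]])
       (simp add: measurable_cong_sets[OF Rsets[OF that] refl])
  have emu: "emeasure (\<mu> c) B = emeasure (R c) (UNIV \<times> B)" if "B \<in> sets borel" "c \<in> space M" for B c
    using that by (auto simp: \<mu>_def emeasure_distr space_pair_measure intro!: arg_cong2[where f=emeasure])
  define \<nu> where "\<nu> q c = distr (density (R c) (indicator ({..?e q} \<times> UNIV))) borel snd" for q c
  have enu: "emeasure (\<nu> q c) B = emeasure (R c) ({..?e q} \<times> B)" if "B \<in> sets borel" "c \<in> space M" for q B c
  proof -
    have s: "snd -` B = UNIV \<times> B" for B :: "real set" by auto
    have "emeasure (\<nu> q c) B = (\<integral>\<^sup>+p. indicator ({..?e q} \<times> UNIV) p * indicator (UNIV \<times> B) p \<partial>R c)"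
      using that by (simp add: \<nu>_def emeasure_distr emeasure_density s space_pair_measure)
    also have "\<dots> = (\<integral>\<^sup>+p. indicator ({..?e q} \<times> B) p \<partial>R c)"
      by (intro nn_integral_cong) (auto simp: indicator_def)
    finally show ?thesis using that by simp
  qed
  have nu: "\<nu> q \<in> M \<rightarrow>\<^sub>M subprob_algebra borel" for q
  proof (rule measurable_subprob_algebra)
    fix c assume c: "c \<in> space M"
    interpret Rc: prob_space "R c" by (rule Rprob[OF c])
    show "subprob_space (\<nu> q c)"
    proof
      show "emeasure (\<nu> q c) (space (\<nu> q c)) \<le> 1"
        using enu[of UNIV c q] c by (simp add: \<nu>_def Rc.measure_le_1 Rc.emeasure_eq_measure)
    qed (simp add: \<nu>_def)
  next
    fix B :: "real set" assume B: "B \<in> sets borel"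
    have "(\<lambda>c. emeasure (R c) ({..?e q} \<times> B)) \<in> borel_measurable M"
      using B by measurable
    then show "(\<lambda>c. emeasure (\<nu> q c) B) \<in> borel_measurable M"
      by (rule measurable_cong[THEN iffD1, rotated]) (simp add: enu B)
  qed (simp add: \<nu>_def)
  have "\<exists>g. g \<in> borel_measurable (M \<Otimes>\<^sub>M borel) \<and> (\<forall>p. 0 \<le> g p) \<and>
    (\<forall>c\<in>space M. \<nu> q c = density (\<mu> c) (\<lambda>y. ennreal (g (c, y))))" for q
    by (rule kernel_density_exists[OF mu nu]) (auto simp: emu enu intro!: emeasure_mono)
  then obtain g where g [measurable]: "\<And>q. g q \<in> borel_measurable (M \<Otimes>\<^sub>M borel)"
    and g0: "\<And>q p. 0 \<le> g q p"
    and gd: "\<And>q c. c \<in> space M \<Longrightarrow> \<nu> q c = density (\<mu> c) (\<lambda>y. ennreal (g q (c, y)))"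
    by metis
  have gc [measurable]: "(\<lambda>y. g q (c, y)) \<in> borel_measurable borel" if "c \<in> space M" for q c
    using measurable_Pair2[OF g that] .
  have gi: "(\<integral>\<^sup>+y. ennreal (g q (c, y)) * indicator B y \<partial>\<mu> c) = emeasure (R c) ({..?e q} \<times> B)"
    if [measurable]: "B \<in> sets borel" and c: "c \<in> space M" for q c B
    using enu[OF that, of q] gc[OF c, of q] by (simp add: gd[OF c] emeasure_density)
  define Q where "Q p = distr unit_uniform borel (quantile (\<lambda>q. g q p))" for p
  have Q: "Q \<in> M \<Otimes>\<^sub>M borel \<rightarrow>\<^sub>M prob_algebra borel"
    unfolding Q_def[abs_def]
  proof (rule measurable_distr_prob_space2)
    show "(\<lambda>p. unit_uniform) \<in> M \<Otimes>\<^sub>M borel \<rightarrow>\<^sub>M prob_algebra borel"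
      by (rule measurable_const) (simp add: space_prob_algebra prob_space_unit_uniform)
    show "(\<lambda>(p, u). quantile (\<lambda>q. g q p) u) \<in> (M \<Otimes>\<^sub>M borel) \<Otimes>\<^sub>M borel \<rightarrow>\<^sub>M borel"
      unfolding quantile_def case_prod_beta by measurable
  qed
  have "R c = \<mu> c \<bind> (\<lambda>y. distr (Q (c, y)) (borel \<Otimes>\<^sub>M borel) (\<lambda>a. (a, y)))" if c: "c \<in> space M" for c
  proof (rule measure_eqI_ereal_times_real)
    interpret Rc: prob_space "R c" by (rule Rprob[OF c])
    interpret muc: prob_space "\<mu> c" by (rule muprob[OF c])
    show "finite_measure (R c)" by unfold_locales
    have Qc: "(\<lambda>y. Q (c, y)) \<in> borel \<rightarrow>\<^sub>M prob_algebra borel"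
      using measurable_Pair2[OF Q c] .
    have k: "(\<lambda>y. distr (Q (c, y)) (borel \<Otimes>\<^sub>M borel) (\<lambda>a. (a, y))) \<in> \<mu> c \<rightarrow>\<^sub>M prob_algebra (borel \<Otimes>\<^sub>M borel)"
      by (rule measurable_distr_prob_space2[where M=borel]) (use Qc in auto)
    show "sets (R c) = sets (borel \<Otimes>\<^sub>M borel)" using c by simp
    show "sets (\<mu> c \<bind> (\<lambda>y. distr (Q (c, y)) (borel \<Otimes>\<^sub>M borel) (\<lambda>a. (a, y)))) = sets (borel \<Otimes>\<^sub>M borel)"
      by (rule sets_bind) (auto simp: \<mu>_def)
    have Qsets: "sets (Q p) = sets borel" "space (Q p) = UNIV" for p by (auto simp: Q_def)
    have rect: "emeasure (\<mu> c \<bind> (\<lambda>y. distr (Q (c, y)) (borel \<Otimes>\<^sub>M borel) (\<lambda>a. (a, y)))) (A \<times> B)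
       = (\<integral>\<^sup>+y. emeasure (Q (c, y)) A * indicator B y \<partial>\<mu> c)"
       if [measurable]: "A \<in> sets borel" "B \<in> sets borel" for A B
    proof -
      have "emeasure (\<mu> c \<bind> (\<lambda>y. distr (Q (c, y)) (borel \<Otimes>\<^sub>M borel) (\<lambda>a. (a, y)))) (A \<times> B)
        = (\<integral>\<^sup>+y. emeasure (distr (Q (c, y)) (borel \<Otimes>\<^sub>M borel) (\<lambda>a. (a, y))) (A \<times> B) \<partial>\<mu> c)"
        by (rule emeasure_bind[OF _ measurable_prob_algebraD[OF k]]) (auto simp: \<mu>_def)
      also have "\<dots> = (\<integral>\<^sup>+y. emeasure (Q (c, y)) A * indicator B y \<partial>\<mu> c)"
      proof (rule nn_integral_cong)
        fix y
        have "emeasure (distr (Q (c, y)) (borel \<Otimes>\<^sub>M borel) (\<lambda>a. (a, y))) (A \<times> B)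
          = emeasure (Q (c, y)) ((\<lambda>a. (a, y)) -` (A \<times> B) \<inter> space (Q (c, y)))"
          by (rule emeasure_distr) (auto simp: measurable_cong_sets[OF Qsets(1) refl])
        also have "(\<lambda>a. (a, y)) -` (A \<times> B) \<inter> space (Q (c, y)) = (if y \<in> B then A else {})"
          by (auto simp: Qsets)
        finally show "emeasure (distr (Q (c, y)) (borel \<Otimes>\<^sub>M borel) (\<lambda>a. (a, y))) (A \<times> B)
          = emeasure (Q (c, y)) A * indicator B y" by simp
      qed
      finally show ?thesis .
    qed
    show "emeasure (R c) (UNIV \<times> B) =
        emeasure (\<mu> c \<bind> (\<lambda>y. distr (Q (c, y)) (borel \<Otimes>\<^sub>M borel) (\<lambda>a. (a, y)))) (UNIV \<times> B)"
      if B [measurable]: "B \<in> sets borel" for B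
    proof -
      have "emeasure (Q (c, y)) UNIV = 1" for y
        using measurable_space[OF Qc, of y]
        by (auto simp: space_prob_algebra Qsets dest!: prob_space.emeasure_space_1)
      then show ?thesis using c by (simp add: rect emu[OF B c, symmetric])
    qed
    have atMost_mono: "{..?e p} \<subseteq> {..?e q}" if "p \<le> q" for p q
      using that by (simp add: of_rat_less_eq)
    have mono: "AE y in \<mu> c. g p (c, y) \<le> g q (c, y)" if pq: "p \<le> q" for p q
    proof (rule AE_le_of_density_le[where \<mu>="\<mu> c"])
      show "(\<integral>\<^sup>+y. ennreal (g q (c, y)) \<partial>\<mu> c) < \<infinity>"
        using gi[of UNIV c q] c by (simp add: less_top[symmetric])
      show "(\<integral>\<^sup>+y. ennreal (g p (c, y)) * indicator B y \<partial>\<mu> c) \<le> (\<integral>\<^sup>+y. ennreal (g q (c, y)) * indicator B y \<partial>\<mu> c)"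
        if "B \<in> sets borel" for B
        unfolding gi[OF that c] using that c atMost_mono[OF pq] by (intro emeasure_mono Sigma_mono) auto
    qed (use c in \<open>auto simp: g0 muc.finite_measure_axioms\<close>)
    have le1: "AE y in \<mu> c. g q (c, y) \<le> 1" for q
    proof (rule AE_le_of_density_le[where \<mu>="\<mu> c"])
      show "(\<integral>\<^sup>+y. ennreal (g q (c, y)) * indicator B y \<partial>\<mu> c) \<le> (\<integral>\<^sup>+y. ennreal 1 * indicator B y \<partial>\<mu> c)"
        if "B \<in> sets borel" for B
      proof -
        have "(\<integral>\<^sup>+y. ennreal 1 * indicator B y \<partial>\<mu> c) = emeasure (R c) (UNIV \<times> B)"
          using that by (simp add: emu[OF that c])
        then show ?thesis
          unfolding gi[OF that c] using that c by (auto intro!: emeasure_mono)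
      qed
    qed (use c in \<open>auto simp: muc.finite_measure_axioms muc.emeasure_space_1\<close>)
    show "emeasure (R c) ({..<r} \<times> B) =
        emeasure (\<mu> c \<bind> (\<lambda>y. distr (Q (c, y)) (borel \<Otimes>\<^sub>M borel) (\<lambda>a. (a, y)))) ({..<r} \<times> B)"
      if B [measurable]: "B \<in> sets borel" for B r
    proof (cases "r = -\<infinity>")
      case True
      then have "{..<r} = {}" by auto
      then show ?thesis by simp
    next
      case False
      then obtain q where q: "incseq q" "\<And>i. ?e (q i) < r" "\<And>p. ?e p < r \<Longrightarrow> \<exists>i. p \<le> q i"
        "{..<r} = (\<Union>i. {..?e (q i)})"
        by (rule rational_cofinal_below) blast
      have "AE y in \<mu> c. \<forall>p q. p \<le> q \<longrightarrow> g p (c, y) \<le> g q (c, y)"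
        using mono by (simp add: AE_all_countable)
      moreover have "AE y in \<mu> c. \<forall>q. g q (c, y) \<le> 1"
        using le1 by (simp add: AE_all_countable)
      ultimately have "AE y in \<mu> c. emeasure (Q (c, y)) {..<r} = (SUP i. ennreal (g (q i) (c, y)))"
      proof eventually_elim
        case (elim y)
        have "quantile (\<lambda>q. g q (c, y)) \<in> unit_uniform \<rightarrow>\<^sub>M borel"
          unfolding quantile_def by measurable
        then have "emeasure (Q (c, y)) {..<r} = emeasure unit_uniform {u. quantile (\<lambda>q. g q (c, y)) u < r}"
          unfolding Q_def by (subst emeasure_distr) (auto simp: vimage_def simp del: emeasure_uniform_measure)
        also have "\<dots> = (SUP p\<in>{p. ?e p < r}. ennreal (g p (c, y)))"
          by (rule emeasure_quantile) (use elim(2) g0 in simp_all)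
        also have "\<dots> = (SUP i. ennreal (g (q i) (c, y)))"
        proof (rule antisym)
          show "(SUP p\<in>{p. ?e p < r}. ennreal (g p (c, y))) \<le> (SUP i. ennreal (g (q i) (c, y)))"
          proof (rule SUP_least)
            fix p assume "p \<in> {p. ?e p < r}"
            then obtain i where "p \<le> q i" using q(3) by auto
            then have "ennreal (g p (c, y)) \<le> ennreal (g (q i) (c, y))" using elim(1) by (auto intro: ennreal_leI)
            also have "\<dots> \<le> (SUP i. ennreal (g (q i) (c, y)))" by (rule SUP_upper) simp
            finally show "ennreal (g p (c, y)) \<le> (SUP i. ennreal (g (q i) (c, y)))" .
          qed
          show "(SUP i. ennreal (g (q i) (c, y))) \<le> (SUP p\<in>{p. ?e p < r}. ennreal (g p (c, y)))"
            using q(2) by (intro SUP_mono) auto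
        qed
        finally show ?case .
      qed
      then have "AE y in \<mu> c. emeasure (Q (c, y)) {..<r} * indicator B y = (SUP i. ennreal (g (q i) (c, y)) * indicator B y)"
        by eventually_elim (simp add: SUP_mult_right_ennreal)
      then have "(\<integral>\<^sup>+y. emeasure (Q (c, y)) {..<r} * indicator B y \<partial>\<mu> c)
         = (\<integral>\<^sup>+y. (SUP i. ennreal (g (q i) (c, y)) * indicator B y) \<partial>\<mu> c)"
        by (rule nn_integral_cong_AE)
      also have "\<dots> = (SUP i. \<integral>\<^sup>+y. ennreal (g (q i) (c, y)) * indicator B y \<partial>\<mu> c)"
      proof (rule nn_integral_monotone_convergence_SUP_AE)
        show "AE y in \<mu> c. ennreal (g (q i) (c, y)) * indicator B y \<le> ennreal (g (q (Suc i)) (c, y)) * indicator B y" for i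
          using mono[OF incseq_SucD[OF q(1)], of i]
          by eventually_elim (auto intro!: mult_right_mono ennreal_leI)
        show "(\<lambda>y. ennreal (g (q i) (c, y)) * indicator B y) \<in> borel_measurable (\<mu> c)" for i
          using gc[OF c, of "q i"] by measurable
      qed
      also have "\<dots> = (SUP i. emeasure (R c) ({..?e (q i)} \<times> B))"
        using c by (simp add: gi)
      also have "\<dots> = emeasure (R c) (\<Union>i. {..?e (q i)} \<times> B)"
      proof (rule SUP_emeasure_incseq)
        show "incseq (\<lambda>i. {..?e (q i)} \<times> B)"
          using atMost_mono[OF incseqD[OF q(1)]] by (intro incseq_SucI Sigma_mono) auto
      qed (use c in auto)
      also have "(\<Union>i. {..?e (q i)} \<times> B) = {..<r} \<times> B" using q(4) by auto
      finally show ?thesis by (simp add: rect)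
    qed
  qed
  note Req = this
  have "(\<integral>\<^sup>+p. h p \<partial>R c) = (\<integral>\<^sup>+p. (\<integral>\<^sup>+a. h (a, snd p) \<partial>Q (c, snd p)) \<partial>R c)"
    if c: "c \<in> space M" and h [measurable]: "h \<in> borel_measurable (borel \<Otimes>\<^sub>M borel)" for c h
  proof -
    have Qc: "(\<lambda>y. Q (c, y)) \<in> borel \<rightarrow>\<^sub>M prob_algebra borel"
      using measurable_Pair2[OF Q c] .
    have k: "(\<lambda>y. distr (Q (c, y)) (borel \<Otimes>\<^sub>M borel) (\<lambda>a. (a, y))) \<in> \<mu> c \<rightarrow>\<^sub>M prob_algebra (borel \<Otimes>\<^sub>M borel)"
      by (rule measurable_distr_prob_space2[where M=borel]) (use Qc in auto)
    have Qsets: "sets (Q p) = sets borel" "space (Q p) = UNIV" for p by (auto simp: Q_def)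
    have "(\<integral>\<^sup>+p. h p \<partial>R c) = (\<integral>\<^sup>+y. \<integral>\<^sup>+p. h p \<partial>distr (Q (c, y)) (borel \<Otimes>\<^sub>M borel) (\<lambda>a. (a, y)) \<partial>\<mu> c)"
      by (subst Req[OF c], rule nn_integral_bind[OF h measurable_prob_algebraD[OF k]])
    also have "\<dots> = (\<integral>\<^sup>+y. \<integral>\<^sup>+a. h (a, y) \<partial>Q (c, y) \<partial>\<mu> c)"
      by (intro nn_integral_cong nn_integral_distr) (auto simp: measurable_cong_sets[OF Qsets(1) refl])
    also have "\<dots> = (\<integral>\<^sup>+p. (\<integral>\<^sup>+a. h (a, snd p) \<partial>Q (c, snd p)) \<partial>R c)"
    proof -
      have 1: "snd \<in> R c \<rightarrow>\<^sub>M borel"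
        by (simp add: measurable_cong_sets[OF Rsets[OF c] refl])
      have 2: "(\<lambda>y. \<integral>\<^sup>+a. h (a, y) \<partial>Q (c, y)) \<in> borel_measurable borel"
        by (rule nn_integral_measurable_subprob_algebra2[OF _ measurable_prob_algebraD[OF Qc]]) measurable
      show ?thesis unfolding \<mu>_def by (rule nn_integral_distr[OF 1]) (simp add: 2)
    qed
    finally show ?thesis .
  qed
  then show ?thesis using Q by blast
qed

section \<open>Standard spaces as measurable retracts of the real line\<close>

text \<open>
  This weakening of an isomorphism onto a Borel subset is enough to transport a disintegration, and it is
  easy to establish for products.
\<close>

definition measurable_retract :: "'a measure \<Rightarrow> 'b measure \<Rightarrow> bool" where
  "measurable_retract M N \<longleftrightarrow>
     (\<exists>\<phi> \<in> M \<rightarrow>\<^sub>M N. \<exists>\<psi> \<in> N \<rightarrow>\<^sub>M M. \<forall>x\<in>space M. \<psi> (\<phi> x) = x)"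

lemma measurable_retract_trans:
  assumes "measurable_retract M N" "measurable_retract N L"
  shows "measurable_retract M L"
proof -
  obtain \<phi> \<psi> where 1: "\<phi> \<in> M \<rightarrow>\<^sub>M N" "\<psi> \<in> N \<rightarrow>\<^sub>M M" "\<forall>x\<in>space M. \<psi> (\<phi> x) = x"
    using assms(1) unfolding measurable_retract_def by blast
  obtain \<phi>' \<psi>' where 2: "\<phi>' \<in> N \<rightarrow>\<^sub>M L" "\<psi>' \<in> L \<rightarrow>\<^sub>M N" "\<forall>x\<in>space N. \<psi>' (\<phi>' x) = x"
    using assms(2) unfolding measurable_retract_def by blast
  show ?thesis
    unfolding measurable_retract_def
  proof (intro bexI ballI)
    show "(\<psi> \<circ> \<psi>') ((\<phi>' \<circ> \<phi>) x) = x" if "x \<in> space M" for x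
      using that 1(3) 2(3) measurable_space[OF 1(1) that] by simp
  qed (use 1 2 in \<open>auto intro: measurable_comp\<close>)
qed

text \<open>
  The inverse of the isomorphism is extended from the Borel set to the whole line by a constant; this is
  where the space has to be nonempty.
\<close>

lemma standard_space_retract_real:
  assumes "standard_space M" and ne: "space M \<noteq> {}"
  shows "measurable_retract M (borel :: real measure)"
proof -
  obtain S f g where S: "S \<in> sets (borel :: real measure)"
    and f: "f \<in> M \<rightarrow>\<^sub>M restrict_space borel S" and g: "g \<in> restrict_space borel S \<rightarrow>\<^sub>M M"
    and gf: "\<And>x. x \<in> space M \<Longrightarrow> g (f x) = x"
    using assms(1) unfolding standard_space_def measurably_isomorphic_def by blast
  obtain x0 where x0: "x0 \<in> space M" using ne by blast
  have f': "f \<in> M \<rightarrow>\<^sub>M borel" "\<And>x. x \<in> space M \<Longrightarrow> f x \<in> S"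
    using f S by (auto simp: measurable_restrict_space2_iff)
  have "(\<lambda>y. if y \<in> S then g y else x0) \<in> borel \<rightarrow>\<^sub>M M"
    using g x0 S by (intro measurable_If_restrict_space_iff[THEN iffD2]) auto
  moreover have "\<forall>x\<in>space M. (\<lambda>y. if y \<in> S then g y else x0) (f x) = x"
    using f'(2) gf by simp
  ultimately show ?thesis
    unfolding measurable_retract_def by (intro bexI[OF bexI[OF _ _] f'(1)])
qed

text \<open>
  The sequence space is a convenient intermediate step, because a nonempty finite power of it is the
  space itself with relabelled coordinates.
\<close>

abbreviation cantor :: "(nat \<Rightarrow> bool) measure" where
  "cantor \<equiv> PiM UNIV (\<lambda>_. count_space UNIV)"

text \<open>
  A real number is encoded by its Dedekind cut in the rationals and decoded as the supremum of the cut.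
\<close>

lemma real_retract_cantor: "measurable_retract (borel :: real measure) cantor"
proof -
  define q :: "nat \<Rightarrow> real" where "q n = real_of_rat (from_nat n)" for n
  define \<phi> :: "real \<Rightarrow> nat \<Rightarrow> bool" where "\<phi> x n \<longleftrightarrow> q n < x" for x n
  define \<psi> :: "(nat \<Rightarrow> bool) \<Rightarrow> real" where
    "\<psi> b = real_of_ereal (SUP n. if b n then ereal (q n) else -\<infinity>)" for b
  have "\<phi> \<in> borel \<rightarrow>\<^sub>M cantor"
    unfolding \<phi>_def[abs_def] by (rule measurable_PiM_single') auto
  moreover have "\<psi> \<in> cantor \<rightarrow>\<^sub>M borel"
    unfolding \<psi>_def[abs_def] by measurable
  moreover have "\<psi> (\<phi> x) = x" for x
  proof -
    have "(SUP n. if \<phi> x n then ereal (q n) else -\<infinity>) = ereal x"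
    proof (rule antisym)
      show "(SUP n. if \<phi> x n then ereal (q n) else -\<infinity>) \<le> ereal x"
        by (rule SUP_least) (auto simp: \<phi>_def)
      show "ereal x \<le> (SUP n. if \<phi> x n then ereal (q n) else -\<infinity>)"
      proof (rule dense_le)
        fix y assume y: "y < ereal x"
        then obtain z where z: "y < ereal z" "z < x"
          using ereal_dense2[OF y] by auto
        obtain p where p: "z < real_of_rat p" "real_of_rat p < x" using of_rat_dense[OF z(2)] by auto
        have "y \<le> (if \<phi> x (to_nat p) then ereal (q (to_nat p)) else -\<infinity>)"
          using p z by (cases y) (auto simp: \<phi>_def q_def)
        also have "\<dots> \<le> (SUP n. if \<phi> x n then ereal (q n) else -\<infinity>)" by (rule SUP_upper) simp
        finally show "y \<le> (SUP n. if \<phi> x n then ereal (q n) else -\<infinity>)" .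
      qed
    qed
    then show ?thesis by (simp add: \<psi>_def)
  qed
  ultimately show ?thesis unfolding measurable_retract_def by (intro bexI[of _ \<phi>] bexI[of _ \<psi>]) auto
qed

text \<open>
  The sequences that encode the coordinates are interleaved along the pairing of natural numbers.
\<close>

lemma PiM_retract_cantor:
  fixes X :: "'i \<Rightarrow> 'a measure"
  assumes fin: "finite I" and X: "\<And>i. i \<in> I \<Longrightarrow> measurable_retract (X i) cantor"
  shows "measurable_retract (PiM I X) cantor"
proof -
  have "\<forall>i\<in>I. \<exists>f g. f \<in> X i \<rightarrow>\<^sub>M cantor \<and> g \<in> cantor \<rightarrow>\<^sub>M X i \<and> (\<forall>x\<in>space (X i). g (f x) = x)"
    using X unfolding measurable_retract_def by blast
  then obtain f g where f [measurable]: "\<And>i. i \<in> I \<Longrightarrow> f i \<in> X i \<rightarrow>\<^sub>M cantor"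
    and g: "\<And>i. i \<in> I \<Longrightarrow> g i \<in> cantor \<rightarrow>\<^sub>M X i"
    and gf: "\<And>i x. i \<in> I \<Longrightarrow> x \<in> space (X i) \<Longrightarrow> g i (f i x) = x"
    by metis
  obtain e :: "'i \<Rightarrow> nat" where e: "inj_on e I" using finite_imp_inj_to_nat_seg[OF fin] by auto
  define i where "i n = the_inv_into I e n" for n
  have i: "i (e k) = k" if "k \<in> I" for k using the_inv_into_f_f[OF e that] by (simp add: i_def)
  define \<phi> where "\<phi> x n \<longleftrightarrow> fst (prod_decode n) \<in> e ` I \<and>
     f (i (fst (prod_decode n))) (x (i (fst (prod_decode n)))) (snd (prod_decode n))" for x n
  define \<psi> where "\<psi> b = (\<lambda>k\<in>I. g k (\<lambda>n. b (prod_encode (e k, n))))" for b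
  have "\<phi> \<in> PiM I X \<rightarrow>\<^sub>M cantor"
  proof (rule measurable_PiM_single')
    fix n :: nat
    show "(\<lambda>x. \<phi> x n) \<in> PiM I X \<rightarrow>\<^sub>M count_space UNIV"
    proof (cases "fst (prod_decode n) \<in> e ` I")
      case True
      then have k: "i (fst (prod_decode n)) \<in> I" using i by auto
      have "(\<lambda>x. f (i (fst (prod_decode n))) (x (i (fst (prod_decode n)))) (snd (prod_decode n))) \<in> PiM I X \<rightarrow>\<^sub>M count_space UNIV"
        using k by measurable
      then show ?thesis using True by (simp add: \<phi>_def)
    qed (simp add: \<phi>_def)
  qed auto
  moreover have "\<psi> \<in> cantor \<rightarrow>\<^sub>M PiM I X"
    unfolding \<psi>_def[abs_def]
  proof (rule measurable_restrict)
    fix k assume k: "k \<in> I"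
    have "(\<lambda>b n. b (prod_encode (e k, n))) \<in> cantor \<rightarrow>\<^sub>M cantor"
      by (rule measurable_PiM_single') auto
    from measurable_compose[OF this g[OF k]]
    show "(\<lambda>b. g k (\<lambda>n. b (prod_encode (e k, n)))) \<in> cantor \<rightarrow>\<^sub>M X k" .
  qed
  moreover have "\<psi> (\<phi> x) = x" if x: "x \<in> space (PiM I X)" for x
  proof
    fix k
    show "\<psi> (\<phi> x) k = x k"
    proof (cases "k \<in> I")
      case True
      then have "(\<lambda>n. \<phi> x (prod_encode (e k, n))) = f k (x k)" by (auto simp: \<phi>_def i)
      then show ?thesis using True gf[OF True, of "x k"] x by (auto simp: \<psi>_def space_PiM)
    next
      case False
      then show ?thesis using x by (auto simp: \<psi>_def space_PiM PiE_def extensional_def)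
    qed
  qed
  ultimately show ?thesis unfolding measurable_retract_def by (intro bexI[of _ \<phi>] bexI[of _ \<psi>]) auto
qed

text \<open>
  A sequence of bits is read as the digits of a number in base \<open>3\<close>. As the digit \<open>2\<close> does not occur, the
  tail after any digit contributes at most half a unit of that digit, so the digits can be recovered by
  rounding down.
\<close>

lemma cantor_retract_real: "measurable_retract cantor (borel :: real measure)"
proof -
  define c where "c b n = of_bool (b n) * (1 / 3 :: real) ^ Suc n" for b :: "nat \<Rightarrow> bool" and n
  define \<phi> where "\<phi> b = (\<Sum>n. c b n)" for b
  define \<psi> :: "real \<Rightarrow> nat \<Rightarrow> bool" where "\<psi> x n \<longleftrightarrow> \<lfloor>3 ^ Suc n * x\<rfloor> mod 3 = 1" for x n
  have geo: "summable (\<lambda>n. (1 / 3 :: real) ^ Suc n)" by (simp add: summable_geometric)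
  have sm: "summable (c b)" for b
    by (rule summable_comparison_test'[OF geo, of 0]) (auto simp: c_def)
  have "\<phi> \<in> cantor \<rightarrow>\<^sub>M borel"
    unfolding \<phi>_def[abs_def] c_def[abs_def] by measurable
  moreover have "\<psi> \<in> borel \<rightarrow>\<^sub>M cantor"
    unfolding \<psi>_def[abs_def] by (rule measurable_PiM_single') auto
  moreover have "\<psi> (\<phi> b) n = b n" for b n
  proof -
    \<comment> \<open>The tail after the digit \<open>n\<close>, and the integer formed by the digits before it.\<close>
    define t where "t = 3 ^ Suc n * (\<Sum>k. c b (k + Suc n))"
    have t0: "0 \<le> t" unfolding t_def
      by (intro mult_nonneg_nonneg suminf_nonneg summable_ignore_initial_segment sm) (auto simp: c_def)
    have "(\<Sum>k. c b (k + Suc n)) \<le> (\<Sum>k. (1 / 3) ^ (Suc n) * (1 / 3 :: real) ^ Suc k)"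
      by (rule suminf_le[OF _ summable_ignore_initial_segment[OF sm] summable_mult[OF geo]])
         (auto simp: c_def power_add)
    also have "\<dots> = (1 / 3) ^ (Suc n) * (\<Sum>k. (1 / 3 :: real) ^ Suc k)" by (rule suminf_mult[OF geo])
    also have "(\<Sum>k. (1 / 3 :: real) ^ Suc k) = 1 / 2"
      using sums_mult[OF geometric_sums[of "1/3::real"], of "1/3"]
      by (intro sums_unique[symmetric]) simp
    finally have "t \<le> 1 / 2" by (simp add: t_def power_one_over field_simps)
    then have t1: "t < 1" by simp
    define m :: int where "m = (\<Sum>k<n. of_bool (b k) * 3 ^ (n - Suc k))"
    have "3 ^ Suc n * (\<Sum>k<n. c b k) = 3 * real_of_int m"
    proof -
      have "3 ^ Suc n * c b k = 3 * of_int (of_bool (b k) * 3 ^ (n - Suc k))" if "k < n" for k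
      proof -
        have "(3 :: real) ^ n = 3 ^ (n - Suc k) * 3 ^ Suc k"
          unfolding power_add[symmetric] using that by simp
        then show ?thesis by (simp add: c_def power_one_over)
      qed
      then have "(\<Sum>k<n. 3 ^ Suc n * c b k) = (\<Sum>k<n. 3 * of_int (of_bool (b k) * 3 ^ (n - Suc k)))"
        by (intro sum.cong) auto
      then show ?thesis by (simp add: m_def sum_distrib_left del: sum_of_bool_mult_eq sum_mult_of_bool_eq)
    qed
    moreover have "3 ^ Suc n * c b n = of_bool (b n)" by (simp add: c_def power_one_over)
    moreover have "\<phi> b = (\<Sum>k<n. c b k) + c b n + (\<Sum>k. c b (k + Suc n))"
      using suminf_split_initial_segment[OF sm, of b "Suc n"] by (simp add: \<phi>_def)
    ultimately have "3 ^ Suc n * \<phi> b = of_int (3 * m + of_bool (b n)) + t"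
      by (simp add: t_def distrib_left del: power_Suc)
    then have "\<lfloor>3 ^ Suc n * \<phi> b\<rfloor> = 3 * m + of_bool (b n)"
      using t0 t1 by (intro floor_unique) auto
    then show ?thesis by (simp add: \<psi>_def del: power_Suc)
  qed
  ultimately show ?thesis unfolding measurable_retract_def by (intro bexI[of _ \<phi>] bexI[of _ \<psi>]) auto
qed

lemma real_retract_ereal: "measurable_retract (borel :: real measure) (borel :: ereal measure)"
  unfolding measurable_retract_def
  by (rule bexI[of _ ereal], rule bexI[of _ real_of_ereal]) simp_all

lemma PiM_standard_retract_real:
  assumes fin: "finite I" and X: "\<And>i. i \<in> I \<Longrightarrow> standard_space (X i)" and ne: "space (PiM I X) \<noteq> {}"
  shows "measurable_retract (PiM I X) (borel :: real measure)"
proof (rule measurable_retract_trans[OF PiM_retract_cantor[OF fin] cantor_retract_real])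
  fix i assume i: "i \<in> I"
  have "space (X i) \<noteq> {}" using ne i by (auto simp: space_PiM PiE_eq_empty_iff)
  then show "measurable_retract (X i) cantor"
    by (rule measurable_retract_trans[OF standard_space_retract_real[OF X[OF i]] real_retract_cantor])
qed

section \<open>Disintegration of kernels between standard spaces\<close>

text \<open>
  The disintegration over the line is transported along retractions. Sending the real point that encodes
  \<open>y\<close> back to \<open>y\<close> is exact, so no null sets arise.
\<close>

proposition disintegration:
  fixes R :: "'c \<Rightarrow> ('a \<times> 'b) measure"
  assumes R: "R \<in> M \<rightarrow>\<^sub>M prob_algebra (MA \<Otimes>\<^sub>M MY)"
    and A: "measurable_retract MA (borel :: real measure)"
    and Y: "measurable_retract MY (borel :: real measure)"
  shows "\<exists>Q \<in> M \<Otimes>\<^sub>M MY \<rightarrow>\<^sub>M prob_algebra MA. \<forall>c\<in>space M.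
     \<forall>h\<in>borel_measurable (MA \<Otimes>\<^sub>M MY).
       (\<integral>\<^sup>+p. h p \<partial>R c) = (\<integral>\<^sup>+p. (\<integral>\<^sup>+a. h (a, snd p) \<partial>Q (c, snd p)) \<partial>R c)"
proof -
  obtain \<phi> \<psi> where a [measurable]: "\<phi> \<in> MA \<rightarrow>\<^sub>M (borel :: ereal measure)" "\<psi> \<in> borel \<rightarrow>\<^sub>M MA"
    and a3: "\<forall>x\<in>space MA. \<psi> (\<phi> x) = x"
    using measurable_retract_trans[OF A real_retract_ereal] unfolding measurable_retract_def by blast
  obtain \<phi>' \<psi>' where y [measurable]: "\<phi>' \<in> MY \<rightarrow>\<^sub>M (borel :: real measure)" "\<psi>' \<in> borel \<rightarrow>\<^sub>M MY"
    and y3: "\<forall>x\<in>space MY. \<psi>' (\<phi>' x) = x"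
    using Y unfolding measurable_retract_def by blast
  let ?\<Phi> = "\<lambda>p. (\<phi> (fst p), \<phi>' (snd p))"
  define R' where "R' c = distr (R c) (borel \<Otimes>\<^sub>M borel) ?\<Phi>" for c
  have "R' \<in> M \<rightarrow>\<^sub>M prob_algebra (borel \<Otimes>\<^sub>M borel)"
    unfolding R'_def[abs_def] by (rule measurable_compose[OF R measurable_distr_prob_space]) measurable
  from disintegration_ereal_real[OF this]
  obtain Q' where Q' [measurable]: "Q' \<in> M \<Otimes>\<^sub>M borel \<rightarrow>\<^sub>M prob_algebra borel"
    and Q'eq: "\<forall>c\<in>space M. \<forall>h\<in>borel_measurable (borel \<Otimes>\<^sub>M borel).
       (\<integral>\<^sup>+p. h p \<partial>R' c) = (\<integral>\<^sup>+p. (\<integral>\<^sup>+a. h (a, snd p) \<partial>Q' (c, snd p)) \<partial>R' c)"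
    by (elim bexE)
  define Q where "Q p = distr (Q' (fst p, \<phi>' (snd p))) MA \<psi>" for p
  have Q'': "(\<lambda>p. Q' (fst p, \<phi>' (snd p))) \<in> M \<Otimes>\<^sub>M MY \<rightarrow>\<^sub>M prob_algebra borel"
    by measurable
  have Q: "Q \<in> M \<Otimes>\<^sub>M MY \<rightarrow>\<^sub>M prob_algebra MA"
    unfolding Q_def[abs_def] by (rule measurable_compose[OF Q'' measurable_distr_prob_space]) measurable
  have "(\<integral>\<^sup>+p. h p \<partial>R c) = (\<integral>\<^sup>+p. (\<integral>\<^sup>+a. h (a, snd p) \<partial>Q (c, snd p)) \<partial>R c)"
    if c: "c \<in> space M" and h [measurable]: "h \<in> borel_measurable (MA \<Otimes>\<^sub>M MY)" for c h
  proof -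
    have Rsets: "sets (R c) = sets (MA \<Otimes>\<^sub>M MY)"
      using measurable_space[OF R c] by (simp add: space_prob_algebra)
    note [measurable_cong] = Rsets
    have Rspace: "space (R c) = space MA \<times> space MY"
      using sets_eq_imp_space_eq[OF Rsets] by (simp add: space_pair_measure)
    have Q's: "sets (Q' (c, z)) = sets borel" for z
      using measurable_space[OF Q', of "(c, z)"] c by (simp add: space_prob_algebra space_pair_measure)
    let ?h = "\<lambda>p. h (\<psi> (fst p), \<psi>' (snd p))"
    have "(\<integral>\<^sup>+p. h p \<partial>R c) = (\<integral>\<^sup>+p. ?h (?\<Phi> p) \<partial>R c)"
      by (intro nn_integral_cong) (auto simp: Rspace a3 y3)
    also have "\<dots> = (\<integral>\<^sup>+p. ?h p \<partial>R' c)"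
      unfolding R'_def by (rule nn_integral_distr[symmetric]) measurable
    also have "\<dots> = (\<integral>\<^sup>+p. (\<integral>\<^sup>+a. h (\<psi> a, \<psi>' (snd p)) \<partial>Q' (c, snd p)) \<partial>R' c)"
      using Q'eq[rule_format, OF c, of ?h] by simp
    also have "\<dots> = (\<integral>\<^sup>+p. (\<integral>\<^sup>+a. h (\<psi> a, \<psi>' (\<phi>' (snd p))) \<partial>Q' (c, \<phi>' (snd p))) \<partial>R c)"
    proof -
      have "(\<lambda>p. \<integral>\<^sup>+a. h (\<psi> a, \<psi>' (snd p)) \<partial>Q' (c, snd p)) \<in> borel_measurable (borel \<Otimes>\<^sub>M borel)"
        by (rule nn_integral_measurable_subprob_algebra2[OF _ measurable_prob_algebraD[OF
             measurable_compose[OF _ measurable_Pair2[OF Q' c]]]]) measurable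
      then show ?thesis
        unfolding R'_def by (subst nn_integral_distr) auto
    qed
    also have "\<dots> = (\<integral>\<^sup>+p. (\<integral>\<^sup>+a. h (a, snd p) \<partial>Q (c, snd p)) \<partial>R c)"
    proof (rule nn_integral_cong)
      fix p assume "p \<in> space (R c)"
      then have p: "snd p \<in> space MY" by (auto simp: Rspace)
      show "(\<integral>\<^sup>+a. h (\<psi> a, \<psi>' (\<phi>' (snd p))) \<partial>Q' (c, \<phi>' (snd p))) = (\<integral>\<^sup>+a. h (a, snd p) \<partial>Q (c, snd p))"
        unfolding Q_def using p
        by (subst nn_integral_distr) (auto simp: y3 measurable_cong_sets[OF Q's refl])
    qed
    finally show ?thesis .
  qed
  then show ?thesis by (intro bexI[OF _ Q] ballI)
qed

section \<open>Adding one node to a factorization\<close>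

text \<open>
  The invariant of the induction over the nodes. Under each law \<open>W t\<close> of a configuration, the kernel \<open>Q\<close>
  is a conditional law of the coordinates \<open>A\<close> given the coordinates \<open>D\<close>; it must not depend on \<open>t\<close>, and it
  may only read the coordinates \<open>C\<close>. Test functions of both blocks, instead of rectangles, make the
  invariant directly applicable to the integrands that arise when a further node is added.
\<close>

definition kernel_factorization ::
  "('n \<Rightarrow> 'a measure) \<Rightarrow> 't set \<Rightarrow> ('t \<Rightarrow> ('n \<Rightarrow> 'a) measure) \<Rightarrow> 'n set \<Rightarrow> 'n set \<Rightarrow> 'n set \<Rightarrow> bool" where
  "kernel_factorization X T W A D C \<longleftrightarrow>
     (\<exists>Q \<in> PiM C X \<rightarrow>\<^sub>M prob_algebra (PiM A X). \<forall>t\<in>T. \<forall>f\<in>borel_measurable (PiM A X \<Otimes>\<^sub>M PiM D X).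
       (\<integral>\<^sup>+w. f (restrict w A, restrict w D) \<partial>W t) =
       (\<integral>\<^sup>+w. (\<integral>\<^sup>+a. f (a, restrict w D) \<partial>Q (restrict w C)) \<partial>W t))"

lemma nn_integral_kernel_measurable:
  assumes "case_prod f \<in> borel_measurable (M \<Otimes>\<^sub>M N)" "L \<in> M \<rightarrow>\<^sub>M prob_algebra N"
  shows "(\<lambda>x. \<integral>\<^sup>+y. f x y \<partial>L x) \<in> borel_measurable M"
  using assms by (intro nn_integral_measurable_subprob_algebra2 measurable_prob_algebraD)

lemma prob_algebraD:
  assumes "\<kappa> \<in> M \<rightarrow>\<^sub>M prob_algebra N" "x \<in> space M"
  shows "sets (\<kappa> x) = sets N" "space (\<kappa> x) = space N" "prob_space (\<kappa> x)"
  using measurable_space[OF assms] by (auto simp: space_prob_algebra dest: sets_eq_imp_space_eq)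

text \<open>
  \<open>W' t\<close> is the law of a configuration on \<open>insert v N\<close> obtained from one on \<open>N\<close> with law \<open>W t\<close> by drawing
  the value of \<open>v\<close> from \<open>\<kappa>\<close>, which reads the coordinates \<open>p\<close>.
\<close>

locale one_node_extension =
  fixes X :: "'n \<Rightarrow> 'a measure" and N p :: "'n set" and v :: 'n
    and \<kappa> :: "('n \<Rightarrow> 'a) \<Rightarrow> 'a measure"
    and T :: "'t set" and W W' :: "'t \<Rightarrow> ('n \<Rightarrow> 'a) measure"
  assumes v: "v \<notin> N" and p: "p \<subseteq> N"
    and kernel: "\<kappa> \<in> PiM p X \<rightarrow>\<^sub>M prob_algebra (X v)"
    and sets_W: "\<And>t. t \<in> T \<Longrightarrow> sets (W t) = sets (PiM N X)"
    and W': "\<And>t f. t \<in> T \<Longrightarrow> f \<in> borel_measurable (PiM (insert v N) X) \<Longrightarrow>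
      (\<integral>\<^sup>+w. f w \<partial>W' t) = (\<integral>\<^sup>+w. (\<integral>\<^sup>+y. f (w(v := y)) \<partial>\<kappa> (restrict w p)) \<partial>W t)"
begin

lemma space_W: "t \<in> T \<Longrightarrow> space (W t) = space (PiM N X)"
  using sets_W by (rule sets_eq_imp_space_eq)

lemma restrict_upd_other: "v \<notin> S \<Longrightarrow> restrict (w(v := y)) S = restrict w S"
  by (auto simp: restrict_def)

lemma restrict_space:
  assumes "S \<subseteq> N'" "w \<in> space (PiM N' X)" shows "restrict w S \<in> space (PiM S X)"
  using assms by (auto simp: space_PiM)

lemma kernel_restrict: "p \<subseteq> S \<Longrightarrow> (\<lambda>w. \<kappa> (restrict w p)) \<in> PiM S X \<rightarrow>\<^sub>M prob_algebra (X v)"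
  by (rule measurable_compose[OF measurable_restrict_subset kernel])

lemma measurable_upd [measurable]:
  assumes "f \<in> L \<rightarrow>\<^sub>M PiM S X" "g \<in> L \<rightarrow>\<^sub>M X v"
  shows "(\<lambda>x. (f x)(v := g x)) \<in> L \<rightarrow>\<^sub>M PiM (insert v S) X"
  using measurable_compose[OF measurable_Pair[OF assms] measurable_add_dim[of v S X]] by simp

text \<open>
  A node that is tracked by neither block is integrated out, as its kernel has total mass one.
\<close>

lemma factorization_ignore:
  assumes sub: "A \<subseteq> N" "D \<subseteq> N" "C \<subseteq> D" and F: "kernel_factorization X T W A D C"
  shows "kernel_factorization X T W' A D C"
proof -
  have vn: "v \<notin> A" "v \<notin> D" "v \<notin> C" using sub v by auto
  obtain Q where Q [measurable]: "Q \<in> PiM C X \<rightarrow>\<^sub>M prob_algebra (PiM A X)"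
    and eq: "\<forall>t\<in>T. \<forall>f\<in>borel_measurable (PiM A X \<Otimes>\<^sub>M PiM D X).
       (\<integral>\<^sup>+w. f (restrict w A, restrict w D) \<partial>W t) =
       (\<integral>\<^sup>+w. (\<integral>\<^sup>+a. f (a, restrict w D) \<partial>Q (restrict w C)) \<partial>W t)"
    using F unfolding kernel_factorization_def by (elim bexE)
  have const: "(\<integral>\<^sup>+w. h w \<partial>W' t) = (\<integral>\<^sup>+w. h w \<partial>W t)"
    if t: "t \<in> T" and h: "h \<in> borel_measurable (PiM (insert v N) X)" and hv: "\<And>w y. h (w(v := y)) = h w" for h t
    unfolding W'[OF t h] hv
  proof (rule nn_integral_cong)
    fix w assume "w \<in> space (W t)"
    then have "prob_space (\<kappa> (restrict w p))"
      using prob_algebraD(3)[OF kernel] restrict_space[OF p] by (simp add: space_W t)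
    then show "(\<integral>\<^sup>+y. h w \<partial>\<kappa> (restrict w p)) = h w" by (simp add: prob_space.emeasure_space_1)
  qed
  show ?thesis
    unfolding kernel_factorization_def
  proof (intro bexI[OF _ Q] ballI)
    fix t and f :: "('n \<Rightarrow> 'a) \<times> ('n \<Rightarrow> 'a) \<Rightarrow> ennreal"
    assume t: "t \<in> T" and f [measurable]: "f \<in> borel_measurable (PiM A X \<Otimes>\<^sub>M PiM D X)"
    have r: "(\<lambda>w. restrict w S) \<in> PiM (insert v N) X \<rightarrow>\<^sub>M PiM S X" if "S \<subseteq> N" for S
      using that by (intro measurable_restrict_subset) auto
    note [measurable] = r[OF sub(1)] r[OF sub(2)] r[OF order_trans[OF sub(3,2)]]
    have "(\<integral>\<^sup>+w. f (restrict w A, restrict w D) \<partial>W' t) = (\<integral>\<^sup>+w. f (restrict w A, restrict w D) \<partial>W t)"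
      by (rule const[OF t]) (simp_all add: restrict_upd_other vn)
    also have "\<dots> = (\<integral>\<^sup>+w. (\<integral>\<^sup>+a. f (a, restrict w D) \<partial>Q (restrict w C)) \<partial>W t)"
      using eq t f by blast
    also have "\<dots> = (\<integral>\<^sup>+w. (\<integral>\<^sup>+a. f (a, restrict w D) \<partial>Q (restrict w C)) \<partial>W' t)"
      by (rule const[OF t, symmetric], rule nn_integral_kernel_measurable[where N="PiM A X"])
         (simp_all add: restrict_upd_other vn)
    finally show "(\<integral>\<^sup>+w. f (restrict w A, restrict w D) \<partial>W' t) = \<dots>" .
  qed
qed

text \<open>
  Given the \<open>D\<close>-block, the new value is independent of the \<open>A\<close>-block, so \<open>Q\<close> stays a conditional law. The
  set \<open>C'\<close> covers both a new node in \<open>C\<close> and one outside of it.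
\<close>

lemma factorization_extend_right:
  assumes sub: "A \<subseteq> N" "D \<subseteq> N" "C \<subseteq> D" and F: "kernel_factorization X T W A D C"
    and pD: "p \<subseteq> D" and C': "C \<subseteq> C'" "C' \<subseteq> insert v D"
  shows "kernel_factorization X T W' A (insert v D) C'"
proof -
  have vn: "v \<notin> A" "v \<notin> D" "v \<notin> C" using sub v by auto
  obtain Q where Q [measurable]: "Q \<in> PiM C X \<rightarrow>\<^sub>M prob_algebra (PiM A X)"
    and eq: "\<forall>t\<in>T. \<forall>f\<in>borel_measurable (PiM A X \<Otimes>\<^sub>M PiM D X).
       (\<integral>\<^sup>+w. f (restrict w A, restrict w D) \<partial>W t) =
       (\<integral>\<^sup>+w. (\<integral>\<^sup>+a. f (a, restrict w D) \<partial>Q (restrict w C)) \<partial>W t)"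
    using F unfolding kernel_factorization_def by (elim bexE)
  have Q': "(\<lambda>c. Q (restrict c C)) \<in> PiM C' X \<rightarrow>\<^sub>M prob_algebra (PiM A X)"
    by (rule measurable_compose[OF measurable_restrict_subset[OF C'(1)] Q])
  show ?thesis
    unfolding kernel_factorization_def
  proof (intro bexI[OF _ Q'] ballI)
    fix t and f :: "('n \<Rightarrow> 'a) \<times> ('n \<Rightarrow> 'a) \<Rightarrow> ennreal"
    assume t: "t \<in> T" and f [measurable]: "f \<in> borel_measurable (PiM A X \<Otimes>\<^sub>M PiM (insert v D) X)"
    have r: "(\<lambda>w. restrict w S) \<in> PiM (insert v N) X \<rightarrow>\<^sub>M PiM S X" if "S \<subseteq> insert v N" for S
      using that by (intro measurable_restrict_subset) auto
    have "C \<subseteq> insert v N" "insert v D \<subseteq> insert v N" "A \<subseteq> insert v N" using sub by auto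
    note [measurable] = this[THEN r] kernel_restrict[OF pD]
    define g where "g q = (\<integral>\<^sup>+y. f (fst q, (snd q)(v := y)) \<partial>\<kappa> (restrict (snd q) p))" for q
    have g: "g \<in> borel_measurable (PiM A X \<Otimes>\<^sub>M PiM D X)"
      unfolding g_def[abs_def]
      by (rule nn_integral_kernel_measurable[where N="X v"]) measurable
    have Cp: "restrict (restrict w C') C = restrict w C" for w :: "'n \<Rightarrow> 'a"
      using C'(1) by (simp add: Int_absorb1)
    note Dp = Int_absorb1[OF pD]
    have "(\<integral>\<^sup>+w. f (restrict w A, restrict w (insert v D)) \<partial>W' t) = (\<integral>\<^sup>+w. g (restrict w A, restrict w D) \<partial>W t)"
      by (subst W'[OF t], measurable) (simp add: g_def Dp restrict_upd_other vn)
    also have "\<dots> = (\<integral>\<^sup>+w. (\<integral>\<^sup>+a. g (a, restrict w D) \<partial>Q (restrict w C)) \<partial>W t)"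
      using eq t g by blast
    also have "\<dots> = (\<integral>\<^sup>+w. (\<integral>\<^sup>+y. (\<integral>\<^sup>+a. f (a, (restrict w D)(v := y)) \<partial>Q (restrict w C)) \<partial>\<kappa> (restrict w p)) \<partial>W t)"
    proof (rule nn_integral_cong)
      fix w assume "w \<in> space (W t)"
      then have w: "w \<in> space (PiM N X)" by (simp add: space_W t)
      have d: "restrict w D \<in> space (PiM D X)" by (rule restrict_space[OF sub(2) w])
      have "restrict w C \<in> space (PiM C X)" by (rule restrict_space[OF _ w]) (use sub in auto)
      note q = prob_algebraD[OF Q this]
      note k = prob_algebraD[OF kernel restrict_space[OF p w]]
      interpret pair_prob_space "Q (restrict w C)" "\<kappa> (restrict w p)"
        using q(3) k(3) by (simp add: pair_prob_space_def pair_sigma_finite_def prob_space_imp_sigma_finite)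
      have "(\<lambda>(a, y). f (a, (restrict w D)(v := y))) \<in> borel_measurable (PiM A X \<Otimes>\<^sub>M X v)"
        using d by measurable
      then have "(\<lambda>(a, y). f (a, (restrict w D)(v := y))) \<in> borel_measurable (Q (restrict w C) \<Otimes>\<^sub>M \<kappa> (restrict w p))"
        by (simp add: measurable_cong_sets[OF sets_pair_measure_cong[OF q(1) k(1)] refl])
      from Fubini'[OF this]
      show "(\<integral>\<^sup>+a. g (a, restrict w D) \<partial>Q (restrict w C))
         = (\<integral>\<^sup>+y. (\<integral>\<^sup>+a. f (a, (restrict w D)(v := y)) \<partial>Q (restrict w C)) \<partial>\<kappa> (restrict w p))"
        by (simp add: g_def Dp)
    qed
    also have "\<dots> = (\<integral>\<^sup>+w. (\<integral>\<^sup>+a. f (a, restrict w (insert v D)) \<partial>Q (restrict w C)) \<partial>W' t)"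
    proof (subst W'[OF t])
      show "(\<lambda>w. \<integral>\<^sup>+a. f (a, restrict w (insert v D)) \<partial>Q (restrict w C)) \<in> borel_measurable (PiM (insert v N) X)"
        by (rule nn_integral_kernel_measurable[where N="PiM A X"]) measurable
    qed (simp add: restrict_upd_other vn)
    finally show "(\<integral>\<^sup>+w. f (restrict w A, restrict w (insert v D)) \<partial>W' t) =
      (\<integral>\<^sup>+w. (\<integral>\<^sup>+a. f (a, restrict w (insert v D)) \<partial>Q (restrict (restrict w C') C)) \<partial>W' t)"
      by (simp only: Cp)
  qed
qed

lemma measurable_merge_restrict:
  assumes "p \<subseteq> A \<union> C"
  shows "(\<lambda>(a, c). restrict (merge A C (a, c)) p) \<in> PiM A X \<Otimes>\<^sub>M PiM C X \<rightarrow>\<^sub>M PiM p X"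
  unfolding case_prod_beta prod.collapse
  by (rule measurable_compose[OF measurable_merge measurable_restrict_subset[OF assms]])

text \<open>
  The new kernel draws \<open>a\<close> from \<open>Q\<close> and then the value of \<open>v\<close> given \<open>a\<close> and \<open>c\<close>.
\<close>

lemma factorization_extend_left:
  assumes sub: "A \<subseteq> N" "D \<subseteq> N" "C \<subseteq> D" and F: "kernel_factorization X T W A D C"
    and pAC: "p \<subseteq> A \<union> C"
  shows "kernel_factorization X T W' (insert v A) D C"
proof -
  have vn: "v \<notin> A" "v \<notin> D" "v \<notin> C" using sub v by auto
  obtain Q where Q [measurable]: "Q \<in> PiM C X \<rightarrow>\<^sub>M prob_algebra (PiM A X)"
    and eq: "\<forall>t\<in>T. \<forall>f\<in>borel_measurable (PiM A X \<Otimes>\<^sub>M PiM D X).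
       (\<integral>\<^sup>+w. f (restrict w A, restrict w D) \<partial>W t) =
       (\<integral>\<^sup>+w. (\<integral>\<^sup>+a. f (a, restrict w D) \<partial>Q (restrict w C)) \<partial>W t)"
    using F unfolding kernel_factorization_def by (elim bexE)
  note [measurable] = measurable_merge_restrict[OF pAC] measurable_restrict_subset[OF sub(3)]
  let ?\<kappa> = "\<lambda>a c. \<kappa> (restrict (merge A C (a, c)) p)"
  have k [measurable]: "(\<lambda>(a, c). ?\<kappa> a c) \<in> PiM A X \<Otimes>\<^sub>M PiM C X \<rightarrow>\<^sub>M prob_algebra (X v)"
    using measurable_compose[OF measurable_merge_restrict[OF pAC] kernel] by (simp add: case_prod_beta)
  have kd: "(\<lambda>(c, a). distr (?\<kappa> a c) (PiM (insert v A) X) (\<lambda>y. a(v := y)))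
      \<in> PiM C X \<Otimes>\<^sub>M PiM A X \<rightarrow>\<^sub>M prob_algebra (PiM (insert v A) X)"
    unfolding case_prod_beta by (rule measurable_distr_prob_space2[where M="X v"]) measurable
  define Q' where "Q' c = Q c \<bind> (\<lambda>a. distr (?\<kappa> a c) (PiM (insert v A) X) (\<lambda>y. a(v := y)))" for c
  have Q': "Q' \<in> PiM C X \<rightarrow>\<^sub>M prob_algebra (PiM (insert v A) X)"
    unfolding Q'_def[abs_def] by (rule measurable_bind_prob_space2[OF Q kd])
  have Q'_int: "(\<integral>\<^sup>+a. h a \<partial>Q' c) = (\<integral>\<^sup>+a. (\<integral>\<^sup>+y. h (a(v := y)) \<partial>?\<kappa> a c) \<partial>Q c)"
    if h [measurable]: "h \<in> borel_measurable (PiM (insert v A) X)" and c: "c \<in> space (PiM C X)" for h c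
  proof -
    note q = prob_algebraD[OF Q c]
    have kc: "(\<lambda>a. distr (?\<kappa> a c) (PiM (insert v A) X) (\<lambda>y. a(v := y))) \<in> PiM A X \<rightarrow>\<^sub>M prob_algebra (PiM (insert v A) X)"
      using measurable_Pair2[OF kd c] by simp
    have "(\<integral>\<^sup>+a. h a \<partial>Q' c) = (\<integral>\<^sup>+a. (\<integral>\<^sup>+a'. h a' \<partial>distr (?\<kappa> a c) (PiM (insert v A) X) (\<lambda>y. a(v := y))) \<partial>Q c)"
      unfolding Q'_def
      by (rule nn_integral_bind[OF h])
         (simp add: measurable_cong_sets[OF q(1) refl] measurable_prob_algebraD[OF kc])
    also have "\<dots> = (\<integral>\<^sup>+a. (\<integral>\<^sup>+y. h (a(v := y)) \<partial>?\<kappa> a c) \<partial>Q c)"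
    proof (intro nn_integral_cong nn_integral_distr)
      fix a assume "a \<in> space (Q c)"
      then have a: "a \<in> space (PiM A X)" by (simp add: q)
      have "(a, c) \<in> space (PiM A X \<Otimes>\<^sub>M PiM C X)" using a c by (simp add: space_pair_measure)
      from prob_algebraD(1)[OF k this] have "sets (?\<kappa> a c) = sets (X v)" by simp
      note cong = measurable_cong_sets[OF this refl]
      have "(\<lambda>y. a(v := y)) \<in> X v \<rightarrow>\<^sub>M PiM (insert v A) X" using a by measurable
      then show "(\<lambda>y. a(v := y)) \<in> ?\<kappa> a c \<rightarrow>\<^sub>M PiM (insert v A) X"
        by (simp only: cong)
    qed simp
    finally show ?thesis .
  qed
  show ?thesis
    unfolding kernel_factorization_def
  proof (intro bexI[OF _ Q'] ballI)
    fix t and f :: "('n \<Rightarrow> 'a) \<times> ('n \<Rightarrow> 'a) \<Rightarrow> ennreal"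
    assume t: "t \<in> T" and f [measurable]: "f \<in> borel_measurable (PiM (insert v A) X \<Otimes>\<^sub>M PiM D X)"
    have r: "(\<lambda>w. restrict w S) \<in> PiM (insert v N) X \<rightarrow>\<^sub>M PiM S X" if "S \<subseteq> insert v N" for S
      using that by (intro measurable_restrict_subset) auto
    have "C \<subseteq> insert v N" "D \<subseteq> insert v N" "insert v A \<subseteq> insert v N" using sub by auto
    note [measurable] = this[THEN r]
    define g where "g q = (\<integral>\<^sup>+y. f ((fst q)(v := y), snd q) \<partial>?\<kappa> (fst q) (restrict (snd q) C))" for q
    have g: "g \<in> borel_measurable (PiM A X \<Otimes>\<^sub>M PiM D X)"
      unfolding g_def[abs_def]
    proof (rule nn_integral_kernel_measurable[where N="X v"])
      have "(\<lambda>q. (fst q, restrict (snd q) C)) \<in> PiM A X \<Otimes>\<^sub>M PiM D X \<rightarrow>\<^sub>M PiM A X \<Otimes>\<^sub>M PiM C X"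
        by measurable
      from measurable_compose[OF this k]
      show "(\<lambda>q. ?\<kappa> (fst q) (restrict (snd q) C)) \<in> PiM A X \<Otimes>\<^sub>M PiM D X \<rightarrow>\<^sub>M prob_algebra (X v)"
        by simp
    qed measurable
    note DC = Int_absorb1[OF sub(3)] Int_absorb1[OF pAC]
    have fm: "(\<lambda>w. f (restrict w (insert v A), restrict w D)) \<in> borel_measurable (PiM (insert v N) X)"
      by (rule measurable_compose[OF measurable_Pair[OF r r] f]) (use sub in auto)
    have "(\<integral>\<^sup>+w. f (restrict w (insert v A), restrict w D) \<partial>W' t) = (\<integral>\<^sup>+w. g (restrict w A, restrict w D) \<partial>W t)"
      by (subst W'[OF t fm])
         (simp add: g_def DC restrict_upd_other vn)
    also have "\<dots> = (\<integral>\<^sup>+w. (\<integral>\<^sup>+a. g (a, restrict w D) \<partial>Q (restrict w C)) \<partial>W t)"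
      using eq t g by blast
    also have "\<dots> = (\<integral>\<^sup>+w. (\<integral>\<^sup>+a. f (a, restrict w D) \<partial>Q' (restrict w C)) \<partial>W t)"
    proof (rule nn_integral_cong)
      fix w assume "w \<in> space (W t)"
      then have w: "w \<in> space (PiM N X)" by (simp add: space_W t)
      have d: "restrict w D \<in> space (PiM D X)" by (rule restrict_space[OF sub(2) w])
      have c: "restrict w C \<in> space (PiM C X)" by (rule restrict_space[OF _ w]) (use sub in auto)
      have "(\<lambda>a. f (a, restrict w D)) \<in> borel_measurable (PiM (insert v A) X)" using d by measurable
      from Q'_int[OF this c]
      show "(\<integral>\<^sup>+a. g (a, restrict w D) \<partial>Q (restrict w C)) = (\<integral>\<^sup>+a. f (a, restrict w D) \<partial>Q' (restrict w C))"
        by (simp add: g_def DC)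
    qed
    also have "\<dots> = (\<integral>\<^sup>+w. (\<integral>\<^sup>+a. f (a, restrict w D) \<partial>Q' (restrict w C)) \<partial>W' t)"
    proof (subst W'[OF t])
      note [measurable] = Q'
      show "(\<lambda>w. \<integral>\<^sup>+a. f (a, restrict w D) \<partial>Q' (restrict w C)) \<in> borel_measurable (PiM (insert v N) X)"
        by (rule nn_integral_kernel_measurable[where N="PiM (insert v A) X"]) measurable
      show "(\<integral>\<^sup>+w. (\<integral>\<^sup>+a. f (a, restrict w D) \<partial>Q' (restrict w C)) \<partial>W t) =
        (\<integral>\<^sup>+w. \<integral>\<^sup>+y. (\<integral>\<^sup>+a. f (a, restrict (w(v := y)) D) \<partial>Q' (restrict (w(v := y)) C)) \<partial>\<kappa> (restrict w p) \<partial>W t)"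
      proof (rule nn_integral_cong)
        fix w assume "w \<in> space (W t)"
        then have "prob_space (\<kappa> (restrict w p))"
          using prob_algebraD(3)[OF kernel] restrict_space[OF p] by (simp add: space_W t)
        then show "(\<integral>\<^sup>+a. f (a, restrict w D) \<partial>Q' (restrict w C)) =
          (\<integral>\<^sup>+y. (\<integral>\<^sup>+a. f (a, restrict (w(v := y)) D) \<partial>Q' (restrict (w(v := y)) C)) \<partial>\<kappa> (restrict w p))"
          by (simp add: restrict_upd_other vn prob_space.emeasure_space_1)
      qed
    qed
    finally show "(\<integral>\<^sup>+w. f (restrict w (insert v A), restrict w D) \<partial>W' t) = \<dots>" .
  qed
qed

text \<open>
  Here \<open>v\<close> becomes part of the condition, while its kernel reads the \<open>A\<close>-block. The kernel \<open>R\<close> draws the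
  pair of the \<open>A\<close>-block and the new value, given \<open>C\<close> only, and the new \<open>Q'\<close> disintegrates \<open>R\<close> with respect
  to the new value. Its defining equation holds almost everywhere under \<open>R c\<close> for each \<open>c\<close>; integrating
  over the law of \<open>c\<close>, by the old factorization, turns this into the new factorization.
\<close>

lemma factorization_condition:
  assumes sub: "A \<subseteq> N" "D \<subseteq> N" "C \<subseteq> D" and F: "kernel_factorization X T W A D C"
    and pAC: "p \<subseteq> A \<union> C"
    and fin: "finite A" and std: "\<And>i. i \<in> insert v A \<Longrightarrow> standard_space (X i)"
  shows "kernel_factorization X T W' A (insert v D) (insert v C)"
proof -
  have vn: "v \<notin> A" "v \<notin> D" "v \<notin> C" using sub v by auto
  obtain Q where Q [measurable]: "Q \<in> PiM C X \<rightarrow>\<^sub>M prob_algebra (PiM A X)"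
    and eq: "\<forall>t\<in>T. \<forall>f\<in>borel_measurable (PiM A X \<Otimes>\<^sub>M PiM D X).
       (\<integral>\<^sup>+w. f (restrict w A, restrict w D) \<partial>W t) =
       (\<integral>\<^sup>+w. (\<integral>\<^sup>+a. f (a, restrict w D) \<partial>Q (restrict w C)) \<partial>W t)"
    using F unfolding kernel_factorization_def by (elim bexE)
  note [measurable] = measurable_merge_restrict[OF pAC] measurable_restrict_subset[OF sub(3)]
  let ?\<kappa> = "\<lambda>a c. \<kappa> (restrict (merge A C (a, c)) p)"
  have k [measurable]: "(\<lambda>(a, c). ?\<kappa> a c) \<in> PiM A X \<Otimes>\<^sub>M PiM C X \<rightarrow>\<^sub>M prob_algebra (X v)"
    using measurable_compose[OF measurable_merge_restrict[OF pAC] kernel] by (simp add: case_prod_beta)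
  have kd: "(\<lambda>(c, a). distr (?\<kappa> a c) (PiM A X \<Otimes>\<^sub>M X v) (\<lambda>y. (a, y)))
      \<in> PiM C X \<Otimes>\<^sub>M PiM A X \<rightarrow>\<^sub>M prob_algebra (PiM A X \<Otimes>\<^sub>M X v)"
    unfolding case_prod_beta by (rule measurable_distr_prob_space2[where M="X v"]) measurable
  define R where "R c = Q c \<bind> (\<lambda>a. distr (?\<kappa> a c) (PiM A X \<Otimes>\<^sub>M X v) (\<lambda>y. (a, y)))" for c
  have R: "R \<in> PiM C X \<rightarrow>\<^sub>M prob_algebra (PiM A X \<Otimes>\<^sub>M X v)"
    unfolding R_def[abs_def] by (rule measurable_bind_prob_space2[OF Q kd])
  have R_int: "(\<integral>\<^sup>+q. h q \<partial>R c) = (\<integral>\<^sup>+a. (\<integral>\<^sup>+y. h (a, y) \<partial>?\<kappa> a c) \<partial>Q c)"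
    if h [measurable]: "h \<in> borel_measurable (PiM A X \<Otimes>\<^sub>M X v)" and c: "c \<in> space (PiM C X)" for h c
  proof -
    note q = prob_algebraD[OF Q c]
    have kc: "(\<lambda>a. distr (?\<kappa> a c) (PiM A X \<Otimes>\<^sub>M X v) (\<lambda>y. (a, y))) \<in> PiM A X \<rightarrow>\<^sub>M prob_algebra (PiM A X \<Otimes>\<^sub>M X v)"
      using measurable_Pair2[OF kd c] by simp
    have "(\<integral>\<^sup>+q. h q \<partial>R c) = (\<integral>\<^sup>+a. (\<integral>\<^sup>+q. h q \<partial>distr (?\<kappa> a c) (PiM A X \<Otimes>\<^sub>M X v) (\<lambda>y. (a, y))) \<partial>Q c)"
      unfolding R_def
      by (rule nn_integral_bind[OF h])
         (simp add: measurable_cong_sets[OF q(1) refl] measurable_prob_algebraD[OF kc])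
    also have "\<dots> = (\<integral>\<^sup>+a. (\<integral>\<^sup>+y. h (a, y) \<partial>?\<kappa> a c) \<partial>Q c)"
    proof (intro nn_integral_cong nn_integral_distr)
      fix a assume "a \<in> space (Q c)"
      then have a: "a \<in> space (PiM A X)" by (simp add: q)
      have "(a, c) \<in> space (PiM A X \<Otimes>\<^sub>M PiM C X)" using a c by (simp add: space_pair_measure)
      from prob_algebraD(1)[OF k this] have "sets (?\<kappa> a c) = sets (X v)" by simp
      note cong = measurable_cong_sets[OF this refl]
      have "(\<lambda>y. (a, y)) \<in> X v \<rightarrow>\<^sub>M PiM A X \<Otimes>\<^sub>M X v" using a by measurable
      then show "(\<lambda>y. (a, y)) \<in> ?\<kappa> a c \<rightarrow>\<^sub>M PiM A X \<Otimes>\<^sub>M X v"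
        by (simp only: cong)
    qed simp
    finally show ?thesis .
  qed
  have "\<exists>Q' \<in> PiM C X \<Otimes>\<^sub>M X v \<rightarrow>\<^sub>M prob_algebra (PiM A X). \<forall>c\<in>space (PiM C X).
     \<forall>h\<in>borel_measurable (PiM A X \<Otimes>\<^sub>M X v).
       (\<integral>\<^sup>+q. h q \<partial>R c) = (\<integral>\<^sup>+q. (\<integral>\<^sup>+a. h (a, snd q) \<partial>Q' (c, snd q)) \<partial>R c)"
  \<comment> \<open>Some \<open>X v\<close> may be empty. A point of the parameter space makes the other spaces nonempty, because
    \<open>R\<close> is a probability measure there.\<close>
  proof (cases "space (PiM C X) = {}")
    case True
    then have "space (PiM C X \<Otimes>\<^sub>M X v) = {}" by (simp add: space_pair_measure)
    then have "(\<lambda>_. undefined) \<in> PiM C X \<Otimes>\<^sub>M X v \<rightarrow>\<^sub>M prob_algebra (PiM A X)"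
      by (simp add: measurable_def sets.sets_into_space)
    then show ?thesis by (rule bexI[rotated]) (simp add: True)
  next
    case False
    then obtain c where c: "c \<in> space (PiM C X)" by blast
    have "space (R c) \<noteq> {}" using prob_algebraD(3)[OF R c] by (rule prob_space.not_empty)
    then have ne: "space (PiM A X) \<noteq> {}" "space (X v) \<noteq> {}"
      using prob_algebraD(2)[OF R c] by (auto simp: space_pair_measure)
    show ?thesis
      by (rule disintegration[OF R PiM_standard_retract_real[OF fin _ ne(1)] standard_space_retract_real[OF _ ne(2)]])
         (use std in auto)
  qed
  then obtain Q' where Q'm [measurable]: "Q' \<in> PiM C X \<Otimes>\<^sub>M X v \<rightarrow>\<^sub>M prob_algebra (PiM A X)"
    and Q': "\<forall>c\<in>space (PiM C X). \<forall>h\<in>borel_measurable (PiM A X \<Otimes>\<^sub>M X v).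
       (\<integral>\<^sup>+q. h q \<partial>R c) = (\<integral>\<^sup>+q. (\<integral>\<^sup>+a. h (a, snd q) \<partial>Q' (c, snd q)) \<partial>R c)"
    by (elim bexE)
  have S: "(\<lambda>c. Q' (restrict c C, c v)) \<in> PiM (insert v C) X \<rightarrow>\<^sub>M prob_algebra (PiM A X)"
    by (rule measurable_compose[OF _ Q'm], rule measurable_Pair[OF measurable_restrict_subset])
       (auto intro: measurable_component_singleton)
  show ?thesis
    unfolding kernel_factorization_def
  proof (intro bexI[OF _ S] ballI)
    fix t and f :: "('n \<Rightarrow> 'a) \<times> ('n \<Rightarrow> 'a) \<Rightarrow> ennreal"
    assume t: "t \<in> T" and f [measurable]: "f \<in> borel_measurable (PiM A X \<Otimes>\<^sub>M PiM (insert v D) X)"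
    have r: "(\<lambda>w. restrict w S) \<in> PiM (insert v N) X \<rightarrow>\<^sub>M PiM S X" if "S \<subseteq> insert v N" for S
      using that by (intro measurable_restrict_subset) auto
    have "insert v C \<subseteq> insert v N" "insert v D \<subseteq> insert v N" "A \<subseteq> insert v N" using sub by auto
    note [measurable] = this[THEN r]
    have kD: "(\<lambda>q. ?\<kappa> (fst q) (restrict (snd q) C)) \<in> PiM A X \<Otimes>\<^sub>M PiM D X \<rightarrow>\<^sub>M prob_algebra (X v)"
    proof -
      have "(\<lambda>q. (fst q, restrict (snd q) C)) \<in> PiM A X \<Otimes>\<^sub>M PiM D X \<rightarrow>\<^sub>M PiM A X \<Otimes>\<^sub>M PiM C X"
        by measurable
      from measurable_compose[OF this k] show ?thesis by simp
    qed
    note DC = Int_absorb1[OF sub(3)] Int_absorb1[OF pAC]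
    define g where "g q = (\<integral>\<^sup>+y. f (fst q, (snd q)(v := y)) \<partial>?\<kappa> (fst q) (restrict (snd q) C))" for q
    have g: "g \<in> borel_measurable (PiM A X \<Otimes>\<^sub>M PiM D X)"
      unfolding g_def[abs_def]
      by (rule nn_integral_kernel_measurable[OF _ kD]) measurable
    \<comment> \<open>\<open>f'\<close> averages \<open>f\<close> over the \<open>A\<close>-block by the new kernel; \<open>g\<close> and \<open>g'\<close> average \<open>f\<close> and \<open>f'\<close> over the
      value of \<open>v\<close>.\<close>
    define f' where "f' q = (\<integral>\<^sup>+a. f (a, snd q) \<partial>Q' (restrict (snd q) C, snd q v))"
      for q :: "('n \<Rightarrow> 'a) \<times> ('n \<Rightarrow> 'a)"
    have f' [measurable]: "f' \<in> borel_measurable (PiM A X \<Otimes>\<^sub>M PiM (insert v D) X)"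
      unfolding f'_def[abs_def]
    proof (rule nn_integral_kernel_measurable[where N="PiM A X"])
      have [measurable]: "(\<lambda>d. restrict d C) \<in> PiM (insert v D) X \<rightarrow>\<^sub>M PiM C X"
        using sub(3) by (intro measurable_restrict_subset) auto
      show "(\<lambda>q. Q' (restrict (snd q) C, snd q v)) \<in> PiM A X \<Otimes>\<^sub>M PiM (insert v D) X \<rightarrow>\<^sub>M prob_algebra (PiM A X)"
        by measurable
    qed measurable
    define g' where "g' q = (\<integral>\<^sup>+y. f' (fst q, (snd q)(v := y)) \<partial>?\<kappa> (fst q) (restrict (snd q) C))" for q
    have g': "g' \<in> borel_measurable (PiM A X \<Otimes>\<^sub>M PiM D X)"
      unfolding g'_def[abs_def]
      by (rule nn_integral_kernel_measurable[OF _ kD]) measurable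
    have fm: "(\<lambda>w. h (restrict w A, restrict w (insert v D))) \<in> borel_measurable (PiM (insert v N) X)"
      if h: "h \<in> borel_measurable (PiM A X \<Otimes>\<^sub>M PiM (insert v D) X)" for h :: "_ \<Rightarrow> ennreal"
      by (rule measurable_compose[OF measurable_Pair[OF r r] h]) (use sub in auto)
    have "(\<integral>\<^sup>+w. f (restrict w A, restrict w (insert v D)) \<partial>W' t) = (\<integral>\<^sup>+w. g (restrict w A, restrict w D) \<partial>W t)"
      by (subst W'[OF t fm[OF f]])
         (simp add: g_def DC restrict_upd_other vn)
    also have "\<dots> = (\<integral>\<^sup>+w. (\<integral>\<^sup>+a. g (a, restrict w D) \<partial>Q (restrict w C)) \<partial>W t)"
      using eq t g by blast
    also have "\<dots> = (\<integral>\<^sup>+w. (\<integral>\<^sup>+a. g' (a, restrict w D) \<partial>Q (restrict w C)) \<partial>W t)"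
    proof (rule nn_integral_cong)
      fix w assume "w \<in> space (W t)"
      then have w: "w \<in> space (PiM N X)" by (simp add: space_W t)
      have d: "restrict w D \<in> space (PiM D X)" by (rule restrict_space[OF sub(2) w])
      have c: "restrict w C \<in> space (PiM C X)" by (rule restrict_space[OF _ w]) (use sub in auto)
      have h: "(\<lambda>q. f (fst q, (restrict w D)(v := snd q))) \<in> borel_measurable (PiM A X \<Otimes>\<^sub>M X v)"
        using d by measurable
      have h': "(\<lambda>q. f' (fst q, (restrict w D)(v := snd q))) \<in> borel_measurable (PiM A X \<Otimes>\<^sub>M X v)"
        using d by measurable
      have rd: "restrict ((restrict w D)(v := y)) C = restrict w C" for y
        using vn by (simp add: restrict_upd_other DC)
      have "(\<integral>\<^sup>+a. g (a, restrict w D) \<partial>Q (restrict w C)) = (\<integral>\<^sup>+q. f (fst q, (restrict w D)(v := snd q)) \<partial>R (restrict w C))"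
        by (simp add: R_int[OF h c] g_def DC)
      also have "\<dots> = (\<integral>\<^sup>+q. f' (fst q, (restrict w D)(v := snd q)) \<partial>R (restrict w C))"
        using Q'[rule_format, OF c h] by (simp add: f'_def rd)
      also have "\<dots> = (\<integral>\<^sup>+a. g' (a, restrict w D) \<partial>Q (restrict w C))"
        by (simp add: R_int[OF h' c] g'_def DC)
      finally show "(\<integral>\<^sup>+a. g (a, restrict w D) \<partial>Q (restrict w C)) = (\<integral>\<^sup>+a. g' (a, restrict w D) \<partial>Q (restrict w C))" .
    qed
    also have "\<dots> = (\<integral>\<^sup>+w. g' (restrict w A, restrict w D) \<partial>W t)"
      using eq t g' by auto
    also have "\<dots> = (\<integral>\<^sup>+w. f' (restrict w A, restrict w (insert v D)) \<partial>W' t)"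
      by (subst W'[OF t fm[OF f']])
         (simp add: g'_def DC restrict_upd_other vn)
    finally show "(\<integral>\<^sup>+w. f (restrict w A, restrict w (insert v D)) \<partial>W' t) =
      (\<integral>\<^sup>+w. (\<integral>\<^sup>+a. f (a, restrict w (insert v D))
         \<partial>Q' (restrict (restrict w (insert v C)) C, restrict w (insert v C) v)) \<partial>W' t)"
      using vn by (simp add: f'_def DC)
  qed
qed

end

section \<open>The factorization of the joint kernel\<close>

text \<open>
  The recursive form of a reversed topological order, which matches the recursion of the product of the
  node kernels and passes to tails.
\<close>

primrec (in cdag) children_first :: "'n list \<Rightarrow> bool" where
  "children_first [] \<longleftrightarrow> True"
| "children_first (v # us) \<longleftrightarrow> v \<in> V - set us \<and> parents E v \<subseteq> J \<union> set us \<and> children_first us"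

lemma (in cdag) children_first_rev_topological_order:
  assumes "topological_order V E vs"
  shows "children_first (rev vs)"
proof -
  have "children_first (rev (take n vs))" if "n \<le> length vs" for n
    using that
  proof (induction n)
    case (Suc n)
    have vs: "distinct vs" "set vs = V"
      and ord: "\<And>i j. i < length vs \<Longrightarrow> j < length vs \<Longrightarrow> (vs ! i, vs ! j) \<in> E \<Longrightarrow> i < j"
      using assms by (auto simp: topological_order_def)
    have n: "n < length vs" using Suc.prems by simp
    have "vs ! n \<notin> set (take n vs)"
      using vs(1) n by (auto simp: in_set_conv_nth nth_eq_iff_index_eq)
    moreover have "vs ! n \<in> V" using vs(2) n by auto
    moreover have "parents E (vs ! n) \<subseteq> J \<union> set (take n vs)"
    proof
      fix w assume "w \<in> parents E (vs ! n)"
      then have w: "(w, vs ! n) \<in> E" by (simp add: parents_def)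
      show "w \<in> J \<union> set (take n vs)"
      proof (cases "w \<in> J")
        case False
        then have "w \<in> set vs" using w edges vs by auto
        then obtain i where i: "i < length vs" "w = vs ! i" by (auto simp: in_set_conv_nth)
        then have "i < n" using w ord[OF i(1) n] by simp
        then show ?thesis using i n by (auto simp: in_set_conv_nth)
      qed simp
    qed
    ultimately show ?case using Suc n by (simp add: take_Suc_conv_app_nth)
  qed simp
  from this[of "length vs"] show ?thesis by simp
qed

context bayes_net
begin

lemma measurable_node_kernel:
  assumes "v \<in> V"
  shows "node_kernel X P v \<in> PiM (parents E v) X \<rightarrow>\<^sub>M prob_algebra (PiM {v} X)"
  unfolding node_kernel_def
  by (rule measurable_distr_prob_space2[where M="X v"], rule kernel[OF assms])
     (unfold case_prod_beta, rule measurable_restrict, auto)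

lemma measurable_list_kernel:
  assumes "children_first us"
  shows "list_kernel J E X P us \<in> PiM J X \<rightarrow>\<^sub>M prob_algebra (PiM (set us) X)"
  using assms
proof (induction us)
  case Nil
  then show ?case
    by (simp add: measurable_const space_prob_algebra prob_space_return space_PiM_empty)
next
  case (Cons v us)
  then have v: "v \<in> V" and us: "children_first us" and J: "(parents E v - set us) \<union> J = J" by auto
  show ?case
    using measurable_kernel_prod[OF measurable_node_kernel[OF v] Cons.IH[OF us]] by (simp add: J)
qed

text \<open>
  Keeping the deterministic inputs as coordinates lets a node read all its parents, inputs or not, from
  one configuration.
\<close>

definition full_law :: "'n list \<Rightarrow> ('n \<Rightarrow> 'a) \<Rightarrow> ('n \<Rightarrow> 'a) measure" where
  "full_law us xJ =
     distr (list_kernel J E X P us xJ) (PiM (set us \<union> J) X) (\<lambda>x. merge (set us) J (x, xJ))"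

lemma sets_full_law [simp]: "sets (full_law us xJ) = sets (PiM (set us \<union> J) X)"
  by (simp add: full_law_def)

lemma measurable_merge_input:
  assumes "xJ \<in> space (PiM J X)"
  shows "(\<lambda>x. merge U J (x, xJ)) \<in> PiM U X \<rightarrow>\<^sub>M PiM (U \<union> J) X"
  by (rule measurable_compose[OF _ measurable_merge]) (use assms in simp)

lemma nn_integral_full_law:
  assumes us: "children_first us" and xJ: "xJ \<in> space (PiM J X)"
    and f: "f \<in> borel_measurable (PiM (set us \<union> J) X)"
  shows "(\<integral>\<^sup>+w. f w \<partial>full_law us xJ) = (\<integral>\<^sup>+x. f (merge (set us) J (x, xJ)) \<partial>list_kernel J E X P us xJ)"
  unfolding full_law_def
proof (rule nn_integral_distr)
  note K = prob_algebraD[OF measurable_list_kernel[OF us] xJ]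
  show "(\<lambda>x. merge (set us) J (x, xJ)) \<in> list_kernel J E X P us xJ \<rightarrow>\<^sub>M PiM (set us \<union> J) X"
    using measurable_merge_input[OF xJ] by (simp only: measurable_cong_sets[OF K(1) refl])
qed (use f in simp)

lemma nn_integral_full_law_Cons:
  assumes us: "children_first (v # us)" and xJ: "xJ \<in> space (PiM J X)"
    and f: "f \<in> borel_measurable (PiM (insert v (set us \<union> J)) X)"
  shows "(\<integral>\<^sup>+w. f w \<partial>full_law (v # us) xJ) =
    (\<integral>\<^sup>+w. (\<integral>\<^sup>+y. f (w(v := y)) \<partial>P v (restrict w (parents E v))) \<partial>full_law us xJ)"
proof -
  let ?U = "set us" and ?p = "parents E v"
  let ?K = "list_kernel J E X P us xJ"
  have v: "v \<in> V" "v \<notin> ?U" "v \<notin> J" and p: "?p \<subseteq> ?U \<union> J" and us': "children_first us"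
    using us disjoint by auto
  note K = prob_algebraD[OF measurable_list_kernel[OF us'] xJ]
  note merge_xJ = measurable_merge_input[OF xJ]
  let ?m = "\<lambda>x. merge ?U J (x, xJ)"
  let ?\<kappa> = "\<lambda>x. P v (restrict (?m x) ?p)"
  let ?N = "\<lambda>x. distr (node_kernel X P v (restrict (?m x) ?p)) (PiM ({v} \<union> ?U) X) (\<lambda>z. merge {v} ?U (z, x))"
  have rm: "(\<lambda>x. restrict (?m x) ?p) \<in> PiM ?U X \<rightarrow>\<^sub>M PiM ?p X"
    by (rule measurable_compose[OF merge_xJ measurable_restrict_subset[OF p]])
  have N: "?N \<in> PiM ?U X \<rightarrow>\<^sub>M prob_algebra (PiM ({v} \<union> ?U) X)"
  proof (rule measurable_distr_prob_space2[where M="PiM {v} X"])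
    show "(\<lambda>x. node_kernel X P v (restrict (?m x) ?p)) \<in> PiM ?U X \<rightarrow>\<^sub>M prob_algebra (PiM {v} X)"
      by (rule measurable_compose[OF rm measurable_node_kernel[OF v(1)]])
    show "(\<lambda>(x, z). merge {v} ?U (z, x)) \<in> PiM ?U X \<Otimes>\<^sub>M PiM {v} X \<rightarrow>\<^sub>M PiM ({v} \<union> ?U) X"
      unfolding case_prod_beta by (rule measurable_compose[OF _ measurable_merge]) simp
  qed
  have pJ: "(?p - ?U) \<union> J = J" using p by auto
  have rJ: "restrict xJ J = xJ" using xJ by (simp add: space_PiM PiE_def extensional_restrict)
  have Keq: "list_kernel J E X P (v # us) xJ = ?K \<bind> ?N"
    by (simp only: list_kernel.simps kernel_prod_def pJ rJ)
  let ?g = "\<lambda>x. f (merge (insert v ?U) J (x, xJ))"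
  have g: "?g \<in> borel_measurable (PiM ({v} \<union> ?U) X)"
    using measurable_compose[OF merge_xJ[of "insert v ?U"]] f by simp
  have "(\<integral>\<^sup>+w. f w \<partial>full_law (v # us) xJ) = (\<integral>\<^sup>+x. ?g x \<partial>(?K \<bind> ?N))"
    using nn_integral_full_law[OF us xJ, of f] f by (simp only: Keq list.set Un_insert_left)
  also have "\<dots> = (\<integral>\<^sup>+x. (\<integral>\<^sup>+z. ?g z \<partial>?N x) \<partial>?K)"
    by (rule nn_integral_bind[OF g])
       (simp only: measurable_cong_sets[OF K(1) refl] measurable_prob_algebraD[OF N])
  also have "\<dots> = (\<integral>\<^sup>+x. (\<integral>\<^sup>+y. f ((?m x)(v := y)) \<partial>?\<kappa> x) \<partial>?K)"
  proof (rule nn_integral_cong)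
    fix x assume "x \<in> space ?K"
    then have x: "x \<in> space (PiM ?U X)" by (simp only: K)
    have rx: "restrict (?m x) ?p \<in> space (PiM ?p X)" by (rule measurable_space[OF rm x])
    note nk = prob_algebraD[OF measurable_node_kernel[OF v(1)] rx]
    note pk = prob_algebraD[OF kernel[OF v(1)] rx]
    have mz: "(\<lambda>z. merge {v} ?U (z, x)) \<in> PiM {v} X \<rightarrow>\<^sub>M PiM ({v} \<union> ?U) X"
      by (rule measurable_compose[OF _ measurable_merge]) (use x in simp)
    have my: "(\<lambda>z. \<lambda>i\<in>{v}. z) \<in> X v \<rightarrow>\<^sub>M PiM {v} X"
      by (rule measurable_restrict) simp
    have "(\<integral>\<^sup>+z. ?g z \<partial>?N x) = (\<integral>\<^sup>+z. ?g (merge {v} ?U (z, x)) \<partial>node_kernel X P v (restrict (?m x) ?p))"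
    proof (rule nn_integral_distr)
      show "(\<lambda>z. merge {v} ?U (z, x)) \<in> node_kernel X P v (restrict (?m x) ?p) \<rightarrow>\<^sub>M PiM ({v} \<union> ?U) X"
        using mz by (simp only: measurable_cong_sets[OF nk(1) refl])
    qed (use g in simp)
    also have "\<dots> = (\<integral>\<^sup>+y. ?g (merge {v} ?U (\<lambda>i\<in>{v}. y, x)) \<partial>?\<kappa> x)"
      unfolding node_kernel_def
    proof (rule nn_integral_distr)
      show "(\<lambda>z. \<lambda>i\<in>{v}. z) \<in> ?\<kappa> x \<rightarrow>\<^sub>M PiM {v} X"
        using my by (simp only: measurable_cong_sets[OF pk(1) refl])
      show "(\<lambda>z. ?g (merge {v} ?U (z, x))) \<in> borel_measurable (distr (?\<kappa> x) (PiM {v} X) (\<lambda>z. \<lambda>i\<in>{v}. z))"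
        using measurable_compose[OF mz g] by simp
    qed
    also have "\<dots> = (\<integral>\<^sup>+y. f ((?m x)(v := y)) \<partial>?\<kappa> x)"
    proof -
      have "merge (insert v ?U) J (merge {v} ?U (\<lambda>i\<in>{v}. y, x), xJ) = (?m x)(v := y)" for y
        using v by (auto simp: merge_def fun_eq_iff)
      then show ?thesis by simp
    qed
    finally show "(\<integral>\<^sup>+z. ?g z \<partial>?N x) = (\<integral>\<^sup>+y. f ((?m x)(v := y)) \<partial>?\<kappa> x)" .
  qed
  also have "\<dots> = (\<integral>\<^sup>+w. (\<integral>\<^sup>+y. f (w(v := y)) \<partial>P v (restrict w ?p)) \<partial>full_law us xJ)"
  proof (rule nn_integral_full_law[OF us' xJ, symmetric])
    show "(\<lambda>w. \<integral>\<^sup>+y. f (w(v := y)) \<partial>P v (restrict w ?p)) \<in> borel_measurable (PiM (?U \<union> J) X)"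
    proof (rule nn_integral_kernel_measurable)
      show "(\<lambda>w. P v (restrict w ?p)) \<in> PiM (?U \<union> J) X \<rightarrow>\<^sub>M prob_algebra (X v)"
        by (rule measurable_compose[OF measurable_restrict_subset[OF p] kernel[OF v(1)]])
      show "(\<lambda>(w, y). f (w(v := y))) \<in> borel_measurable (PiM (?U \<union> J) X \<Otimes>\<^sub>M X v)"
        using measurable_compose[OF measurable_add_dim f] by (simp add: case_prod_beta)
    qed
  qed
  finally show ?thesis .
qed

text \<open>
  The induction over the nodes. The input nodes all belong to \<open>D\<close>, so at the start the \<open>A\<close>-block is empty
  and \<open>Q\<close> is the kernel into the one-point space.
\<close>

proposition full_law_factorization:
  assumes sub: "A \<subseteq> V" "A \<inter> D = {}" "C \<subseteq> D" "J \<subseteq> D"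
    and left: "\<And>v. v \<in> A \<Longrightarrow> parents E v \<subseteq> A \<union> C"
    and right: "\<And>v. v \<in> D \<inter> V \<Longrightarrow> parents E v \<subseteq> D \<or> v \<in> C \<and> parents E v \<subseteq> A \<union> C"
    and us: "children_first us"
  shows "kernel_factorization X (space (PiM J X)) (full_law us)
     (A \<inter> (set us \<union> J)) (D \<inter> (set us \<union> J)) (C \<inter> (set us \<union> J))"
  using us
proof (induction us)
  case Nil
  have AJ: "A \<inter> J = {}" using sub disjoint by auto
  let ?u = "\<lambda>_. undefined"
  have "(\<lambda>_. return (PiM {} X) ?u) \<in> PiM (C \<inter> J) X \<rightarrow>\<^sub>M prob_algebra (PiM {} X)"
    by (rule measurable_const) (simp add: space_prob_algebra prob_space_return space_PiM_empty)
  then show ?case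
    unfolding kernel_factorization_def list.set Un_empty_left AJ
  proof (rule bexI[rotated], intro ballI)
    fix t and f :: "('n \<Rightarrow> 'a) \<times> ('n \<Rightarrow> 'a) \<Rightarrow> ennreal"
    assume f: "f \<in> borel_measurable (PiM {} X \<Otimes>\<^sub>M PiM (D \<inter> J) X)"
    show "(\<integral>\<^sup>+w. f (restrict w {}, restrict w (D \<inter> J)) \<partial>full_law [] t) =
      (\<integral>\<^sup>+w. (\<integral>\<^sup>+a. f (a, restrict w (D \<inter> J)) \<partial>return (PiM {} X) ?u) \<partial>full_law [] t)"
    proof (rule nn_integral_cong)
      fix w assume "w \<in> space (full_law [] t)"
      then have "restrict w (D \<inter> J) \<in> space (PiM (D \<inter> J) X)"
        by (auto simp: full_law_def space_PiM)
      then have "(\<lambda>a. f (a, restrict w (D \<inter> J))) \<in> borel_measurable (PiM {} X)"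
        by (rule measurable_Pair1[OF f])
      then show "f (restrict w {}, restrict w (D \<inter> J)) = (\<integral>\<^sup>+a. f (a, restrict w (D \<inter> J)) \<partial>return (PiM {} X) ?u)"
        by (subst nn_integral_return) (auto simp: space_PiM_empty restrict_def)
    qed
  qed
next
  case (Cons v us)
  let ?N = "set us \<union> J" and ?p = "parents E v"
  have vV: "v \<in> V" "v \<notin> ?N" and p: "?p \<subseteq> ?N" and us: "children_first us"
    using Cons.prems disjoint by auto
  interpret one_node_extension X ?N ?p v "P v" "space (PiM J X)" "full_law us" "full_law (v # us)"
    by unfold_locales
       (use vV p kernel nn_integral_full_law_Cons[OF Cons.prems] in auto)
  note IH = Cons.IH[OF us]
  have S: "A \<inter> ?N \<subseteq> ?N" "D \<inter> ?N \<subseteq> ?N" "C \<inter> ?N \<subseteq> D \<inter> ?N" using sub by auto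
  have N': "set (v # us) \<union> J = insert v ?N" by simp
  consider "v \<in> A" | "v \<notin> A" "v \<notin> D" | "v \<in> D" "?p \<subseteq> D" | "v \<in> C" "v \<in> D" "?p \<subseteq> A \<union> C"
    using right[of v] vV(1) by blast
  then show ?case
  proof cases
    case 1
    then have "v \<notin> D" "v \<notin> C" using sub by auto
    moreover have "?p \<subseteq> (A \<inter> ?N) \<union> (C \<inter> ?N)" using left[OF 1] p by auto
    ultimately show ?thesis
      using factorization_extend_left[OF S IH] 1 by (simp only: N' Int_insert_right if_True if_False)
  next
    case 2
    moreover have "v \<notin> C" using 2 sub by auto
    ultimately show ?thesis
      using factorization_ignore[OF S IH] by (simp only: N' Int_insert_right if_True if_False)
  next
    case 3
    have "v \<notin> A" using 3 sub by auto
    moreover have "?p \<subseteq> D \<inter> ?N" using 3 p by auto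
    moreover have "C \<inter> ?N \<subseteq> C \<inter> insert v ?N" "C \<inter> insert v ?N \<subseteq> insert v (D \<inter> ?N)" using sub by auto
    ultimately show ?thesis
      using factorization_extend_right[OF S IH, of "C \<inter> insert v ?N"] 3
      by (simp only: N' Int_insert_right[of A] Int_insert_right[of D] if_True if_False)
  next
    case 4
    have "v \<notin> A" using 4 sub by auto
    moreover have "?p \<subseteq> (A \<inter> ?N) \<union> (C \<inter> ?N)" using 4 p by auto
    moreover have "finite (A \<inter> ?N)" using sub(1) finite_V by (meson finite_Int finite_subset)
    moreover have "standard_space (X i)" if "i \<in> insert v (A \<inter> ?N)" for i
      using that vV sub standard by auto
    ultimately show ?thesis
      using factorization_condition[OF S IH] 4 by (simp only: N' Int_insert_right if_True if_False)
  qed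
qed

end

section \<open>Open walks and the split of the graph\<close>

text \<open>
  In contrast to a walk that is not d-blocked, an open walk carries no condition on its last node, whose
  status as a collider is decided by the next edge. Walks can thus be extended across a node of \<open>C\<close>.
\<close>

definition open_walk ::
  "'n set \<Rightarrow> ('n \<times> 'n) set \<Rightarrow> 'n set \<Rightarrow> 'n set \<Rightarrow> 'n list \<Rightarrow> ('n \<times> 'n) list \<Rightarrow> bool" where
  "open_walk N E A C ns es \<longleftrightarrow> is_walk N E ns es \<and> hd ns \<in> A \<and>
     (\<forall>k<length es. if is_collider ns es k then ns ! k \<in> ancestors E C else ns ! k \<notin> C)"

definition open_connected ::
  "'n set \<Rightarrow> ('n \<times> 'n) set \<Rightarrow> 'n set \<Rightarrow> 'n set \<Rightarrow> 'n \<Rightarrow> bool" where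
  "open_connected N E A C u \<longleftrightarrow> u \<notin> C \<and> (\<exists>ns es. open_walk N E A C ns es \<and> last ns = u)"

lemma walk_length:
  assumes "is_walk N E ns es"
  shows "length ns = Suc (length es)" "ns ! length es = last ns"
proof -
  show l: "length ns = Suc (length es)" using assms by (simp add: is_walk_def)
  then have "ns \<noteq> []" by auto
  then show "ns ! length es = last ns" using l by (simp add: last_conv_nth)
qed

lemma open_walk_imp_not_blocked:
  assumes w: "open_walk N E A C ns es" and C: "last ns \<notin> C"
  shows "\<not> d_blocked E ns es C"
proof
  assume "d_blocked E ns es C"
  then obtain k where k: "k < length ns"
    "\<not> is_collider ns es k \<and> ns ! k \<in> C \<or> is_collider ns es k \<and> ns ! k \<notin> ancestors E C"
    unfolding d_blocked_def by blast
  have l: "length ns = Suc (length es)" "ns ! length es = last ns"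
    using w walk_length unfolding open_walk_def by blast+
  show False
  proof (cases "k < length es")
    case True
    then have "if is_collider ns es k then ns ! k \<in> ancestors E C else ns ! k \<notin> C"
      using w by (simp add: open_walk_def)
    then show False using k(2) by (auto split: if_splits)
  next
    case False
    then have "k = length es" using k(1) l(1) by simp
    then show False using k(2) l(2) C by (simp add: is_collider_def)
  qed
qed

lemma d_separated_not_open_connected:
  assumes "d_separated N E A B C" "b \<in> B"
  shows "\<not> open_connected N E A C b"
proof
  assume "open_connected N E A C b"
  then obtain ns es where w: "open_walk N E A C ns es" "last ns = b" "b \<notin> C"
    unfolding open_connected_def by blast
  then have "\<not> d_blocked E ns es C" using open_walk_imp_not_blocked[OF w(1)] by simp
  then show False using assms w unfolding d_separated_def open_walk_def by blast
qed

lemma open_walk_singleton: "a \<in> A \<Longrightarrow> a \<in> N \<Longrightarrow> open_walk N E A C [a] []"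
  by (auto simp: open_walk_def is_walk_def)

lemma open_connected_start: "a \<in> A \<Longrightarrow> a \<in> N \<Longrightarrow> a \<notin> C \<Longrightarrow> open_connected N E A C a"
  unfolding open_connected_def
  by (intro conjI exI[of _ "[a]"] exI[of _ "[]"] open_walk_singleton) auto

text \<open>
  Attaching an edge decides the status of the former last node and of no other.
\<close>

lemma open_walk_extend:
  assumes walk: "open_walk N E A C ns es"
    and w: "w \<in> N" "last ns \<noteq> w" and ed: "ed \<in> E"
    and e: "ed = (last ns, w) \<and> last ns \<notin> C \<or> ed = (w, last ns) \<and>
      (if es \<noteq> [] \<and> snd (last es) = last ns then last ns \<in> ancestors E C else last ns \<notin> C)"
  shows "open_walk N E A C (ns @ [w]) (es @ [ed])"
proof -
  let ?ns = "ns @ [w]" and ?es = "es @ [ed]" and ?u = "last ns"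
  have walk0: "is_walk N E ns es" using walk by (simp add: open_walk_def)
  note l = walk_length[OF walk0]
  have walk': "is_walk N E ?ns ?es"
    unfolding is_walk_def
  proof (intro conjI allI impI)
    fix k assume "k < length ?es"
    then consider "k < length es" | "k = length es" by fastforce
    then show "?es ! k = (?ns ! k, ?ns ! Suc k) \<or> ?es ! k = (?ns ! Suc k, ?ns ! k)"
    proof cases
      case 1
      then show ?thesis using walk0 l by (auto simp: is_walk_def nth_append)
    next
      case 2
      then show ?thesis using l e by (auto simp: nth_append)
    qed
  qed (use walk0 l w ed in \<open>auto simp: is_walk_def\<close>)
  have "if is_collider ?ns ?es k then ?ns ! k \<in> ancestors E C else ?ns ! k \<notin> C" if k: "k < length ?es" for k
  proof (cases "k < length es")
    case True
    then have "is_collider ?ns ?es k \<longleftrightarrow> is_collider ns es k" "?ns ! k = ns ! k"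
      using l by (auto simp: is_collider_def nth_append)
    then show ?thesis using walk True by (simp add: open_walk_def)
  next
    case False
    then have k: "k = length es" using k by simp
    then have n: "?ns ! k = ?u" "?ns ! Suc k = w" "?es ! k = ed" using l by (auto simp: nth_append)
    have "?es ! (k - 1) = (?ns ! (k - 1), ?ns ! k) \<longleftrightarrow> snd (last es) = ?u" if "es \<noteq> []"
    proof -
      have "k \<noteq> 0" using that k by simp
      then obtain m where m: "k = Suc m" using not0_implies_Suc by blast
      have lm: "length es = Suc m" using k m by simp
      have last_es: "last es = es ! m" using lm last_conv_nth[OF that] by simp
      have u: "ns ! Suc m = ?u" using l(2) lm by simp
      have "es ! m = (ns ! m, ns ! Suc m) \<or> es ! m = (ns ! Suc m, ns ! m)"
        using walk0 lm by (simp add: is_walk_def)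
      then have orient: "last es = (ns ! m, ?u) \<or> last es = (?u, ns ! m)"
        by (simp only: last_es u)
      have es_m: "?es ! (k - 1) = last es" using m lm last_es by (simp add: nth_append)
      have ns_m: "?ns ! (k - 1) = ns ! m" using m lm l(1) by (simp add: nth_append)
      have "x = (a, b) \<or> x = (b, a) \<Longrightarrow> x = (a, b) \<longleftrightarrow> snd x = b" for x :: "'n \<times> 'n" and a b
        by auto
      from this[OF orient] show ?thesis unfolding es_m ns_m n(1) .
    qed
    then have coll: "is_collider ?ns ?es k \<longleftrightarrow> es \<noteq> [] \<and> snd (last es) = ?u \<and> ed = (w, ?u)"
      unfolding is_collider_def n(2,3) using k n(1) by (cases "es = []") simp_all
    show ?thesis
      unfolding coll n(1) using e w(2) by (cases "es \<noteq> [] \<and> snd (last es) = ?u") auto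
  qed
  moreover have "hd ?ns \<in> A" using walk l(1) by (cases ns) (auto simp: open_walk_def)
  ultimately show ?thesis
    unfolding open_walk_def using walk' by blast
qed

lemma open_connected_extend:
  assumes u: "open_connected N E A C u"
    and w: "w \<in> N" "w \<notin> C" "u \<noteq> w"
    and e: "(u, w) \<in> E \<or> (w, u) \<in> E \<and> u \<in> ancestors E C"
  shows "open_connected N E A C w"
proof -
  obtain ns es where ns: "open_walk N E A C ns es" "last ns = u" and uC: "u \<notin> C"
    using u unfolding open_connected_def by blast
  have "\<exists>ed. open_walk N E A C (ns @ [w]) (es @ [ed])"
    using e
  proof
    assume "(u, w) \<in> E"
    then show ?thesis
      by (intro exI[of _ "(u, w)"] open_walk_extend[OF ns(1) w(1)]) (use ns w uC in auto)
  next
    assume "(w, u) \<in> E \<and> u \<in> ancestors E C"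
    then show ?thesis
      by (intro exI[of _ "(w, u)"] open_walk_extend[OF ns(1) w(1)]) (use ns w uC in auto)
  qed
  then show ?thesis unfolding open_connected_def using w(2) by (metis last_snoc)
qed

text \<open>
  The walk passes through the common child as a collider.
\<close>

lemma open_connected_spouse:
  assumes u: "open_connected N E A C u"
    and w: "w \<in> N" "w \<notin> C" and v: "v \<in> N" "v \<in> C"
    and e: "(u, v) \<in> E" "(w, v) \<in> E"
  shows "open_connected N E A C w"
proof -
  obtain ns es where ns: "open_walk N E A C ns es" "last ns = u" and uC: "u \<notin> C"
    using u unfolding open_connected_def by blast
  have vC: "v \<in> ancestors E C" using v(2) unfolding ancestors_def by blast
  have ne: "u \<noteq> v" "v \<noteq> w" using uC w(2) v(2) by auto
  have "open_walk N E A C (ns @ [v]) (es @ [(u, v)])"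
    by (rule open_walk_extend[OF ns(1) v(1)]) (use ns ne e uC in auto)
  then have "open_walk N E A C ((ns @ [v]) @ [w]) ((es @ [(u, v)]) @ [(w, v)])"
    by (rule open_walk_extend[OF _ w(1)]) (use ne e vC in auto)
  then show ?thesis unfolding open_connected_def using w(2) by (metis last_snoc)
qed

lemma ancestors_step: "(u, w) \<in> E \<Longrightarrow> w \<in> ancestors E S \<Longrightarrow> u \<in> ancestors E S"
  unfolding ancestors_def by (auto intro: converse_rtrancl_into_rtrancl)

lemma ancestors_self: "S \<subseteq> ancestors E S"
  unfolding ancestors_def by auto

context cdag
begin

lemma rtrancl_nodes:
  assumes "(u, w) \<in> E\<^sup>*" "w \<in> J \<union> V"
  shows "u \<in> J \<union> V"
  using assms by (induction rule: converse_rtrancl_induct) (use edges in auto)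

lemma no_loop: "(u, w) \<in> E \<Longrightarrow> u \<noteq> w"
  using acyclic r_into_trancl[of u w E] by (auto simp: acyclic_def)

text \<open>
  A directed path that starts outside the ancestors of \<open>C\<close> never meets \<open>C\<close>, and following it makes no
  colliders.
\<close>

lemma open_connected_down:
  assumes "(u, b) \<in> E\<^sup>*" "open_connected (J \<union> V) E A C u" "u \<notin> ancestors E C"
  shows "open_connected (J \<union> V) E A C b"
  using assms
proof (induction rule: converse_rtrancl_induct)
  case (step u w)
  have w: "w \<notin> ancestors E C" using step.prems(2) ancestors_step[OF step.hyps(1)] by blast
  moreover have "w \<notin> C" using w unfolding ancestors_def by blast
  moreover have "w \<in> J \<union> V" using step.hyps(1) edges by auto
  ultimately show ?case
    using step.hyps(1) no_loop[OF step.hyps(1)]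
    by (intro step.IH open_connected_extend[OF step.prems(1)]) auto
qed

text \<open>
  Walking a directed path backwards from \<open>a\<close> to \<open>u\<close> and on to the parent \<open>w\<close> makes no colliders. The
  induction keeps track of the direction of the last edge, as \<open>u\<close> must not become a collider in the
  last step.
\<close>

lemma open_connected_up:
  assumes "(u, a) \<in> E\<^sup>*" "a \<in> A" "a \<in> J \<union> V" "u \<notin> ancestors E C"
    and w: "(w, u) \<in> E" "w \<notin> C"
  shows "open_connected (J \<union> V) E A C w"
proof -
  have "\<exists>ns es. open_walk (J \<union> V) E A C ns es \<and> last ns = u \<and> (es = [] \<or> snd (last es) \<noteq> u)"
    using assms(1,4)
  proof (induction rule: converse_rtrancl_induct)
    case base
    have "open_walk (J \<union> V) E A C [a] []" using open_walk_singleton assms(2,3) .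
    then show ?case by (intro exI[of _ "[a]"] exI[of _ "[]"]) simp
  next
    case (step u w)
    have wC: "w \<notin> ancestors E C" using step.prems ancestors_step[OF step.hyps(1)] by blast
    then obtain ns es where ns: "open_walk (J \<union> V) E A C ns es" "last ns = w" "es = [] \<or> snd (last es) \<noteq> w"
      using step.IH by blast
    have "w \<notin> C" using wC unfolding ancestors_def by blast
    moreover have "u \<in> J \<union> V" "u \<noteq> w" using step.hyps(1) edges no_loop by auto
    ultimately have "open_walk (J \<union> V) E A C (ns @ [u]) (es @ [(u, w)])"
      by (intro open_walk_extend[OF ns(1)]) (use ns step.hyps(1) in auto)
    then show ?case using \<open>u \<noteq> w\<close> by (intro exI[of _ "ns @ [u]"] exI[of _ "es @ [(u, w)]"]) auto
  qed
  then obtain ns es where ns: "open_walk (J \<union> V) E A C ns es" "last ns = u" "es = [] \<or> snd (last es) \<noteq> u"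
    by blast
  have uC: "u \<notin> C" using assms(4) unfolding ancestors_def by blast
  have "w \<in> J \<union> V" using w edges by auto
  then have "open_walk (J \<union> V) E A C (ns @ [w]) (es @ [(w, u)])"
    by (rule open_walk_extend[OF ns(1)]) (use ns w no_loop[OF w(1)] uC in auto)
  then show ?thesis
    unfolding open_connected_def using w(2)
    by (intro conjI exI[of _ "ns @ [w]"] exI[of _ "es @ [(w, u)]"]) simp_all
qed

text \<open>
  The set \<open>A'\<close> consists of the ancestors of \<open>A \<union> B \<union> C \<union> J\<close> to which an open walk leads from \<open>A\<close>. The point is
  that \<open>A'\<close> is closed under passing to parents outside \<open>C\<close>. An open walk to \<open>u\<close> may arrive with an arrow
  into \<open>u\<close>, and then it continues to a parent only if \<open>u\<close> is an ancestor of \<open>C\<close>. Otherwise \<open>u\<close> is an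
  ancestor of \<open>A\<close> or of \<open>B \<union> J\<close>. The latter is impossible, since the walk would continue downwards to
  \<open>B \<union> J\<close>; in the former case the parent is reached by a new walk that climbs from \<open>A\<close> through \<open>u\<close>.
\<close>

lemma id_separated_split:
  assumes sep: "id_separated J V E A B C" and sub: "A \<subseteq> J \<union> V" "B \<subseteq> J \<union> V" "C \<subseteq> J \<union> V"
  obtains A' D where "A' \<subseteq> V" "A' \<inter> D = {}" "A \<subseteq> A' \<union> C" "B \<union> C \<union> J \<subseteq> D" "D \<subseteq> J \<union> V"
    "\<And>v. v \<in> A' \<Longrightarrow> parents E v \<subseteq> A' \<union> C"
    "\<And>v. v \<in> D \<inter> V \<Longrightarrow> parents E v \<subseteq> D \<or> v \<in> C \<and> parents E v \<subseteq> A' \<union> C"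
proof -
  define conn where "conn = open_connected (J \<union> V) E A C"
  define N where "N = ancestors E (A \<union> B \<union> J \<union> C)"
  define A' where "A' = {u \<in> N. conn u}"
  define D where "D = N - A'"
  have sep': "\<not> conn b" if "b \<in> B \<union> J" for b
    using sep that unfolding id_separated_def conn_def by (rule d_separated_not_open_connected)
  have self: "A \<union> B \<union> J \<union> C \<subseteq> N" unfolding N_def by (rule ancestors_self)
  have NJV: "N \<subseteq> J \<union> V"
    unfolding N_def ancestors_def using sub rtrancl_nodes by blast
  have Npar: "w \<in> N" if "(w, u) \<in> E" "u \<in> N" for u w
    using that unfolding N_def by (rule ancestors_step)
  have notC: "u \<notin> C" if "conn u" for u
    using that unfolding conn_def open_connected_def by blast
  have par: "w \<in> A'" if u: "u \<in> A'" and e: "(w, u) \<in> E" and w: "w \<notin> C" for u w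
  proof -
    have uN: "u \<in> N" and cu: "conn u" using u by (auto simp: A'_def)
    have wN: "w \<in> N" by (rule Npar[OF e uN])
    then have wJV: "w \<in> J \<union> V" using NJV by auto
    have "conn w"
    proof (cases "u \<in> ancestors E C")
      case True
      then show ?thesis
        using open_connected_extend[of "J \<union> V" E A C u w] cu wJV w e no_loop[OF e] unfolding conn_def by blast
    next
      case uC: False
      obtain s where s: "s \<in> A \<union> B \<union> J \<union> C" "(u, s) \<in> E\<^sup>*"
        using uN unfolding N_def ancestors_def by blast
      have "s \<notin> C" using s uC unfolding ancestors_def by blast
      moreover have "s \<notin> B \<union> J"
        using sep'[of s] open_connected_down[OF s(2) cu[unfolded conn_def] uC] unfolding conn_def by blast
      ultimately have "s \<in> A" using s(1) by blast
      then show ?thesis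
        unfolding conn_def using sub(1) by (intro open_connected_up[OF s(2) _ _ uC e w]) auto
    qed
    then show ?thesis using wN by (simp add: A'_def)
  qed
  have child: "u \<in> A'" if v: "v \<in> A'" and e: "(v, u) \<in> E" and u: "u \<in> N" "u \<notin> C" for u v
    using open_connected_extend[of "J \<union> V" E A C v u] v e u NJV no_loop[OF e] unfolding A'_def conn_def by blast
  have spouse: "u \<in> A'"
    if w: "w \<in> A'" and e: "(w, v) \<in> E" "(u, v) \<in> E" and v: "v \<in> C" and u: "u \<notin> C" for u v w
  proof -
    have JV: "u \<in> J \<union> V" "v \<in> J \<union> V" using e edges by auto
    have "u \<in> N" using Npar[OF e(2)] self v by blast
    moreover have "conn u" using open_connected_spouse[of "J \<union> V" E A C w u v] w e u v JV
      unfolding A'_def conn_def by blast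
    ultimately show ?thesis by (simp add: A'_def)
  qed
  show ?thesis
  proof (rule that)
    show "A' \<subseteq> V" using NJV sep' unfolding A'_def by blast
    show "A' \<inter> D = {}" unfolding D_def by blast
    show "A \<subseteq> A' \<union> C"
      using self sub(1) open_connected_start[of _ A "J \<union> V" C E] unfolding A'_def conn_def by blast
    show "B \<union> C \<union> J \<subseteq> D" using self sep' notC unfolding D_def A'_def by blast
    show "D \<subseteq> J \<union> V" using NJV unfolding D_def by blast
    show "parents E v \<subseteq> A' \<union> C" if "v \<in> A'" for v
      using par[OF that] unfolding parents_def by blast
    show "parents E v \<subseteq> D \<or> v \<in> C \<and> parents E v \<subseteq> A' \<union> C" if v: "v \<in> D \<inter> V" for v
    proof (cases "parents E v \<inter> A' = {}")
      case True
      then show ?thesis using Npar v unfolding D_def parents_def by blast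
    next
      case False
      then obtain w where w: "w \<in> A'" "(w, v) \<in> E" unfolding parents_def by blast
      have "v \<in> C" using child[OF w] v unfolding D_def by blast
      then show ?thesis using spouse[OF w] unfolding parents_def by blast
    qed
  qed
qed

end

section \<open>Transitional conditional independence\<close>

text \<open>
  The coordinates of \<open>A\<close> are read off those of \<open>A'\<close> and \<open>C\<close>, so the kernel for \<open>A\<close> is an image of \<open>Q\<close>; it is
  deterministic on \<open>A \<inter> C\<close>.
\<close>

lemma (in bayes_net) trans_cond_indep_of_factorization:
  assumes us: "children_first us" "set us = V"
    and F: "kernel_factorization X (space (PiM J X)) (full_law us) A' D C"
    and sub: "A \<subseteq> A' \<union> C" "B \<subseteq> D" "C \<subseteq> D" "A' \<subseteq> J \<union> V" "D \<subseteq> J \<union> V"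
  shows "trans_cond_indep J V X (list_kernel J E X P us) A B C"
proof -
  obtain Q where Q: "Q \<in> PiM C X \<rightarrow>\<^sub>M prob_algebra (PiM A' X)"
    and eq: "\<forall>t\<in>space (PiM J X). \<forall>f\<in>borel_measurable (PiM A' X \<Otimes>\<^sub>M PiM D X).
       (\<integral>\<^sup>+w. f (restrict w A', restrict w D) \<partial>full_law us t) =
       (\<integral>\<^sup>+w. (\<integral>\<^sup>+a. f (a, restrict w D) \<partial>Q (restrict w C)) \<partial>full_law us t)"
    using F unfolding kernel_factorization_def by (elim bexE)
  let ?r = "\<lambda>a c. restrict (merge A' C (a, c)) A"
  have r: "(\<lambda>p. ?r (fst p) (snd p)) \<in> PiM A' X \<Otimes>\<^sub>M PiM C X \<rightarrow>\<^sub>M PiM A X"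
    unfolding prod.collapse by (rule measurable_compose[OF measurable_merge measurable_restrict_subset[OF sub(1)]])
  define Q' where "Q' c = distr (Q c) (PiM A X) (\<lambda>a. ?r a c)" for c
  have Q': "Q' \<in> PiM C X \<rightarrow>\<^sub>M prob_algebra (PiM A X)"
    unfolding Q'_def[abs_def]
  proof (rule measurable_distr_prob_space2[OF Q])
    show "(\<lambda>(c, a). ?r a c) \<in> PiM C X \<Otimes>\<^sub>M PiM A' X \<rightarrow>\<^sub>M PiM A X"
      using measurable_compose[OF measurable_Pair[OF measurable_snd measurable_fst] r]
      by (simp add: case_prod_beta)
  qed
  have rest: "(\<lambda>w. restrict w S) \<in> PiM S' X \<rightarrow>\<^sub>M PiM S X" if "S \<subseteq> S'" for S S'
    using that by (rule measurable_restrict_subset)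
  have AJV: "A \<subseteq> J \<union> V" and BJV: "B \<subseteq> J \<union> V" and CJV: "C \<subseteq> J \<union> V" using sub by blast+
  show ?thesis
    unfolding trans_cond_indep_def
  proof (rule bexI[OF _ Q'], intro ballI)
    fix xJ and F G H :: "('n \<Rightarrow> 'a) set"
    assume xJ: "xJ \<in> space (PiM J X)" and F: "F \<in> sets (PiM A X)"
      and G: "G \<in> sets (PiM B X)" and H: "H \<in> sets (PiM C X)"
    let ?K = "list_kernel J E X P us xJ" and ?m = "\<lambda>x. merge V J (x, xJ)"
    note K = prob_algebraD[OF measurable_list_kernel[OF us(1)] xJ, unfolded us(2)]
    have full: "(\<integral>\<^sup>+w. f w \<partial>full_law us xJ) = (\<integral>\<^sup>+x. f (?m x) \<partial>?K)"
      if "f \<in> borel_measurable (PiM (J \<union> V) X)" for f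
      using nn_integral_full_law[OF us(1) xJ, of f] that by (simp add: us(2) Un_commute)
    have m: "?m \<in> ?K \<rightarrow>\<^sub>M PiM (J \<union> V) X"
      using measurable_merge_input[OF xJ, of V]
      by (simp add: measurable_cong_sets[OF K(1) refl] Un_commute)
    have pr: "(\<lambda>x. proj V J S x xJ) \<in> ?K \<rightarrow>\<^sub>M PiM S X" if "S \<subseteq> J \<union> V" for S
      unfolding proj_def by (rule measurable_compose[OF m rest[OF that]])
    define f where "f p = indicator F (?r (fst p) (restrict (snd p) C)) *
        (indicator G (restrict (snd p) B) * indicator H (restrict (snd p) C) :: ennreal)" for p
    have rD: "(\<lambda>p. restrict (snd p) S) \<in> PiM A' X \<Otimes>\<^sub>M PiM D X \<rightarrow>\<^sub>M PiM S X" if "S \<subseteq> D" for S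
      by (rule measurable_compose[OF measurable_snd rest[OF that]])
    have f1: "(\<lambda>p. ?r (fst p) (restrict (snd p) C)) \<in> PiM A' X \<Otimes>\<^sub>M PiM D X \<rightarrow>\<^sub>M PiM A X"
      using measurable_compose[OF measurable_Pair[OF measurable_fst rD[OF sub(3)]] r] by simp
    have f: "f \<in> borel_measurable (PiM A' X \<Otimes>\<^sub>M PiM D X)"
      unfolding f_def[abs_def]
      by (intro borel_measurable_times_ennreal measurable_compose[OF f1 borel_measurable_indicator[OF F]]
            measurable_compose[OF rD[OF sub(2)] borel_measurable_indicator[OF G]]
            measurable_compose[OF rD[OF sub(3)] borel_measurable_indicator[OF H]])
    have fA: "f (restrict w A', restrict w D) = indicator F (restrict w A) * (indicator G (restrict w B) * indicator H (restrict w C))" for w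
    proof -
      have "?r (restrict w A') (restrict w C) = restrict w A"
        using sub(1) by (auto simp: restrict_def merge_def fun_eq_iff)
      then show ?thesis by (simp add: f_def Int_absorb1[OF sub(2)] Int_absorb1[OF sub(3)])
    qed
    have fQ: "(\<integral>\<^sup>+a. f (a, restrict w D) \<partial>Q (restrict w C)) =
       indicator G (restrict w B) * indicator H (restrict w C) * emeasure (Q' (restrict w C)) F"
      if w: "w \<in> space (PiM (J \<union> V) X)" for w
    proof -
      have c: "restrict w C \<in> space (PiM C X)" by (rule measurable_space[OF rest[OF CJV] w])
      note q = prob_algebraD[OF Q c]
      have rc: "(\<lambda>a. ?r a (restrict w C)) \<in> Q (restrict w C) \<rightarrow>\<^sub>M PiM A X"
        using measurable_Pair1[OF r c] by (simp add: measurable_cong_sets[OF q(1) refl])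
      have iF: "(\<lambda>a. indicator F (?r a (restrict w C)) :: ennreal) \<in> borel_measurable (Q (restrict w C))"
        by (rule measurable_compose[OF rc borel_measurable_indicator[OF F]])
      have "(\<integral>\<^sup>+a. f (a, restrict w D) \<partial>Q (restrict w C)) =
        (\<integral>\<^sup>+a. indicator F (?r a (restrict w C)) *
           (indicator G (restrict w B) * indicator H (restrict w C)) \<partial>Q (restrict w C))"
        by (simp add: f_def Int_absorb1[OF sub(2)] Int_absorb1[OF sub(3)] del: merge_restrict restrict_merge)
      also have "\<dots> = (\<integral>\<^sup>+a. indicator F (?r a (restrict w C)) \<partial>Q (restrict w C)) *
           (indicator G (restrict w B) * indicator H (restrict w C))"
        by (rule nn_integral_multc[OF iF])
      also have "(\<integral>\<^sup>+a. indicator F (?r a (restrict w C)) \<partial>Q (restrict w C)) = (\<integral>\<^sup>+a. indicator F a \<partial>Q' (restrict w C))"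
        unfolding Q'_def by (rule nn_integral_distr[OF rc, symmetric]) (use F in simp)
      also have "\<dots> = emeasure (Q' (restrict w C)) F"
        using F by (intro nn_integral_indicator) (simp add: Q'_def)
      finally show ?thesis by (simp only: mult.commute)
    qed
    have lhs: "(\<lambda>x. (proj V J A x xJ, proj V J B x xJ, proj V J C x xJ)) \<in> ?K \<rightarrow>\<^sub>M PiM A X \<Otimes>\<^sub>M PiM B X \<Otimes>\<^sub>M PiM C X"
      by (intro measurable_Pair pr AJV BJV CJV)
    have rhs: "(\<lambda>x. (proj V J B x xJ, proj V J C x xJ)) \<in> ?K \<rightarrow>\<^sub>M PiM B X \<Otimes>\<^sub>M PiM C X"
      by (intro measurable_Pair pr BJV CJV)
    have FGH: "F \<times> G \<times> H \<in> sets (PiM A X \<Otimes>\<^sub>M PiM B X \<Otimes>\<^sub>M PiM C X)"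
      using F G H by (intro pair_measureI)
    have "emeasure (distr ?K (PiM A X \<Otimes>\<^sub>M PiM B X \<Otimes>\<^sub>M PiM C X)
        (\<lambda>x. (proj V J A x xJ, proj V J B x xJ, proj V J C x xJ))) (F \<times> G \<times> H)
      = (\<integral>\<^sup>+p. indicator (F \<times> G \<times> H) p \<partial>distr ?K (PiM A X \<Otimes>\<^sub>M PiM B X \<Otimes>\<^sub>M PiM C X)
        (\<lambda>x. (proj V J A x xJ, proj V J B x xJ, proj V J C x xJ)))"
      using FGH by (intro nn_integral_indicator[symmetric]) simp
    also have "\<dots> = (\<integral>\<^sup>+x. indicator (F \<times> G \<times> H) (proj V J A x xJ, proj V J B x xJ, proj V J C x xJ) \<partial>?K)"
      by (rule nn_integral_distr[OF lhs]) (use FGH in simp)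
    also have "\<dots> = (\<integral>\<^sup>+x. f (restrict (?m x) A', restrict (?m x) D) \<partial>?K)"
      by (rule nn_integral_cong) (simp only: fA proj_def indicator_times mult.assoc fst_conv snd_conv)
    also have "\<dots> = (\<integral>\<^sup>+w. f (restrict w A', restrict w D) \<partial>full_law us xJ)"
      by (rule full[symmetric], rule measurable_compose[OF measurable_Pair[OF rest[OF sub(4)] rest[OF sub(5)]] f])
    also have "\<dots> = (\<integral>\<^sup>+w. (\<integral>\<^sup>+a. f (a, restrict w D) \<partial>Q (restrict w C)) \<partial>full_law us xJ)"
      by (rule eq[rule_format, OF xJ f])
    also have "\<dots> = (\<integral>\<^sup>+x. (\<integral>\<^sup>+a. f (a, restrict (?m x) D) \<partial>Q (restrict (?m x) C)) \<partial>?K)"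
    proof (rule full)
      show "(\<lambda>w. \<integral>\<^sup>+a. f (a, restrict w D) \<partial>Q (restrict w C)) \<in> borel_measurable (PiM (J \<union> V) X)"
      proof (rule nn_integral_kernel_measurable)
        show "(\<lambda>w. Q (restrict w C)) \<in> PiM (J \<union> V) X \<rightarrow>\<^sub>M prob_algebra (PiM A' X)"
          by (rule measurable_compose[OF rest[OF CJV] Q])
        show "(\<lambda>(w, a). f (a, restrict w D)) \<in> borel_measurable (PiM (J \<union> V) X \<Otimes>\<^sub>M PiM A' X)"
          unfolding case_prod_beta
          by (rule measurable_compose[OF measurable_Pair[OF measurable_snd measurable_compose[OF measurable_fst rest[OF sub(5)]]] f])
      qed
    qed
    also have "\<dots> = (\<integral>\<^sup>+x. indicator G (proj V J B x xJ) * indicator H (proj V J C x xJ) *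
         emeasure (Q' (proj V J C x xJ)) F \<partial>?K)"
      unfolding proj_def by (intro nn_integral_cong fQ measurable_space[OF m])
    also have "\<dots> = (\<integral>\<^sup>+p. indicator G (fst p) * indicator H (snd p) * emeasure (Q' (snd p)) F
        \<partial>distr ?K (PiM B X \<Otimes>\<^sub>M PiM C X) (\<lambda>x. (proj V J B x xJ, proj V J C x xJ)))"
    proof (subst nn_integral_distr[OF rhs])
      have "(\<lambda>c. emeasure (Q' c) F) \<in> borel_measurable (PiM C X)"
        by (rule measurable_compose[OF measurable_prob_algebraD[OF Q'] measurable_emeasure_subprob_algebra[OF F]])
      then show "(\<lambda>p. indicator G (fst p) * indicator H (snd p) * emeasure (Q' (snd p)) F) \<in>
         borel_measurable (distr ?K (PiM B X \<Otimes>\<^sub>M PiM C X) (\<lambda>x. (proj V J B x xJ, proj V J C x xJ)))"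
        using G H by measurable
    qed simp
    finally show "emeasure (distr ?K (PiM A X \<Otimes>\<^sub>M PiM B X \<Otimes>\<^sub>M PiM C X)
        (\<lambda>x. (proj V J A x xJ, proj V J B x xJ, proj V J C x xJ))) (F \<times> G \<times> H)
      = (\<integral>\<^sup>+(b, c). indicator G b * indicator H c * emeasure (Q' c) F
        \<partial>distr ?K (PiM B X \<Otimes>\<^sub>M PiM C X) (\<lambda>x. (proj V J B x xJ, proj V J C x xJ)))"
      by (simp only: case_prod_unfold)
  qed
qed

theorem theorem5p18:
  fixes J V :: "'n set" and E :: "('n \<times> 'n) set"
    and X :: "'n \<Rightarrow> 'a measure" and P :: "'n \<Rightarrow> ('n \<Rightarrow> 'a) \<Rightarrow> 'a measure"
    and vs :: "'n list" and A B C :: "'n set"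
  assumes "bayes_net J V E X P"
    and "topological_order V E vs"
    and "A \<subseteq> J \<union> V" and "B \<subseteq> J \<union> V" and "C \<subseteq> J \<union> V"
    and "id_separated J V E A B C"
  shows "trans_cond_indep J V X (joint_kernel J E X P vs) A B C"
proof -
  interpret bayes_net J V E X P by (rule assms(1))
  obtain A' D where A': "A' \<subseteq> V" "A' \<inter> D = {}" "A \<subseteq> A' \<union> C" and D: "B \<union> C \<union> J \<subseteq> D" "D \<subseteq> J \<union> V"
    and left: "\<And>v. v \<in> A' \<Longrightarrow> parents E v \<subseteq> A' \<union> C"
    and right: "\<And>v. v \<in> D \<inter> V \<Longrightarrow> parents E v \<subseteq> D \<or> v \<in> C \<and> parents E v \<subseteq> A' \<union> C"
    using id_separated_split[OF assms(6,3,4,5)] by metis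
  have us: "children_first (rev vs)" "set (rev vs) = V"
    using children_first_rev_topological_order[OF assms(2)] assms(2) by (auto simp: topological_order_def)
  have all: "A' \<inter> (V \<union> J) = A'" "D \<inter> (V \<union> J) = D" "C \<inter> (V \<union> J) = C" using A' D assms(5) by auto
  have "C \<subseteq> D" "J \<subseteq> D" "B \<subseteq> D" using D by auto
  have "kernel_factorization X (space (PiM J X)) (full_law (rev vs)) A' D C"
    using full_law_factorization[OF A'(1,2) \<open>C \<subseteq> D\<close> \<open>J \<subseteq> D\<close> left right us(1)] by (simp only: us(2) all)
  then show ?thesis
    unfolding joint_kernel_def
    by (rule trans_cond_indep_of_factorization[OF us _ A'(3) \<open>B \<subseteq> D\<close> \<open>C \<subseteq> D\<close> _ D(2)]) (use A' in auto)
qed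

end
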